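(* Let $T(\mathcal{O}_q(G(m,n)))$ be the twist of the $\mathbb{Z}^n$-graded algebra $\mathcal{O}_q(G(m,n))$ by the $2$-cocycle $c$ given by $c((s_1,\dots,s_n),(t_1,\dots,t_n))=\prod_{j\neq n}p^{s_nt_j}$. Then there is an isomorphism of $\mathbb{K}$-algebras $$\theta: T(\mathcal{O}_q(G(m,n)))\longrightarrow \mathcal{O}_q(G(m,n))$$ such that, for every $1\le i_1<\dots<i_m\le n$: if $i_m<n$ then $\theta([i_1,\dots,i_m]')=[i_1+1,\dots,i_m+1]$; and if $i_m=n$ then $\theta([i_1,\dots,i_{m-1},n]')=q^{-2}[1,i_1+1,\dots,i_{m-1}+1]$.
   Context: $\mathbb{K}$ is a field, $\mathbb{K}^*=\mathbb{K}\setminus\{0\}$, $q\in\mathbb{K}^*$, $m<n$ are positive integers, and $p\in\mathbb{K}$ is a fixed element with $p^m=q^2$. Quantum matrices: for positive integers $r,s$, $\mathcal{O}_q(M_{r,s})$ is the $\mathbb{K}$-algebra generated by $X_{ij}$ ($1\le i\le r$, $1\le j\le s$) subject to: $X_{ij}X_{il}=qX_{il}X_{ij}$ for $j<l$; $X_{ij}X_{kj}=qX_{kj}X_{ij}$ for $i<k$; $X_{ij}X_{kl}=X_{kl}X_{ij}$ for $k<i$, $j<l$; $X_{ij}X_{kl}-X_{kl}X_{ij}=(q-q^{-1})X_{il}X_{kj}$ for $i<k$, $j<l$. Quantum minors: for $I=\{i_1<\dots<i_t\}$, $J=\{j_1<\dots<j_t\}$, $[I|J]=\sum_{\sigma\in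 S_t}(-q)^{\ell(\sigma)}X_{i_{\sigma(1)}j_1}\cdots X_{i_{\sigma(t)}j_t}$, where $\ell$ is the Coxeter length. Quantum grassmannian: $\mathcal{O}_q(G(m,n))$ is the subalgebra of $\mathcal{O}_q(M_{m,n})$ generated by the $m\times m$ quantum minors $[J]=[j_1,\dots,j_m]:=[\{1,\dots,m\}|J]$, for $J=\{j_1<\dots<j_m\}\subseteq\{1,\dots,n\}$. It is $\mathbb{Z}^n$-graded with $[J]$ homogeneous of degree (content) $\sum_{j\in J}\epsilon(j)$, where $\epsilon(1),\dots,\epsilon(n)$ is the standard basis of $\mathbb{Z}^n$. Twist: given a $\mathbb{Z}^n$-graded $\mathbb{K}$-algebra $A$ and a map $c:\mathbb{Z}^n\times\mathbb{Z}^n\to\mathbb{K}^*$ that is a $2$-cocycle, i.e. $c(s,t+u)c(t,u)=c(s,t)c(s+t,u)$ for all $s,t,u$, the twist $T(A)$ is the graded vector space isomorphic to $A$ via $a\mapsto a'$, with multiplication $a'b'=c(s,t)(ab)'$ for $a,b$ homogeneous of degrees $s,t$. The map $c$ in the claim is a $2$-cocycle. *)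

theory Defs
  imports
    "HOL-Library.Poly_Mapping"
    "HOL-Combinatorics.Permutations"
    "HOL-Algebra.Subrings"
    "HOL-Algebra.QuotRing"
    "HOL-Algebra.Module"
begin

text \<open>
  An associative unital algebra over a field is represented by a record of type
  \<^typ>\<open>('k::field, 'a) module\<close>: a HOL-Algebra ring, not necessarily commutative, together with
  a multiplication by scalars from the type \<^typ>\<open>'k::field\<close>.
\<close>

section \<open>Subalgebras, linear spans, isomorphisms\<close>

definition alg_subspace :: "('k::field, 'a) module \<Rightarrow> 'a set \<Rightarrow> bool" where
  "alg_subspace A H \<longleftrightarrow>
     additive_subgroup H A \<and> (\<forall>k. \<forall>a\<in>H. k \<odot>\<^bsub>A\<^esub> a \<in> H)"

definition alg_span :: "('k::field, 'a) module \<Rightarrow> 'a set \<Rightarrow> 'a set" where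
  "alg_span A S = alg_subspace A hull S"

definition subalg :: "('k::field, 'a) module \<Rightarrow> 'a set \<Rightarrow> bool" where
  "subalg A H \<longleftrightarrow> subring H A \<and> (\<forall>k. \<forall>a\<in>H. k \<odot>\<^bsub>A\<^esub> a \<in> H)"

definition generated_alg :: "('k::field, 'a) module \<Rightarrow> 'a set \<Rightarrow> ('k, 'a) module" where
  "generated_alg A S = A\<lparr>carrier := subalg A hull S\<rparr>"

definition alg_iso :: "('k::field, 'a) module \<Rightarrow> ('k, 'b) module \<Rightarrow> ('a \<Rightarrow> 'b) set" where
  "alg_iso A B =
     {h \<in> ring_iso A B. \<forall>k. \<forall>a\<in>carrier A. h (k \<odot>\<^bsub>A\<^esub> a) = k \<odot>\<^bsub>B\<^esub> h a}"

definition list_mult :: "('a, 'b) monoid_scheme \<Rightarrow> 'a list \<Rightarrow> 'a" where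
  "list_mult A as = foldr (\<lambda>a b. a \<otimes>\<^bsub>A\<^esub> b) as \<one>\<^bsub>A\<^esub>"


section \<open>Algebras given by generators and relations\<close>

text \<open>
  The free monoid is written additively because the convolution product of
  \<^type>\<open>poly_mapping\<close> is taken with respect to an additive index monoid; the finitely
  supported functions on the free monoid are then the noncommutative polynomials.
\<close>

datatype 'v free_monoid = Word (letters: "'v list")

instantiation free_monoid :: (type) monoid_add
begin

definition zero_free_monoid :: "'a free_monoid" where
  "0 = Word []"

definition plus_free_monoid :: "'a free_monoid \<Rightarrow> 'a free_monoid \<Rightarrow> 'a free_monoid" where
  "u + v = Word (letters u @ letters v)"

instance
  by standard (simp_all add: zero_free_monoid_def plus_free_monoid_def)

end

type_synonym ('k, 'v) nc_poly = "'v free_monoid \<Rightarrow>\<^sub>0 'k"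

definition nc_var :: "'v \<Rightarrow> ('k::field, 'v) nc_poly" where
  "nc_var v = Poly_Mapping.single (Word [v]) 1"

definition nc_scale :: "'k \<Rightarrow> ('k::field, 'v) nc_poly \<Rightarrow> ('k, 'v) nc_poly" where
  "nc_scale k f = Poly_Mapping.map (\<lambda>x. k * x) f"

definition free_alg :: "'v set \<Rightarrow> ('k::field, ('k, 'v) nc_poly) module" where
  "free_alg V =
     \<lparr>carrier = {f. \<forall>w\<in>Poly_Mapping.keys f. set (letters w) \<subseteq> V},
      mult = (\<lambda>f g. f * g), one = 1, zero = 0, add = (\<lambda>f g. f + g), smult = nc_scale\<rparr>"

text \<open>
  \<^const>\<open>genideal\<close> is the two-sided ideal generated by a set. The scalar action on
  \<^const>\<open>FactRing\<close> is the induced one on cosets.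
\<close>

definition presented_ideal ::
    "'v set \<Rightarrow> ('k::field, 'v) nc_poly set \<Rightarrow> ('k, 'v) nc_poly set" where
  "presented_ideal V R = Idl\<^bsub>free_alg V\<^esub> R"

definition presented_alg ::
    "'v set \<Rightarrow> ('k::field, 'v) nc_poly set \<Rightarrow> ('k, ('k, 'v) nc_poly set) module" where
  "presented_alg V R =
     ring.extend (free_alg V Quot presented_ideal V R)
       \<lparr>smult = (\<lambda>k C. \<Union>f\<in>C. presented_ideal V R +>\<^bsub>free_alg V\<^esub> (k \<odot>\<^bsub>free_alg V\<^esub> f))\<rparr>"

definition presented_gen ::
    "'v set \<Rightarrow> ('k::field, 'v) nc_poly set \<Rightarrow> 'v \<Rightarrow> ('k, 'v) nc_poly set" where
  "presented_gen V R v = presented_ideal V R +>\<^bsub>free_alg V\<^esub> nc_var v"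


section \<open>Quantum matrices and quantum minors\<close>

type_synonym 'k qelem = "('k, nat \<times> nat) nc_poly set"

definition qmat_indices :: "nat \<Rightarrow> nat \<Rightarrow> (nat \<times> nat) set" where
  "qmat_indices r s = {1..r} \<times> {1..s}"

definition qmat_relations :: "'k::field \<Rightarrow> nat \<Rightarrow> nat \<Rightarrow> ('k, nat \<times> nat) nc_poly set" where
  "qmat_relations q r s =
     (let x = (\<lambda>i j. nc_var (i, j)) in
       {x i j * x i l - nc_scale q (x i l * x i j) | i j l.
          i \<in> {1..r} \<and> j \<in> {1..s} \<and> l \<in> {1..s} \<and> j < l}
     \<union> {x i j * x k j - nc_scale q (x k j * x i j) | i k j.
          i \<in> {1..r} \<and> k \<in> {1..r} \<and> j \<in> {1..s} \<and> i < k}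
     \<union> {x i j * x k l - x k l * x i j | i j k l.
          i \<in> {1..r} \<and> k \<in> {1..r} \<and> j \<in> {1..s} \<and> l \<in> {1..s} \<and> k < i \<and> j < l}
     \<union> {x i j * x k l - x k l * x i j - nc_scale (q - inverse q) (x i l * x k j) | i j k l.
          i \<in> {1..r} \<and> k \<in> {1..r} \<and> j \<in> {1..s} \<and> l \<in> {1..s} \<and> i < k \<and> j < l})"

definition qmat :: "'k::field \<Rightarrow> nat \<Rightarrow> nat \<Rightarrow> ('k, 'k qelem) module" where
  "qmat q r s = presented_alg (qmat_indices r s) (qmat_relations q r s)"

definition qmat_gen :: "'k::field \<Rightarrow> nat \<Rightarrow> nat \<Rightarrow> nat \<Rightarrow> nat \<Rightarrow> 'k qelem" where
  "qmat_gen q r s i j = presented_gen (qmat_indices r s) (qmat_relations q r s) (i, j)"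

text \<open>
  Coxeter length in the symmetric group on \<open>{..<t}\<close>: the least length of an expression as
  a product of simple transpositions \<open>(a a+1)\<close>.
\<close>

definition coxeter_length :: "nat \<Rightarrow> (nat \<Rightarrow> nat) \<Rightarrow> nat" where
  "coxeter_length t \<sigma> =
     (LEAST l. \<exists>w. length w = l \<and> (\<forall>a\<in>set w. Suc a < t) \<and>
        \<sigma> = foldr (\<lambda>a \<tau>. Transposition.transpose a (Suc a) \<circ> \<tau>) w id)"

text \<open>
  Positions in \<open>I = {i\<^sub>1 < \<dots> < i\<^sub>t}\<close> and \<open>J\<close> are numbered from \<open>0\<close> here, so that \<open>i\<^sub>a\<^sub>+\<^sub>1\<close> is
  the entry \<open>a\<close> of the sorted list. Intended for finite \<open>I\<close>, \<open>J\<close> of equal cardinality.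
\<close>

definition qminor :: "'k::field \<Rightarrow> nat \<Rightarrow> nat \<Rightarrow> nat set \<Rightarrow> nat set \<Rightarrow> 'k qelem" where
  "qminor q r s I J =
     (let t = card I;
          i = (\<lambda>a. sorted_list_of_set I ! a);
          j = (\<lambda>a. sorted_list_of_set J ! a)
      in \<Oplus>\<^bsub>qmat q r s\<^esub> \<sigma> \<in> {\<sigma>. \<sigma> permutes {..<t}}.
           (- q) ^ coxeter_length t \<sigma> \<odot>\<^bsub>qmat q r s\<^esub>
             list_mult (qmat q r s) (map (\<lambda>a. qmat_gen q r s (i (\<sigma> a)) (j a)) [0..<t]))"


section \<open>The quantum grassmannian and its grading\<close>

definition grass_indices :: "nat \<Rightarrow> nat \<Rightarrow> nat set set" where
  "grass_indices m n = {J. J \<subseteq> {1..n} \<and> card J = m}"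

definition qplucker :: "'k::field \<Rightarrow> nat \<Rightarrow> nat \<Rightarrow> nat set \<Rightarrow> 'k qelem" where
  "qplucker q m n J = qminor q m n {1..m} J"

definition qgrass :: "'k::field \<Rightarrow> nat \<Rightarrow> nat \<Rightarrow> ('k, 'k qelem) module" where
  "qgrass q m n = generated_alg (qmat q m n) (qplucker q m n ` grass_indices m n)"

text \<open>\<open>\<int>\<^sup>n\<close> is the group of finitely supported functions \<open>\<nat> \<rightarrow> \<int>\<close> vanishing outside \<open>{1..n}\<close>.\<close>

definition int_lattice :: "nat \<Rightarrow> (nat \<Rightarrow>\<^sub>0 int) set" where
  "int_lattice n = {s. Poly_Mapping.keys s \<subseteq> {1..n}}"

definition content :: "nat set \<Rightarrow> nat \<Rightarrow>\<^sub>0 int" where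
  "content J = (\<Sum>j\<in>J. Poly_Mapping.single j 1)"

text \<open>
  The grading is determined by the degrees of the generators: the component of degree \<open>s\<close> is
  spanned by the products \<open>[J\<^sub>1] \<cdots> [J\<^sub>k]\<close> with total content \<open>s\<close>.
\<close>

definition qgrass_component ::
    "'k::field \<Rightarrow> nat \<Rightarrow> nat \<Rightarrow> (nat \<Rightarrow>\<^sub>0 int) \<Rightarrow> 'k qelem set" where
  "qgrass_component q m n s =
     alg_span (qgrass q m n)
       {list_mult (qgrass q m n) (map (qplucker q m n) Js) | Js.
          set Js \<subseteq> grass_indices m n \<and> sum_list (map content Js) = s}"


section \<open>Twists of graded algebras\<close>

text \<open>
  \<open>G\<close> is the degree group and \<open>gr s\<close> the component of degree \<open>s \<in> G\<close>. When \<open>A\<close> is the direct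
  sum of its components, the following is the family of homogeneous components of \<open>a\<close>.
\<close>

definition homogeneous_parts ::
    "('k::field, 'a) module \<Rightarrow> 'g set \<Rightarrow> ('g \<Rightarrow> 'a set) \<Rightarrow> 'a \<Rightarrow> 'g \<Rightarrow> 'a" where
  "homogeneous_parts A G gr a =
     (THE f. (\<forall>s\<in>G. f s \<in> gr s) \<and> (\<forall>s. s \<notin> G \<longrightarrow> f s = \<zero>\<^bsub>A\<^esub>) \<and>
             finite {s. f s \<noteq> \<zero>\<^bsub>A\<^esub>} \<and>
             (\<Oplus>\<^bsub>A\<^esub> s \<in> {s. f s \<noteq> \<zero>\<^bsub>A\<^esub>}. f s) = a)"

text \<open>
  The twist has the same underlying vector space, so that the identification \<open>a \<mapsto> a'\<close> is the
  identity; its product is the bilinear extension of \<open>a' b' = c(s,t) (ab)'\<close> for homogeneous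
  \<open>a\<close>, \<open>b\<close> of degrees \<open>s\<close>, \<open>t\<close>. For a \<open>2\<close>-cocycle \<open>c\<close> with nonzero values this product has
  unit \<open>c(0,0)\<^sup>-\<^sup>1 1'\<close>.
\<close>

definition twist ::
    "('k::field, 'a) module \<Rightarrow> ('g::ab_group_add) set \<Rightarrow> ('g \<Rightarrow> 'a set) \<Rightarrow>
       ('g \<Rightarrow> 'g \<Rightarrow> 'k) \<Rightarrow> ('k, 'a) module" where
  "twist A G gr c =
     A\<lparr>mult := (\<lambda>a b.
          let f = homogeneous_parts A G gr a; g = homogeneous_parts A G gr b
          in \<Oplus>\<^bsub>A\<^esub> s \<in> {s. f s \<noteq> \<zero>\<^bsub>A\<^esub>}. \<Oplus>\<^bsub>A\<^esub> t \<in> {t. g t \<noteq> \<zero>\<^bsub>A\<^esub>}.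
               c s t \<odot>\<^bsub>A\<^esub> (f s \<otimes>\<^bsub>A\<^esub> g t)),
       one := inverse (c 0 0) \<odot>\<^bsub>A\<^esub> \<one>\<^bsub>A\<^esub>\<rparr>"

definition grass_cocycle ::
    "'k::field \<Rightarrow> nat \<Rightarrow> (nat \<Rightarrow>\<^sub>0 int) \<Rightarrow> (nat \<Rightarrow>\<^sub>0 int) \<Rightarrow> 'k" where
  "grass_cocycle p n s t =
     (\<Prod>j\<in>{1..n} - {n}. p powi (Poly_Mapping.lookup s n * Poly_Mapping.lookup t j))"

definition qgrass_twist :: "'k::field \<Rightarrow> 'k \<Rightarrow> nat \<Rightarrow> nat \<Rightarrow> ('k, 'k qelem) module" where
  "qgrass_twist p q m n =
     twist (qgrass q m n) (int_lattice n) (qgrass_component q m n) (grass_cocycle p n)"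

end

theory Submission
  imports Defs "HOL-Combinatorics.Multiset_Permutations"
begin

text \<open>
  Modulo the relations every element of the algebra of quantum matrices is a sum of products \<open>a b\<close>
  with \<open>a\<close> in the columns \<open>1, \<dots>, n - 1\<close> and \<open>b\<close> in the column \<open>n\<close>, and the tensor product of the
  two subalgebras carries an action of the whole algebra. Hence there is a well-defined linear map
  sending \<open>a b\<close> to \<open>b' a'\<close>, where \<open>a'\<close> is \<open>a\<close> with all columns shifted by one and \<open>b'\<close> is a rescaled copy
  of \<open>b\<close> in the column \<open>1\<close>. By Laplace expansion along the last and the first column it rotates the
  generators of the grassmannian, up to scalars. Maximal minors commute up to powers of \<open>q\<close> with the
  entries of an extreme column, so this map is multiplicative on the grassmannian up to a
  bicharacter, which differs from the given cocycle by a coboundary. Surjectivity is clear on monomials in the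
  generators; the \<open>n\<close>-th iterate multiplies each monomial by a nonzero scalar, whence injectivity.
\<close>


text \<open>Neither a presentation nor a basis of the grassmannian is at hand, so nothing can be
  defined by prescribing it on the generators [J]; \<open>\<theta>\<close> has to come from a map on
  all quantum matrices, where the ideal of relations is explicit. Moving column n to the front is
  not compatible with multiplication there: within a row, the relation between columns j and n would
  have its power of q inverted. Hence the detour through a merely linear map, which needs the normal
  forms a b. No basis theorem is used for them: each generator acts on the tensor product, an entry
  of column n through the matrix that straightens it past the other columns, and a word applied to 1
  yields its normal form. What has to be checked is that these operators satisfy the relations.

  All computations take place in the free algebra on all letters, as congruences modulo two-sided
  ideals. The tensor product is again such a quotient, by \<open>\<T>\<close>, so that every map is
  a linear map of free algebras carrying one ideal into another; cosets appear only at the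
  end.\<close>

lemma lookup_nc_scale [simp]: "Poly_Mapping.lookup (nc_scale k f) w = k * Poly_Mapping.lookup f w"
  by (simp add: nc_scale_def Poly_Mapping.map.rep_eq when_def)

global_interpretation nc: vector_space nc_scale
  by unfold_locales (auto intro!: poly_mapping_eqI simp: lookup_add algebra_simps)

notation nc_scale (infixr "\<cdot>" 75)

lemma nc_scale_conv_mult: "k \<cdot> f = Poly_Mapping.single 0 k * f"
  by (simp add: nc_scale_def mult_map_scale_conv_mult)

abbreviation word :: "'v list \<Rightarrow> ('k::field, 'v) nc_poly" where
  "word w \<equiv> Poly_Mapping.single (Word w) 1"

lemma scale_single: "k \<cdot> Poly_Mapping.single w c = Poly_Mapping.single w (k * c)"
  by (intro poly_mapping_eqI) (simp add: lookup_single when_def)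

lemma word_mult: "word u * word v = word (u @ v)"
  by (simp add: Poly_Mapping.mult_single plus_free_monoid_def)

lemma word_Nil: "word [] = 1"
  by (metis single_one zero_free_monoid_def)

lemma nc_var_eq: "nc_var v = word [v]"
  by (simp add: nc_var_def)

lemma word_Cons: "word (v # w) = nc_var v * word w"
  by (simp add: nc_var_eq word_mult)

lemma nc_poly_eq_sum:
  "f = (\<Sum>w\<in>Poly_Mapping.keys f. Poly_Mapping.lookup f w \<cdot> word (letters w))"
  by (rule poly_mapping_eqI)
    (simp add: lookup_sum lookup_single when_def in_keys_iff if_distrib[of "\<lambda>x. _ * x"] cong: if_cong)

lemma nc_poly_induct [case_names add scale word]:
  assumes "\<And>f g. P f \<Longrightarrow> P g \<Longrightarrow> P (f + g)" "\<And>c f. P f \<Longrightarrow> P (c \<cdot> f)" "\<And>w. P (word w)"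
  shows "P f"
proof -
  have zero: "P 0" using assms(2)[OF assms(3), of 0] by simp
  have "P (\<Sum>w\<in>A. Poly_Mapping.lookup f w \<cdot> word (letters w))" if "finite A" for A
    using that
  proof (induction A)
    case (insert w A)
    show ?case
      unfolding sum.insert[OF insert(1,2)] by (intro assms(1) assms(2) insert(3)) (rule assms(3))
  qed (simp add: zero)
  then show ?thesis by (subst nc_poly_eq_sum) simp
qed

lemma scale_mult_left [simp]: "(k \<cdot> f) * g = k \<cdot> (f * g)"
  by (simp add: nc_scale_conv_mult mult.assoc)

lemma mult_scale_right [simp]: "f * (k \<cdot> g) = k \<cdot> (f * g)"
proof (induction f rule: nc_poly_induct)
  case (word u)
  show ?case
  proof (induction g arbitrary: k rule: nc_poly_induct)
    case (word v)
    show ?case by (simp add: word_mult scale_single Poly_Mapping.mult_single)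
  next
    case (scale c g)
    show ?case by (simp add: scale.IH)
  qed (simp_all add: distrib_left nc.scale_right_distrib)
qed (simp_all add: distrib_right nc.scale_right_distrib nc.scale_left_commute)

section \<open>Linear maps between free algebras and their values on words\<close>

abbreviation lin :: "(('k::field, 'v) nc_poly \<Rightarrow> ('k, 'w) nc_poly) \<Rightarrow> bool" where
  "lin \<equiv> Vector_Spaces.linear nc_scale nc_scale"

lemma linI: "\<lbrakk>\<And>f g. L (f + g) = L f + L g; \<And>c f. L (c \<cdot> f) = c \<cdot> L f\<rbrakk> \<Longrightarrow> lin L"
  by unfold_locales auto

lemma lin_add: "lin L \<Longrightarrow> L (f + g) = L f + L g"
  and lin_scale: "lin L \<Longrightarrow> L (c \<cdot> f) = c \<cdot> L f"
  and lin_diff: "lin L \<Longrightarrow> L (f - g) = L f - L g"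
  and lin_zero: "lin L \<Longrightarrow> L 0 = 0"
  and lin_sum: "lin L \<Longrightarrow> L (sum h A) = (\<Sum>a\<in>A. L (h a))"
  unfolding Vector_Spaces.linear_iff_module_hom
  by (simp_all add: module_hom.add module_hom.scale module_hom.diff module_hom.zero module_hom.sum)

lemmas lin_simps = lin_add lin_scale lin_diff lin_zero lin_sum

lemma lin_id: "lin (\<lambda>f. f)"
  by (rule linI) simp_all

lemma lin_comp: "lin L \<Longrightarrow> lin L' \<Longrightarrow> lin (\<lambda>f. L (L' f))"
  by (rule linI) (simp_all add: lin_add lin_scale)

lemma lin_mult_left: "lin (\<lambda>f. g * f)" and lin_mult_right: "lin (\<lambda>f. f * g)"
  by (rule linI; simp add: algebra_simps)+

lemma lin_scaled: "lin L \<Longrightarrow> lin (\<lambda>f. c \<cdot> L f)"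
  by (rule linI) (simp_all add: lin_add lin_scale algebra_simps nc.scale_right_distrib nc.scale_left_commute)

lemma lin_sum_fun: "(\<And>a. a \<in> A \<Longrightarrow> lin (L a)) \<Longrightarrow> lin (\<lambda>f. \<Sum>a\<in>A. L a f)"
  by (rule linI) (simp_all add: lin_add lin_scale sum.distrib nc.scale_sum_right)

lemma lin_eqI:
  assumes "lin L" "lin L'" "\<And>w. L (word w) = L' (word w)"
  shows "L f = L' f"
  by (induction f rule: nc_poly_induct) (simp_all add: assms lin_add lin_scale)

definition lin_ext :: "('v list \<Rightarrow> ('k, 'w) nc_poly) \<Rightarrow> ('k::field, 'v) nc_poly \<Rightarrow> ('k, 'w) nc_poly" where
  "lin_ext g f = (\<Sum>w\<in>Poly_Mapping.keys f. Poly_Mapping.lookup f w \<cdot> g (letters w))"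

lemma lin_ext_eq_sum:
  assumes "finite A" "Poly_Mapping.keys f \<subseteq> A"
  shows "lin_ext g f = (\<Sum>w\<in>A. Poly_Mapping.lookup f w \<cdot> g (letters w))"
  unfolding lin_ext_def using assms by (intro sum.mono_neutral_left) (auto simp: in_keys_iff)

lemma lin_lin_ext: "lin (lin_ext g)"
proof (rule linI)
  fix f h :: "('a, 'b) nc_poly"
  let ?A = "Poly_Mapping.keys f \<union> Poly_Mapping.keys h"
  show "lin_ext g (f + h) = lin_ext g f + lin_ext g h"
    using lin_ext_eq_sum[of ?A "f + h" g] lin_ext_eq_sum[of ?A f g] lin_ext_eq_sum[of ?A h g]
      Poly_Mapping.keys_add[of f h]
    by (simp add: sum.distrib[symmetric] lookup_add nc.scale_left_distrib)
next
  fix c :: 'a and f :: "('a, 'b) nc_poly"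
  have "Poly_Mapping.keys (c \<cdot> f) \<subseteq> Poly_Mapping.keys f" by (auto simp: in_keys_iff)
  then show "lin_ext g (c \<cdot> f) = c \<cdot> lin_ext g f"
    using lin_ext_eq_sum[of "Poly_Mapping.keys f" "c \<cdot> f" g] lin_ext_eq_sum[of "Poly_Mapping.keys f" f g]
    by (simp add: nc.scale_sum_right)
qed

lemma lin_ext_word [simp]: "lin_ext g (word w) = g w"
  by (simp add: lin_ext_def)

section \<open>Congruences modulo two-sided ideals of the free algebra\<close>

locale nc_ideal =
  fixes \<I> :: "('k::field, 'v) nc_poly set"
  assumes subspace: "nc.subspace \<I>"
    and mult_left: "f \<in> \<I> \<Longrightarrow> g * f \<in> \<I>"
    and mult_right: "f \<in> \<I> \<Longrightarrow> f * g \<in> \<I>"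
begin

definition cong (infix "\<approx>" 50) where "f \<approx> g \<longleftrightarrow> f - g \<in> \<I>"

lemmas mem_add = nc.subspace_add[OF subspace]
  and mem_diff = nc.subspace_diff[OF subspace]
  and mem_scale = nc.subspace_scale[OF subspace]
  and mem_zero = nc.subspace_0[OF subspace]
  and mem_sum = nc.subspace_sum[OF subspace]

lemma cong_refl [simp, intro]: "f \<approx> f"
  by (simp add: cong_def mem_zero)

lemma cong_sym: "f \<approx> g \<Longrightarrow> g \<approx> f"
  unfolding cong_def using nc.subspace_neg[OF subspace, of "f - g"] by simp

lemma cong_trans [trans]: "f \<approx> g \<Longrightarrow> g \<approx> h \<Longrightarrow> f \<approx> h"
  unfolding cong_def using mem_add[of "f - g" "g - h"] by simp

lemma cong_eq_trans [trans]: "f \<approx> g \<Longrightarrow> g = h \<Longrightarrow> f \<approx> h" "f = g \<Longrightarrow> g \<approx> h \<Longrightarrow> f \<approx> h"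
  by simp_all

lemma cong_add: "f \<approx> g \<Longrightarrow> f' \<approx> g' \<Longrightarrow> f + f' \<approx> g + g'"
  unfolding cong_def using mem_add[of "f - g" "f' - g'"] by (simp add: algebra_simps)

lemma cong_diff: "f \<approx> g \<Longrightarrow> f' \<approx> g' \<Longrightarrow> f - f' \<approx> g - g'"
  unfolding cong_def using mem_diff[of "f - g" "f' - g'"] by (simp add: algebra_simps)

lemma cong_scale: "f \<approx> g \<Longrightarrow> c \<cdot> f \<approx> c \<cdot> g"
  unfolding cong_def using mem_scale by (simp flip: nc.scale_right_diff_distrib)

lemma cong_mult: "f \<approx> g \<Longrightarrow> f' \<approx> g' \<Longrightarrow> f * f' \<approx> g * g'"
  unfolding cong_def
  using mem_add[OF mult_right[of "f - g" f'] mult_left[of "f' - g'" g]] by (simp add: algebra_simps)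

lemma cong_sum: "(\<And>a. a \<in> A \<Longrightarrow> f a \<approx> g a) \<Longrightarrow> sum f A \<approx> sum g A"
  unfolding cong_def by (simp flip: sum_subtractf add: mem_sum)

lemma cong_mult_left: "f \<approx> g \<Longrightarrow> h * f \<approx> h * g"
  and cong_mult_right: "f \<approx> g \<Longrightarrow> f * h \<approx> g * h"
  by (simp_all add: cong_mult)

lemma cong_mem: "f \<approx> g \<Longrightarrow> g \<in> \<I> \<Longrightarrow> f \<in> \<I>"
  unfolding cong_def using mem_add[of "f - g" g] by simp

end

definition ideal_gen :: "('k::field, 'v) nc_poly set \<Rightarrow> ('k, 'v) nc_poly set" where
  "ideal_gen R = nc.span {word u * r * word v | u r v. r \<in> R}"

text \<open>Linear maps suffice because the ideal is written as a linear span; the main maps by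
  which ideals are compared later (\<open>rho i k\<close>, \<open>reorder\<close>,
  \<open>to_front\<close>) are not multiplicative.\<close>

lemma ideal_gen_image:
  assumes L: "lin L" and S: "nc.subspace S"
    and gens: "\<And>u r v. r \<in> R \<Longrightarrow> L (word u * r * word v) \<in> S"
    and f: "f \<in> ideal_gen R"
  shows "L f \<in> S"
  using f unfolding ideal_gen_def
proof (induction rule: nc.span_induct_alt)
  case base
  then show ?case by (simp add: lin_zero[OF L] nc.subspace_0[OF S])
next
  case (step c x y)
  then show ?case
    using gens by (auto simp: lin_add[OF L] lin_scale[OF L] intro!: nc.subspace_add[OF S] nc.subspace_scale[OF S])
qed

lemma nc_ideal_ideal_gen: "nc_ideal (ideal_gen R)"
proof
  show S: "nc.subspace (ideal_gen R)" by (simp add: ideal_gen_def nc.subspace_span)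
  have L: "word w * f \<in> ideal_gen R" if "f \<in> ideal_gen R" for w f
  proof (rule ideal_gen_image[OF lin_mult_left S _ that])
    fix u r v assume "r \<in> R"
    then have "word (w @ u) * r * word v \<in> ideal_gen R"
      unfolding ideal_gen_def by (intro nc.span_base) blast
    then show "word w * (word u * r * word v) \<in> ideal_gen R"
      by (simp flip: mult.assoc add: word_mult)
  qed
  show "g * f \<in> ideal_gen R" if f: "f \<in> ideal_gen R" for f g
  proof (induction g rule: nc_poly_induct)
    case (add g h)
    then show ?case by (simp add: distrib_right nc.subspace_add[OF S])
  qed (simp_all add: nc.subspace_scale[OF S] L[OF f])
  have R: "f * word w \<in> ideal_gen R" if "f \<in> ideal_gen R" for w f
  proof (rule ideal_gen_image[OF lin_mult_right S _ that])
    fix u r v assume "r \<in> R"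
    then have "word u * r * word (v @ w) \<in> ideal_gen R"
      unfolding ideal_gen_def by (intro nc.span_base) blast
    then show "word u * r * word v * word w \<in> ideal_gen R"
      by (simp add: mult.assoc word_mult)
  qed
  show "f * g \<in> ideal_gen R" if f: "f \<in> ideal_gen R" for f g
  proof (induction g rule: nc_poly_induct)
    case (add g h)
    then show ?case by (simp add: distrib_left nc.subspace_add[OF S])
  qed (simp_all add: nc.subspace_scale[OF S] R[OF f])
qed

lemma ideal_gen_base:
  assumes "r \<in> R"
  shows "r \<in> ideal_gen R"
proof -
  have "word [] * r * word [] \<in> ideal_gen R"
    unfolding ideal_gen_def using assms by (intro nc.span_base) blast
  then show ?thesis by (simp add: word_Nil)
qed

lemma ideal_gen_minimal:
  assumes "nc_ideal I" "R \<subseteq> I"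
  shows "ideal_gen R \<subseteq> I"
proof
  interpret nc_ideal I by fact
  fix f assume f: "f \<in> ideal_gen R"
  have "word u * r * word v \<in> I" if "r \<in> R" for u r v
    by (rule mult_right[OF mult_left]) (use that assms(2) in blast)
  from ideal_gen_image[OF lin_id subspace this f] show "f \<in> I" .
qed


section \<open>Quantum minors by Laplace expansion\<close>

text \<open>Laplace expansion along the column listed first; the exponent counts the inversions that
  the chosen row forms with the rows left over. Rows may come from any linear order and columns from
  any list, so that the expansion can be mirrored. If the numbers of rows and columns differ, the
  value is 0.\<close>

fun lap :: "'k::field \<Rightarrow> ('r::linorder \<Rightarrow> 'c \<Rightarrow> ('k, 'v) nc_poly) \<Rightarrow> 'r set \<Rightarrow> 'c list \<Rightarrow> ('k, 'v) nc_poly"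
  where
    "lap q x I [] = (if I = {} then 1 else 0)"
  | "lap q x I (j # js) =
       (\<Sum>i\<in>I. (- q) ^ card {r \<in> I. r < i} \<cdot> (x i j * lap q x (I - {i}) js))"

text \<open>The factor \<open>q - inverse q\<close> turns the power with exponent 1 + 2 k into q^(2
  k) - q^(2 k + 2), and the counts k run through 0, 1, 2, ... without gaps. A new maximum leaves the
  counts of the other elements unchanged.\<close>

lemma telescope_even_powers:
  fixes A :: "'r::linorder set"
  assumes "finite A" "q \<noteq> (0 :: 'k::field)"
  shows "(q - inverse q) * (\<Sum>a\<in>A. (- q) ^ (1 + 2 * card {r \<in> A. r < a})) = 1 - q ^ (2 * card A)"
  using assms(1)
proof (induction rule: finite_linorder_max_induct)
  case (insert b A)
  have 1: "{r \<in> insert b A. r < a} = {r \<in> A. r < a}" if "a \<in> A" for a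
    using insert that by auto
  have 2: "{r \<in> insert b A. r < b} = A"
    using insert by auto
  have [simp]: "b \<notin> A" using insert by auto
  have "(\<Sum>a\<in>insert b A. (- q) ^ (1 + 2 * card {r \<in> insert b A. r < a}))
      = (- q) ^ (1 + 2 * card A) + (\<Sum>a\<in>A. (- q) ^ (1 + 2 * card {r \<in> A. r < a}))"
    using insert(1) by (simp add: 1 2 del: insert_iff)
  moreover have "(q - inverse q) * (- q) ^ (1 + 2 * card A) = q ^ (2 * card A) - q ^ (2 + 2 * card A)"
    using assms(2) by (simp add: algebra_simps power2_eq_square)
  ultimately show ?case
    by (simp only: distrib_left insert.IH) (simp add: insert(1))
qed simp

text \<open>The rows below \<open>a\<close> are those below \<open>k\<close>, the row
  \<open>k\<close> itself and those strictly between \<open>k\<close> and \<open>a\<close>. The last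
  group is counted twice in the exponent, which leaves the even powers of the preceding lemma over
  the rows between \<open>k\<close> and \<open>i\<close>.\<close>

lemma telescope_between:
  fixes I :: "'r::linorder set"
  assumes "finite I" "k \<in> I" "k < i" "q \<noteq> (0 :: 'k::field)"
  shows "(q - inverse q) *
     (\<Sum>a\<in>{a \<in> I. k < a \<and> a < i}. (- q) ^ (card {r \<in> I. r < a} + card {r \<in> I. k < r \<and> r < a}))
     = (- q) ^ card {r \<in> I. r < k} - (- q) ^ (card {r \<in> I. r < k} + 2 * card {r \<in> I. k < r \<and> r < i})"
proof -
  let ?A = "{a \<in> I. k < a \<and> a < i}"
  have "card {r \<in> I. r < a} + card {r \<in> I. k < r \<and> r < a} =
      card {r \<in> I. r < k} + (1 + 2 * card {r \<in> ?A. r < a})" if "a \<in> ?A" for a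
  proof -
    have "{r \<in> I. r < a} = {r \<in> I. r < k} \<union> insert k {r \<in> ?A. r < a}"
      using that assms by auto
    moreover have "card \<dots> = card {r \<in> I. r < k} + card (insert k {r \<in> ?A. r < a})"
      using assms by (intro card_Un_disjoint) auto
    moreover have "{r \<in> I. k < r \<and> r < a} = {r \<in> ?A. r < a}"
      using that by auto
    ultimately show ?thesis
      using assms by simp
  qed
  then have eq: "(\<Sum>a\<in>?A. (- q) ^ (card {r \<in> I. r < a} + card {r \<in> I. k < r \<and> r < a}))
    = (\<Sum>a\<in>?A. (- q) ^ card {r \<in> I. r < k} * (- q) ^ (1 + 2 * card {r \<in> ?A. r < a}))"
    by (intro sum.cong refl) (simp only: power_add)
  have "(q - inverse q) * (\<Sum>a\<in>?A. (- q) ^ (card {r \<in> I. r < a} + card {r \<in> I. k < r \<and> r < a})) =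
      (- q) ^ card {r \<in> I. r < k} * ((q - inverse q) * (\<Sum>a\<in>?A. (- q) ^ (1 + 2 * card {r \<in> ?A. r < a})))"
    by (simp only: eq sum_distrib_left[symmetric] mult.left_commute)
  also have "\<dots> = (- q) ^ card {r \<in> I. r < k} * (1 - q ^ (2 * card ?A))"
    by (subst telescope_even_powers) (use assms in simp_all)
  finally show ?thesis by (simp add: right_diff_distrib power_add)
qed

context nc_ideal
begin

text \<open>
  The right-hand side describes how a column \<open>y\<close> standing to the right of all columns of a minor
  is moved across that minor.
\<close>

definition pass ::
    "'k \<Rightarrow> ('r::linorder \<Rightarrow> 'c \<Rightarrow> ('k, 'v) nc_poly) \<Rightarrow> ('r \<Rightarrow> ('k, 'v) nc_poly) \<Rightarrow>
      'r set \<Rightarrow> 'c list \<Rightarrow> 'r \<Rightarrow> ('k, 'v) nc_poly" where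
  "pass q x y I js i =
    (if i \<in> I then inverse q \<cdot> (lap q x I js * y i)
     else lap q x I js * y i - (q - inverse q) \<cdot>
       (\<Sum>k\<in>{k\<in>I. k < i}. (- q) ^ card {r \<in> I. k < r \<and> r < i} \<cdot> (lap q x (insert i (I - {k})) js * y k)))"

text \<open>The induction step for carrying \<open>y i\<close> across a minor. The left-hand side is
  what results when \<open>y i\<close> has passed the entries \<open>x a j\<close> of the first
  column and, by induction, the complementary minors. Corrections come from both stages; those that
  lead with \<open>x i j\<close> all have the form \<open>W k\<close>, and their coefficients
  telescope.\<close>

lemma pass_Cons:
  fixes I :: "'r::linorder set"
  assumes "finite I" and q: "q \<noteq> 0"
  shows "(\<Sum>a\<in>I. (- q) ^ card {r \<in> I. r < a} \<cdot>
     ((if a = i then inverse q else 1) \<cdot> (x a j * pass q x y (I - {a}) js i) -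
      (if a < i then q - inverse q else 0) \<cdot> (x i j * pass q x y (I - {a}) js a)))
    = pass q x y I (j # js) i"
proof -
  let ?Q = "- q" and ?z = "q - inverse q"
  let ?M = "\<lambda>I. lap q x I js"
  define p where "p I a = card {r \<in> I. r < a}" for I :: "'r set" and a
  define b where "b I k a = card {r \<in> I. k < r \<and> r < a}" for I :: "'r set" and k a
  define W where "W k = x i j * ?M (I - {k}) * y k" for k
  have off: "pass q x y (I - {a}) js a = ?M (I - {a}) * y a
      - ?z \<cdot> (\<Sum>k\<in>{k\<in>I. k < a}. ?Q ^ b I k a \<cdot> (?M (I - {k}) * y k))" if "a \<in> I" for a
  proof -
    have "{k \<in> I - {a}. k < a} = {k\<in>I. k < a}" by auto
    moreover have "{r \<in> I - {a}. k < r \<and> r < a} = {r \<in> I. k < r \<and> r < a}" for k by auto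
    moreover have "insert a (I - {a} - {k}) = I - {k}" if "k < a" for k
      using \<open>a \<in> I\<close> that by auto
    ultimately show ?thesis by (simp add: pass_def b_def)
  qed
  have tele: "?z * (\<Sum>a\<in>{a \<in> I. k < a \<and> a < i}. ?Q ^ (p I a + b I k a)) = ?Q ^ p I k - ?Q ^ (p I k + 2 * b I k i)"
    if "k \<in> I" "k < i" for k
    unfolding p_def b_def using telescope_between[of I k i q] assms that by simp
  have swap: "(\<Sum>a\<in>{a\<in>I. a < i}. \<Sum>k\<in>{k\<in>I. k < a}. F a k) =
     (\<Sum>k\<in>{k\<in>I. k < i}. \<Sum>a\<in>{a \<in> I. k < a \<and> a < i}. F a k)" for F :: "'r \<Rightarrow> 'r \<Rightarrow> ('k, 'v) nc_poly"
    using assms(1) by (subst sum.Sigma, simp, simp, subst sum.Sigma, simp, simp,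
      intro sum.reindex_bij_witness[of _ "\<lambda>(k, a). (a, k)" "\<lambda>(a, k). (k, a)"]) auto
  \<comment> \<open>These are the corrections with leading factor \<open>x i j\<close>, sorted by
    the row \<open>k\<close> of the final factor \<open>y k\<close>. After the interchange of sums,
    \<open>telescope_between\<close> replaces the exponent \<open>p I k\<close> by
    \<open>p I k + 2 * b I k i\<close>.\<close>
  have second: "(\<Sum>a\<in>I. ?Q ^ p I a \<cdot> ((if a < i then ?z else 0) \<cdot> (x i j * pass q x y (I - {a}) js a)))
      = ?z \<cdot> (\<Sum>k\<in>{k\<in>I. k < i}. ?Q ^ (p I k + 2 * b I k i) \<cdot> W k)"
  proof -
    have "(\<Sum>a\<in>I. ?Q ^ p I a \<cdot> ((if a < i then ?z else 0) \<cdot> (x i j * pass q x y (I - {a}) js a)))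
      = (\<Sum>a\<in>{a\<in>I. a < i}. ?Q ^ p I a \<cdot> (?z \<cdot> (x i j * pass q x y (I - {a}) js a)))"
      using assms(1) by (intro sum.mono_neutral_cong_right) auto
    also have "\<dots> = (\<Sum>a\<in>{a\<in>I. a < i}. ?z \<cdot> (?Q ^ p I a \<cdot> W a)
        - (\<Sum>k\<in>{k\<in>I. k < a}. (?z * (?z * ?Q ^ (p I a + b I k a))) \<cdot> W k))"
      by (intro sum.cong)
        (simp_all add: off W_def right_diff_distrib nc.scale_right_diff_distrib sum_distrib_left
          nc.scale_sum_right power_add mult.assoc ac_simps)
    also have "\<dots> = (\<Sum>k\<in>{k\<in>I. k < i}. ?z \<cdot> (?Q ^ p I k \<cdot> W k) -
         (\<Sum>a\<in>{a \<in> I. k < a \<and> a < i}. (?z * (?z * ?Q ^ (p I a + b I k a))) \<cdot> W k))"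
      by (simp add: sum_subtractf swap)
    also have "\<dots> = (\<Sum>k\<in>{k\<in>I. k < i}. ?z \<cdot> (?Q ^ (p I k + 2 * b I k i) \<cdot> W k))"
    proof (intro sum.cong refl, clarify)
      fix k assume k: "k \<in> I" "k < i"
      have "(\<Sum>a\<in>{a \<in> I. k < a \<and> a < i}. (?z * (?z * ?Q ^ (p I a + b I k a))) \<cdot> W k)
        = (?z * (?Q ^ p I k - ?Q ^ (p I k + 2 * b I k i))) \<cdot> W k"
        unfolding tele[OF k, symmetric] by (simp add: nc.scale_sum_left sum_distrib_left)
      then show "?z \<cdot> (?Q ^ p I k \<cdot> W k) - (\<Sum>a\<in>{a \<in> I. k < a \<and> a < i}. (?z * (?z * ?Q ^ (p I a + b I k a))) \<cdot> W k)
        = ?z \<cdot> (?Q ^ (p I k + 2 * b I k i) \<cdot> W k)"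
        by (simp add: right_diff_distrib nc.scale_left_diff_distrib)
    qed
    finally show ?thesis by (simp add: nc.scale_sum_right)
  qed
  let ?F = "\<Sum>a\<in>I. ?Q ^ p I a \<cdot> ((if a = i then inverse q else 1) \<cdot> (x a j * pass q x y (I - {a}) js i))"
  have split: "(\<Sum>a\<in>I. ?Q ^ p I a \<cdot>
     ((if a = i then inverse q else 1) \<cdot> (x a j * pass q x y (I - {a}) js i) -
      (if a < i then ?z else 0) \<cdot> (x i j * pass q x y (I - {a}) js a)))
    = ?F - ?z \<cdot> (\<Sum>k\<in>{k\<in>I. k < i}. ?Q ^ (p I k + 2 * b I k i) \<cdot> W k)"
    unfolding second[symmetric] by (simp add: nc.scale_right_diff_distrib sum_subtractf)
  show ?thesis
  proof (cases "i \<in> I")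
    case True
    \<comment> \<open>For \<open>i \<in> I\<close> only the summand \<open>a = i\<close> contributes
      corrections to \<open>?F\<close>. Since \<open>p I i\<close> exceeds
      \<open>p I k + b I k i\<close> by 1, they acquire an extra factor \<open>- q\<close>, whose
      sign makes them cancel the sum subtracted in \<open>split\<close>.\<close>
    have "?Q ^ p I a \<cdot> ((if a = i then inverse q else 1) \<cdot> (x a j * pass q x y (I - {a}) js i))
      = inverse q \<cdot> (?Q ^ p I a \<cdot> (x a j * ?M (I - {a}) * y i))" if "a \<in> I - {i}" for a
    proof -
      from that have "a \<noteq> i" "i \<noteq> a" by auto
      then show ?thesis using True by (simp add: pass_def mult.assoc nc.scale_left_commute)
    qed
    note rest = sum.cong[OF refl this]
    have "?F = (?Q ^ p I i * inverse q) \<cdot> (x i j * pass q x y (I - {i}) js i)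
       + (\<Sum>a\<in>I - {i}. inverse q \<cdot> (?Q ^ p I a \<cdot> (x a j * ?M (I - {a}) * y i)))"
      unfolding sum.remove[OF assms(1) True] by (rule arg_cong2[where f = "(+)"], simp) (rule rest)
    also have "\<dots> = inverse q \<cdot> (\<Sum>a\<in>I. ?Q ^ p I a \<cdot> (x a j * ?M (I - {a}) * y i))
        - (inverse q * ?Q ^ p I i * ?z) \<cdot> (\<Sum>k\<in>{k\<in>I. k < i}. ?Q ^ b I k i \<cdot> W k)"
      unfolding off[OF True]
      by (subst sum.remove[of I i])
        (use True assms(1) in \<open>simp_all add: W_def right_diff_distrib nc.scale_right_diff_distrib nc.scale_right_distrib
          sum_distrib_left nc.scale_sum_right ac_simps\<close>)
    also have "(inverse q * ?Q ^ p I i * ?z) \<cdot> (\<Sum>k\<in>{k\<in>I. k < i}. ?Q ^ b I k i \<cdot> W k)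
        = - (?z \<cdot> (\<Sum>k\<in>{k\<in>I. k < i}. ?Q ^ (p I k + 2 * b I k i) \<cdot> W k))"
    proof -
      have "inverse q * ?Q ^ p I i * ?z * ?Q ^ b I k i = - (?z * ?Q ^ (p I k + 2 * b I k i))"
        if "k \<in> I" "k < i" for k
      proof -
        have "{r \<in> I. r < i} = {r \<in> I. r < k} \<union> insert k {r \<in> I. k < r \<and> r < i}"
          using that by auto
        moreover have "card \<dots> = card {r \<in> I. r < k} + card (insert k {r \<in> I. k < r \<and> r < i})"
          using assms by (intro card_Un_disjoint) auto
        ultimately have "p I i = Suc (p I k + b I k i)"
          using assms by (simp add: p_def b_def)
        then show ?thesis using q by (simp add: power_add mult_2 field_simps)
      qed
      then show ?thesis
        by (simp add: nc.scale_sum_right sum_negf[symmetric] nc.scale_minus_left[symmetric] del: nc.scale_minus_left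
           cong: conj_cong)
    qed
    finally show ?thesis
      unfolding p_def[symmetric] split
      using True by (simp add: pass_def p_def sum_distrib_right)
  next
    case False
    have "?F = (\<Sum>a\<in>I. ?Q ^ p I a \<cdot> (x a j * ?M (I - {a}) * y i)) - ?z \<cdot>
        (\<Sum>a\<in>I. \<Sum>k\<in>{k \<in> I - {a}. k < i}. (?Q ^ p I a * ?Q ^ b (I - {a}) k i) \<cdot>
            (x a j * ?M (insert i (I - {a} - {k})) * y k))"
      using False
      by (auto simp: pass_def b_def sum_subtractf[symmetric] right_diff_distrib nc.scale_right_diff_distrib
          sum_distrib_left nc.scale_sum_right ac_simps intro!: sum.cong)
    also have "(\<Sum>a\<in>I. \<Sum>k\<in>{k \<in> I - {a}. k < i}. (?Q ^ p I a * ?Q ^ b (I - {a}) k i) \<cdot>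
            (x a j * ?M (insert i (I - {a} - {k})) * y k))
       = (\<Sum>k\<in>{k\<in>I. k < i}. \<Sum>a\<in>I - {k}. (?Q ^ p I a * ?Q ^ b (I - {a}) k i) \<cdot>
            (x a j * ?M (insert i (I - {a} - {k})) * y k))"
      using assms(1) by (subst sum.Sigma, simp, simp, subst sum.Sigma, simp, simp,
        intro sum.reindex_bij_witness[of _ "\<lambda>(k, a). (a, k)" "\<lambda>(a, k). (k, a)"]) auto
    \<comment> \<open>The sum over \<open>a \<in> I - {k}\<close> is the expansion along column
      \<open>j\<close> of the minor with row \<open>k\<close> exchanged for row \<open>i\<close>,
      except that the summand of row \<open>i\<close> is missing; \<open>W k\<close> accounts for
      it.\<close>
    also have "\<dots> = (\<Sum>k\<in>{k\<in>I. k < i}. ?Q ^ b I k i \<cdot> (lap q x (insert i (I - {k})) (j # js) * y k) -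
        ?Q ^ (p I k + 2 * b I k i) \<cdot> W k)"
    proof (intro sum.cong refl, clarify)
      fix k assume k: "k \<in> I" "k < i"
      let ?I = "insert i (I - {k})"
      have i: "p ?I i = p I k + b I k i"
      proof -
        have "{r \<in> ?I. r < i} = {r \<in> I. r < k} \<union> {r \<in> I. k < r \<and> r < i}"
          using k False by auto
        moreover have "card \<dots> = card {r \<in> I. r < k} + card {r \<in> I. k < r \<and> r < i}"
          using assms by (intro card_Un_disjoint) auto
        ultimately show ?thesis by (simp add: p_def b_def)
      qed
      have a: "p I a + b (I - {a}) k i = b I k i + p ?I a" if "a \<in> I - {k}" for a
      proof (cases "k < a \<and> a < i")
        case True
        have "{r \<in> ?I. r < a} = {r \<in> I. r < a} - {k}" "{r \<in> I - {a}. k < r \<and> r < i} = {r \<in> I. k < r \<and> r < i} - {a}"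
          using k False True that by auto
        moreover have "card {r \<in> I. r < a} > 0" "card {r \<in> I. k < r \<and> r < i} > 0"
          using True that assms(1) k by (auto simp: card_gt_0_iff)
        ultimately show ?thesis
          using True that k assms(1) by (simp add: p_def b_def card_Diff_singleton)
      next
        case F: False
        then have *: "{r \<in> I - {a}. k < r \<and> r < i} = {r \<in> I. k < r \<and> r < i}" by auto
        show ?thesis
        proof (cases "a < k")
          case True
          then have "{r \<in> ?I. r < a} = {r \<in> I. r < a}" using k by auto
          with * show ?thesis by (simp add: p_def b_def)
        next
          case F2: False
          with F that False have "i < a" by (auto simp: not_less le_less)
          then have "{r \<in> ?I. r < a} = insert i ({r \<in> I. r < a} - {k})" using k by auto
          moreover have "card {r \<in> I. r < a} > 0" "i \<notin> {r \<in> I. r < a} - {k}" "k \<in> {r \<in> I. r < a}"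
            using \<open>i < a\<close> k assms(1) False by (auto simp: card_gt_0_iff)
          ultimately have "p ?I a = p I a"
            using assms(1) by (simp add: p_def)
          with * show ?thesis by (simp add: b_def)
        qed
      qed
      have set: "?I - {a} = insert i (I - {a} - {k})" if "a \<in> I - {k}" for a
        using that False by auto
      have "?I - {i} = I - {k}" using False by auto
      then have "lap q x ?I (j # js) = ?Q ^ p ?I i \<cdot> (x i j * ?M (I - {k}))
          + (\<Sum>a\<in>I - {k}. ?Q ^ p ?I a \<cdot> (x a j * ?M (insert i (I - {a} - {k}))))"
        using assms(1) False set by (simp add: p_def)
      then have "?Q ^ b I k i \<cdot> (lap q x ?I (j # js) * y k) = ?Q ^ (p I k + 2 * b I k i) \<cdot> W k
         + (\<Sum>a\<in>I - {k}. ?Q ^ (b I k i + p ?I a) \<cdot> (x a j * ?M (insert i (I - {a} - {k})) * y k))"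
        by (simp add: i W_def distrib_right nc.scale_right_distrib sum_distrib_right nc.scale_sum_right power_add
           mult_2 ac_simps del: lap.simps)
      also have "(\<Sum>a\<in>I - {k}. ?Q ^ (b I k i + p ?I a) \<cdot> (x a j * ?M (insert i (I - {a} - {k})) * y k))
         = (\<Sum>a\<in>I - {k}. (?Q ^ p I a * ?Q ^ b (I - {a}) k i) \<cdot> (x a j * ?M (insert i (I - {a} - {k})) * y k))"
        by (intro sum.cong) (simp_all flip: a power_add)
      finally show "(\<Sum>a\<in>I - {k}. (?Q ^ p I a * ?Q ^ b (I - {a}) k i) \<cdot> (x a j * ?M (insert i (I - {a} - {k})) * y k))
         = ?Q ^ b I k i \<cdot> (lap q x ?I (j # js) * y k) - ?Q ^ (p I k + 2 * b I k i) \<cdot> W k"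
        by (simp del: lap.simps)
    qed
    finally show ?thesis
      unfolding p_def[symmetric] split
      using False
      by (simp add: pass_def b_def p_def sum_distrib_right sum_subtractf nc.scale_right_diff_distrib)
  qed
qed

text \<open>The weights \<open>c j\<close> allow the minor to contain the column of \<open>y\<close>
  itself: two entries of one column obey the exchange rule for two columns up to a factor. All rows
  of \<open>A\<close> are treated together because the exchange replaces \<open>y i\<close> by
  \<open>y a\<close>.\<close>

lemma mult_lap_cong:
  assumes A: "finite A" and q: "q \<noteq> 0"
    and xy: "\<And>a i j. \<lbrakk>a \<in> A; i \<in> A; j \<in> set js\<rbrakk> \<Longrightarrow> y i * x a j \<approx>
      c j \<cdot> ((if a = i then inverse q else 1) \<cdot> (x a j * y i) - (if a < i then q - inverse q else 0) \<cdot> (x i j * y a))"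
    and "I \<subseteq> A" "i \<in> A"
  shows "y i * lap q x I js \<approx> prod_list (map c js) \<cdot> pass q x y I js i"
  using xy assms(4,5)
proof (induction js arbitrary: I i)
  case Nil
  then show ?case by (auto simp: pass_def)
next
  case (Cons j js)
  let ?C = "prod_list (map c js)" and ?M = "\<lambda>a. lap q x (I - {a}) js"
  let ?d = "\<lambda>a. if a = i then inverse q else 1" and ?e = "\<lambda>a. if a < i then q - inverse q else 0"
  have fin: "finite I" using A Cons.prems(2) finite_subset by blast
  have "y i * (x a j * ?M a) \<approx> (c j * ?C) \<cdot>
      (?d a \<cdot> (x a j * pass q x y (I - {a}) js i) - ?e a \<cdot> (x i j * pass q x y (I - {a}) js a))"
    if a: "a \<in> I" for a
  proof -
    have IH: "y l * ?M a \<approx> ?C \<cdot> pass q x y (I - {a}) js l" if "l \<in> A" for l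
      using that by (intro Cons.IH Cons.prems(1)) (use Cons.prems(2) in auto)
    have "y i * (x a j * ?M a) = y i * x a j * ?M a" by (simp add: mult.assoc)
    also have "\<dots> \<approx> c j \<cdot> (?d a \<cdot> (x a j * y i) - ?e a \<cdot> (x i j * y a)) * ?M a"
      using a Cons.prems by (intro cong_mult_right Cons.prems(1)) auto
    also have "\<dots> = c j \<cdot> (?d a \<cdot> (x a j * (y i * ?M a)) - ?e a \<cdot> (x i j * (y a * ?M a)))"
      by (simp add: left_diff_distrib mult.assoc)
    also have "\<dots> \<approx> c j \<cdot> (?d a \<cdot> (x a j * (?C \<cdot> pass q x y (I - {a}) js i))
        - ?e a \<cdot> (x i j * (?C \<cdot> pass q x y (I - {a}) js a)))"
      using a Cons.prems(2,3) by (intro cong_scale cong_diff cong_mult_left IH) auto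
    finally show ?thesis by (simp add: nc.scale_right_diff_distrib ac_simps)
  qed
  then have "(\<Sum>a\<in>I. (- q) ^ card {r \<in> I. r < a} \<cdot> (y i * (x a j * ?M a))) \<approx>
      (\<Sum>a\<in>I. (- q) ^ card {r \<in> I. r < a} \<cdot> ((c j * ?C) \<cdot>
      (?d a \<cdot> (x a j * pass q x y (I - {a}) js i) - ?e a \<cdot> (x i j * pass q x y (I - {a}) js a))))"
    by (intro cong_sum cong_scale)
  also have "\<dots> = (c j * ?C) \<cdot> (\<Sum>a\<in>I. (- q) ^ card {r \<in> I. r < a} \<cdot>
      (?d a \<cdot> (x a j * pass q x y (I - {a}) js i) - ?e a \<cdot> (x i j * pass q x y (I - {a}) js a)))"
    unfolding nc.scale_sum_right by (intro sum.cong refl nc.scale_left_commute)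
  also have "\<dots> = (c j * ?C) \<cdot> pass q x y I (j # js) i"
    unfolding pass_Cons[OF fin q] ..
  finally show ?case by (simp add: sum_distrib_left)
qed

text \<open>With the full set of rows, \<open>i\<close> is always among them, so \<open>pass\<close>
  has no corrections and the minor and the entry commute up to a scalar.\<close>

lemma mult_full_lap_cong:
  assumes "finite A" "q \<noteq> 0"
    and "\<And>a i j. \<lbrakk>a \<in> A; i \<in> A; j \<in> set js\<rbrakk> \<Longrightarrow> y i * x a j \<approx>
      c j \<cdot> ((if a = i then inverse q else 1) \<cdot> (x a j * y i) - (if a < i then q - inverse q else 0) \<cdot> (x i j * y a))"
    and "i \<in> A"
  shows "y i * lap q x A js \<approx> (prod_list (map c js) * inverse q) \<cdot> (lap q x A js * y i)"
  using mult_lap_cong[OF assms(1-3) order_refl assms(4)] assms(4) by (simp add: pass_def)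

end


text \<open>Both expansions of the induction step choose a row \<open>a\<close> for the first column
  and a row \<open>b\<close> for the last one. The exponents agree because the comparison of
  \<open>a\<close> with \<open>b\<close> is counted once on either side, in whichever order the two
  rows are removed.\<close>

lemma lap_snoc:
  assumes "finite I"
  shows "lap q x I (js @ [l]) = (\<Sum>b\<in>I. (- q) ^ card {r \<in> I. b < r} \<cdot> (lap q x (I - {b}) js * x b l))"
  using assms
proof (induction js arbitrary: I)
  case Nil
  have "(- q) ^ card {r \<in> I. r < b} \<cdot> (x b l * lap q x (I - {b}) []) =
      (- q) ^ card {r \<in> I. b < r} \<cdot> (lap q x (I - {b}) [] * x b l)" if "b \<in> I" for b
  proof (cases "I = {b}")
    case True
    then have "{r \<in> I. r < b} = {}" "{r \<in> I. b < r} = {}" by auto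
    then show ?thesis by (simp only:) simp
  next
    case False
    then have "I - {b} \<noteq> {}" using that by auto
    then show ?thesis by simp
  qed
  then show ?case by simp
next
  case (Cons j js)
  let ?Q = "- q"
  have e: "card {r \<in> I. r < a} + card {r \<in> I - {a}. b < r} = card {r \<in> I. b < r} + card {r \<in> I - {b}. r < a}"
    if "a \<in> I" "b \<in> I" "a \<noteq> b" for a b
  proof (cases "b < a")
    case True
    then have "{r \<in> I. b < r} = insert a {r \<in> I - {a}. b < r}" "{r \<in> I. r < a} = insert b {r \<in> I - {b}. r < a}"
      using that by auto
    then show ?thesis using Cons.prems by simp
  next
    case False
    then have "{r \<in> I. b < r} = {r \<in> I - {a}. b < r}" "{r \<in> I. r < a} = {r \<in> I - {b}. r < a}"
      using that by auto
    then show ?thesis by simp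
  qed
  have "lap q x I ((j # js) @ [l]) = (\<Sum>a\<in>I. \<Sum>b\<in>I - {a}. ?Q ^ (card {r \<in> I. r < a} + card {r \<in> I - {a}. b < r}) \<cdot>
     (x a j * lap q x (I - {a} - {b}) js * x b l))"
    using Cons by (simp add: sum_distrib_left nc.scale_sum_right power_add mult.assoc)
  also have "\<dots> = (\<Sum>b\<in>I. \<Sum>a\<in>I - {b}. ?Q ^ (card {r \<in> I. r < a} + card {r \<in> I - {a}. b < r}) \<cdot>
     (x a j * lap q x (I - {a} - {b}) js * x b l))"
    using Cons.prems by (subst sum.Sigma, simp, simp, subst sum.Sigma, simp, simp,
      intro sum.reindex_bij_witness[of _ "\<lambda>(k, a). (a, k)" "\<lambda>(a, k). (k, a)"]) auto
  also have "\<dots> = (\<Sum>b\<in>I. \<Sum>a\<in>I - {b}. ?Q ^ (card {r \<in> I. b < r} + card {r \<in> I - {b}. r < a}) \<cdot>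
     (x a j * lap q x (I - {b} - {a}) js * x b l))"
  proof (intro sum.cong refl)
    fix a b assume "b \<in> I" "a \<in> I - {b}"
    moreover have "I - {a} - {b} = I - {b} - {a}" by auto
    ultimately show "?Q ^ (card {r \<in> I. r < a} + card {r \<in> I - {a}. b < r}) \<cdot> (x a j * lap q x (I - {a} - {b}) js * x b l)
      = ?Q ^ (card {r \<in> I. b < r} + card {r \<in> I - {b}. r < a}) \<cdot> (x a j * lap q x (I - {b} - {a}) js * x b l)"
      using e[of a b] by (simp only: DiffE) auto
  qed
  finally show ?case
    by (simp add: sum_distrib_left sum_distrib_right nc.scale_sum_right power_add mult.assoc)
qed

section \<open>Reversal of words and the mirror image of the commutation rule\<close>

definition nc_rev :: "('k::field, 'v) nc_poly \<Rightarrow> ('k, 'v) nc_poly" where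
  "nc_rev = lin_ext (\<lambda>w. word (rev w))"

lemma lin_nc_rev: "lin nc_rev"
  by (simp add: nc_rev_def lin_lin_ext)

lemma nc_rev_word [simp]: "nc_rev (word w) = word (rev w)"
  by (simp add: nc_rev_def)

lemma nc_rev_one [simp]: "nc_rev 1 = 1"
  using nc_rev_word[of "[]"] by (simp add: word_Nil)

lemma nc_rev_mult: "nc_rev (f * g) = nc_rev g * nc_rev f"
proof -
  have "nc_rev (word u * g) = nc_rev g * nc_rev (word u)" for u
    by (rule lin_eqI[of "\<lambda>g. nc_rev (word u * g)" "\<lambda>g. nc_rev g * nc_rev (word u)"])
      (simp_all add: lin_comp[OF lin_nc_rev lin_mult_left] lin_comp[OF lin_mult_right lin_nc_rev] word_mult)
  then show ?thesis
    by (rule lin_eqI[of "\<lambda>f. nc_rev (f * g)" "\<lambda>f. nc_rev g * nc_rev f",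
      OF lin_comp[OF lin_nc_rev lin_mult_right] lin_comp[OF lin_mult_left lin_nc_rev]])
qed

lemma nc_rev_rev [simp]: "nc_rev (nc_rev f) = f"
  by (rule lin_eqI[of "\<lambda>f. nc_rev (nc_rev f)" "\<lambda>f. f"]) (simp_all add: lin_comp[OF lin_nc_rev lin_nc_rev] lin_id)

text \<open>Reversal turns the expansion along the first column into one along the last column,
  where the exponent counts the rows above instead of those below. Reversing the order of the rows
  by \<open>h\<close> restores the shape of a minor.\<close>

lemma nc_rev_lap:
  fixes h :: "'r::linorder \<Rightarrow> 's::linorder"
  assumes h: "\<And>a b. h b < h a \<longleftrightarrow> a < b" and xy: "\<And>a j. y (h a) j = nc_rev (x a j)" and "finite I"
  shows "nc_rev (lap q x I js) = lap q y (h ` I) (rev js)"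
  using assms(3)
proof (induction js arbitrary: I)
  case Nil
  then show ?case by (simp add: lin_zero[OF lin_nc_rev])
next
  case (Cons j js)
  have inj: "inj h"
    using h by (metis injI linorder_neq_iff)
  have c: "card {r \<in> I. r < a} = card {r \<in> h ` I. h a < r}" for a
  proof -
    have "{r \<in> h ` I. h a < r} = h ` {r \<in> I. r < a}" using h by auto
    then show ?thesis by (simp add: card_image inj_on_subset[OF inj])
  qed
  have d: "h ` (I - {a}) = h ` I - {h a}" for a
    using inj by (auto simp: inj_eq)
  show ?case
    using Cons.prems
    by (simp add: lap_snoc lin_simps[OF lin_nc_rev] nc_rev_mult Cons.IH
       sum.reindex[OF inj_on_subset[OF inj]] c d xy)
qed

context nc_ideal
begin

lemma nc_ideal_rev: "nc_ideal {f. nc_rev f \<in> \<I>}"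
  by unfold_locales
    (auto simp: nc.subspace_def lin_simps[OF lin_nc_rev] nc_rev_mult
      intro: mem_add mem_scale mem_zero mult_left mult_right)

text \<open>The mirror image of \<open>mult_full_lap_cong\<close>: reversal carries the ideal to an
  ideal, minors to minors, and the hypothesis on \<open>x\<close> and \<open>y\<close> to the
  exchange rule needed there.\<close>

lemma full_lap_mult_cong:
  fixes x :: "nat \<Rightarrow> 'c \<Rightarrow> ('k, 'v) nc_poly"
  assumes "finite A" "q \<noteq> 0"
    and yx: "\<And>a i j. \<lbrakk>a \<in> A; i \<in> A; j \<in> set js\<rbrakk> \<Longrightarrow> x a j * y i \<approx>
      c j \<cdot> ((if a = i then inverse q else 1) \<cdot> (y i * x a j) - (if i < a then q - inverse q else 0) \<cdot> (y a * x i j))"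
    and "i \<in> A"
  shows "lap q x A js * y i \<approx> (prod_list (map c js) * inverse q) \<cdot> (y i * lap q x A js)"
proof -
  interpret op: nc_ideal "{f. nc_rev f \<in> \<I>}" by (rule nc_ideal_rev)
  \<comment> \<open>Rows are moved to the integers since the natural numbers admit no
    order-reversing injection into themselves.\<close>
  define h where "h a = - int a" for a
  define g where "g b = nat (- b)" for b
  have gh [simp]: "g (h a) = a" for a by (simp add: g_def h_def)
  define x' where "x' b j = nc_rev (x (g b) j)" for b j
  define y' where "y' b = nc_rev (y (g b))" for b
  have op_cong: "op.cong u v \<longleftrightarrow> nc_rev u \<approx> nc_rev v" for u v
    by (simp add: op.cong_def cong_def lin_diff[OF lin_nc_rev])
  have rev_lap: "nc_rev (lap q x A js) = lap q x' (h ` A) (rev js)"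
    by (rule nc_rev_lap) (simp_all add: h_def x'_def g_def assms(1))
  have "op.cong (y' (h i) * lap q x' (h ` A) (rev js))
     ((prod_list (map c (rev js)) * inverse q) \<cdot> (lap q x' (h ` A) (rev js) * y' (h i)))"
  proof (rule op.mult_full_lap_cong[OF _ assms(2)])
    fix a i j assume "a \<in> h ` A" "i \<in> h ` A" "j \<in> set (rev js)"
    then obtain a' i' where a: "a = h a'" "a' \<in> A" "i = h i'" "i' \<in> A" and j: "j \<in> set js" by auto
    have "a = i \<longleftrightarrow> a' = i'" "a < i \<longleftrightarrow> i' < a'" using a by (auto simp: h_def)
    then show "op.cong (y' i * x' a j) (c j \<cdot> ((if a = i then inverse q else 1) \<cdot> (x' a j * y' i) -
        (if a < i then q - inverse q else 0) \<cdot> (x' i j * y' a)))"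
      using yx[OF a(2,4) j] a
      by (simp add: op_cong x'_def y'_def nc_rev_mult lin_simps[OF lin_nc_rev]
          del: nc.scale_eq_0_iff)
  qed (use assms in auto)
  then show ?thesis
    by (simp add: op_cong rev_lap[symmetric] y'_def nc_rev_mult lin_scale[OF lin_nc_rev] rev_map[symmetric] prod_list.rev)
qed

end

section \<open>Coxeter length and inversions\<close>

fun list_inversions :: "'a::linorder list \<Rightarrow> nat" where
  "list_inversions [] = 0"
| "list_inversions (i # r) = card {k \<in> set r. k < i} + list_inversions r"

text \<open>The row chosen for the first column stands first in \<open>r\<close>, so every smaller
  remaining row forms an inversion with it, and there are no others at that position.\<close>

lemma lap_eq_sum_permutations:
  assumes "finite I" "card I = length js"
  shows "lap q x I js = (\<Sum>r\<in>permutations_of_set I. (- q) ^ list_inversions r \<cdot> prod_list (map2 x r js))"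
  using assms
proof (induction js arbitrary: I)
  case (Cons j js)
  then have ne: "I \<noteq> {}" by auto
  have "lap q x I (j # js) = (\<Sum>i\<in>I. \<Sum>r\<in>permutations_of_set (I - {i}).
      (- q) ^ list_inversions (i # r) \<cdot> prod_list (map2 x (i # r) (j # js)))"
    unfolding lap.simps
  proof (intro sum.cong refl)
    fix i assume i: "i \<in> I"
    have s: "{k \<in> set r. k < i} = {r \<in> I. r < i}" if "r \<in> permutations_of_set (I - {i})" for r
      using permutations_of_setD(1)[OF that] by auto
    have "lap q x (I - {i}) js = (\<Sum>r\<in>permutations_of_set (I - {i}). (- q) ^ list_inversions r \<cdot> prod_list (map2 x r js))"
      using Cons i by (intro Cons.IH) auto
    then show "(- q) ^ card {r \<in> I. r < i} \<cdot> (x i j * lap q x (I - {i}) js) = (\<Sum>r\<in>permutations_of_set (I - {i}).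
      (- q) ^ list_inversions (i # r) \<cdot> prod_list (map2 x (i # r) (j # js)))"
      by (simp add: sum_distrib_left nc.scale_sum_right power_add s)
  qed
  also have "\<dots> = (\<Sum>r\<in>(\<Union>i\<in>I. (#) i ` permutations_of_set (I - {i})). (- q) ^ list_inversions r \<cdot> prod_list (map2 x r (j # js)))"
    using Cons.prems(1) by (subst sum.UNION_disjoint) (auto simp: sum.reindex)
  also have "(\<Union>i\<in>I. (#) i ` permutations_of_set (I - {i})) = permutations_of_set I"
    using permutations_of_set_nonempty[OF ne] by simp
  finally show ?case .
qed simp

definition inversions :: "nat \<Rightarrow> (nat \<Rightarrow> nat) \<Rightarrow> (nat \<times> nat) set" where
  "inversions t \<sigma> = {(a, b). a < b \<and> b < t \<and> \<sigma> b < \<sigma> a}"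

lemma finite_inversions [simp]: "finite (inversions t \<sigma>)"
  by (rule finite_subset[of _ "{..<t} \<times> {..<t}"]) (auto simp: inversions_def)

lemma list_inversions_map: "inj_on f {..<t} \<Longrightarrow> list_inversions (map f [0..<t]) = card (inversions t f)"
  for f :: "nat \<Rightarrow> nat"
proof (induction t arbitrary: f)
  case (Suc t)
  have up: "[0..<Suc t] = 0 # map Suc [0..<t]" by (metis map_Suc_upt upt_conv_Cons zero_less_Suc)
  have "inj_on (f \<circ> Suc) {..<t}" using Suc.prems by (auto simp: inj_on_def)
  note IH = Suc.IH[OF this]
  let ?A = "{b. b < t \<and> f (Suc b) < f 0}"
  have "inversions (Suc t) f = (\<lambda>b. (0, Suc b)) ` ?A \<union> map_prod Suc Suc ` inversions t (f \<circ> Suc)" (is "_ = ?L \<union> ?R")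
  proof (intro equalityI subsetI)
    fix p assume "p \<in> inversions (Suc t) f"
    then obtain a b where p: "p = (a, b)" "a < b" "b < Suc t" "f b < f a" by (auto simp: inversions_def)
    then obtain b' where b: "b = Suc b'" by (cases b) auto
    show "p \<in> ?L \<union> ?R"
      using p b by (cases a) (force simp: inversions_def)+
  qed (auto simp: inversions_def)
  moreover have "card (?L \<union> ?R) = card ?L + card ?R"
    by (intro card_Un_disjoint) auto
  moreover have "card ?L = card ?A" by (intro card_image) (auto simp: inj_on_def)
  moreover have "card ?R = card (inversions t (f \<circ> Suc))" by (intro card_image) (auto simp: inj_on_def)
  moreover have "{k \<in> set (map (f \<circ> Suc) [0..<t]). k < f 0} = (f \<circ> Suc) ` ?A" by auto
  moreover have "card ((f \<circ> Suc) ` ?A) = card ?A"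
    using \<open>inj_on (f \<circ> Suc) {..<t}\<close> by (intro card_image) (auto simp: inj_on_def)
  ultimately show ?case unfolding up by (simp only: list_inversions.simps list.map map_map IH)
qed (simp add: inversions_def)

section \<open>Coxeter length as the number of inversions\<close>

abbreviation transposition_word :: "nat list \<Rightarrow> nat \<Rightarrow> nat" where
  "transposition_word w \<equiv> foldr (\<lambda>a \<tau>. Transposition.transpose a (Suc a) \<circ> \<tau>) w id"

lemma permutes_transposition_word:
  "\<forall>a\<in>set w. Suc a < t \<Longrightarrow> transposition_word w permutes {..<t}"
proof (induction w)
  case (Cons a w)
  have eq: "transposition_word (a # w) = Transposition.transpose a (Suc a) \<circ> transposition_word w"
    by simp
  show ?case
    unfolding eq by (rule permutes_compose[OF Cons.IH permutes_swap_id]) (use Cons.prems in auto)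
qed (simp add: permutes_id)

text \<open>Composition on the left exchanges the values \<open>a\<close> and \<open>Suc a\<close>,
  so only the one pair of positions carrying these values can become a new inversion.\<close>

lemma card_inversions_transpose_le:
  assumes "\<sigma> permutes {..<t}" "Suc a < t"
  shows "card (inversions t (Transposition.transpose a (Suc a) \<circ> \<sigma>)) \<le> Suc (card (inversions t \<sigma>))"
proof -
  let ?\<tau> = "Transposition.transpose a (Suc a) \<circ> \<sigma>"
  note s = permutes_inverses[OF assms(1)]
  have "p \<in> insert (Hilbert_Choice.inv \<sigma> a, Hilbert_Choice.inv \<sigma> (Suc a)) (inversions t \<sigma>)"
    if p_in: "p \<in> inversions t ?\<tau>" for p
  proof -
    obtain u v where p: "p = (u, v)" "u < v" "v < t" "?\<tau> v < ?\<tau> u"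
      using p_in by (cases p) (auto simp: inversions_def)
    show ?thesis
    proof (cases "\<sigma> u = a \<and> \<sigma> v = Suc a")
      case True
      then show ?thesis using s(2)[of u] s(2)[of v] p(1) by simp
    next
      case False
      have "\<sigma> u \<noteq> \<sigma> v" using p(2) permutes_inj[OF assms(1)] by (auto simp: inj_eq)
      then have "\<sigma> v < \<sigma> u"
        using p(4) False by (auto simp: Transposition.transpose_def split: if_splits)
      with p show ?thesis by (simp add: inversions_def)
    qed
  qed
  then have "card (inversions t ?\<tau>) \<le>
      card (insert (Hilbert_Choice.inv \<sigma> a, Hilbert_Choice.inv \<sigma> (Suc a)) (inversions t \<sigma>))"
    by (intro card_mono) auto
  also have "\<dots> \<le> Suc (card (inversions t \<sigma>))"
    by (simp add: card_insert_if)
  finally show ?thesis .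
qed

lemma card_inversions_transpose_less:
  assumes "\<sigma> permutes {..<t}" "Suc a < t" "Hilbert_Choice.inv \<sigma> (Suc a) < Hilbert_Choice.inv \<sigma> a"
  shows "card (inversions t (Transposition.transpose a (Suc a) \<circ> \<sigma>)) < card (inversions t \<sigma>)"
proof (rule psubset_card_mono)
  let ?\<tau> = "Transposition.transpose a (Suc a) \<circ> \<sigma>"
  note s = permutes_inverses[OF assms(1)]
  have "Hilbert_Choice.inv \<sigma> a < t"
    using permutes_in_image[OF permutes_inv[OF assms(1)], of a] assms(2) by simp
  then have "(Hilbert_Choice.inv \<sigma> (Suc a), Hilbert_Choice.inv \<sigma> a) \<in> inversions t \<sigma> - inversions t ?\<tau>"
    using assms(3) by (simp add: inversions_def s)
  moreover have "p \<in> inversions t \<sigma>" if p_in: "p \<in> inversions t ?\<tau>" for p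
  proof -
    obtain u v where p: "p = (u, v)" "u < v" "v < t" "?\<tau> v < ?\<tau> u"
      using p_in by (cases p) (auto simp: inversions_def)
    have "\<not> (\<sigma> u = a \<and> \<sigma> v = Suc a)"
      using p(2) assms(3) s(2)[of u] s(2)[of v] by auto
    moreover have "\<sigma> u \<noteq> \<sigma> v" using p(2) permutes_inj[OF assms(1)] by (auto simp: inj_eq)
    ultimately have "\<sigma> v < \<sigma> u"
      using p(4) by (auto simp: Transposition.transpose_def split: if_splits)
    with p show ?thesis by (simp add: inversions_def)
  qed
  ultimately show "inversions t ?\<tau> \<subset> inversions t \<sigma>" by blast
qed simp

lemma permutes_increasing_eq_id:
  assumes "\<tau> permutes {..<t}" "\<And>a. Suc a < t \<Longrightarrow> \<tau> a < \<tau> (Suc a)"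
  shows "\<tau> = id"
proof
  fix i
  have step: "\<tau> i + d \<le> \<tau> (i + d)" if "i + d < t" for i d
    using that
  proof (induction d)
    case (Suc d)
    then show ?case using assms(2)[of "i + d"] by simp
  qed simp
  show "\<tau> i = id i"
  proof (cases "i < t")
    case True
    have "\<tau> (t - 1) < t" using permutes_in_image[OF assms(1), of "t - 1"] True by simp
    then show ?thesis using step[of 0 i] step[of i "t - 1 - i"] True by simp
  qed (use permutes_not_in[OF assms(1), of i] in simp)
qed

text \<open>If \<open>\<sigma>\<close> is not the identity, its inverse is not increasing, so two
  consecutive values stand in the wrong order; exchanging them removes an inversion.\<close>

lemma exists_transposition_word:
  assumes "\<sigma> permutes {..<t}"
  shows "\<exists>w. length w \<le> card (inversions t \<sigma>) \<and> (\<forall>a\<in>set w. Suc a < t) \<and> \<sigma> = transposition_word w"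
  using assms
proof (induction "card (inversions t \<sigma>)" arbitrary: \<sigma> rule: less_induct)
  case less
  show ?case
  proof (cases "\<sigma> = id")
    case True
    then show ?thesis by (intro exI[of _ "[]"]) simp
  next
    case False
    have "\<exists>a. Suc a < t \<and> Hilbert_Choice.inv \<sigma> (Suc a) < Hilbert_Choice.inv \<sigma> a"
    proof (rule ccontr)
      assume "\<not> ?thesis"
      moreover have "Hilbert_Choice.inv \<sigma> (Suc a) \<noteq> Hilbert_Choice.inv \<sigma> a" for a
        using permutes_inj[OF permutes_inv[OF less.prems]] by (metis injD n_not_Suc_n)
      ultimately have "Hilbert_Choice.inv \<sigma> = id"
        by (intro permutes_increasing_eq_id[OF permutes_inv[OF less.prems]]) (metis linorder_neqE_nat)
      then show False using False permutes_inv_inv[OF less.prems] by simp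
    qed
    then obtain a where a: "Suc a < t" "Hilbert_Choice.inv \<sigma> (Suc a) < Hilbert_Choice.inv \<sigma> a" by auto
    let ?\<tau> = "Transposition.transpose a (Suc a) \<circ> \<sigma>"
    have lt: "card (inversions t ?\<tau>) < card (inversions t \<sigma>)"
      using card_inversions_transpose_less[OF less.prems a] .
    moreover have "?\<tau> permutes {..<t}"
      using less.prems a(1) by (intro permutes_compose permutes_swap_id) auto
    ultimately obtain w where w: "length w \<le> card (inversions t ?\<tau>)" "\<forall>a\<in>set w. Suc a < t" "?\<tau> = transposition_word w"
      using less.hyps by blast
    have "\<sigma> = Transposition.transpose a (Suc a) \<circ> ?\<tau>" by (simp add: fun_eq_iff)
    with w lt a(1) show ?thesis by (intro exI[of _ "a # w"]) auto
  qed
qed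

lemma coxeter_length_eq_inversions:
  assumes "\<sigma> permutes {..<t}"
  shows "coxeter_length t \<sigma> = card (inversions t \<sigma>)"
proof -
  have le: "card (inversions t (transposition_word w)) \<le> length w" if "\<forall>a\<in>set w. Suc a < t" for w
    using that
  proof (induction w)
    case (Cons a w)
    have eq: "transposition_word (a # w) = Transposition.transpose a (Suc a) \<circ> transposition_word w"
      by simp
    have "card (inversions t (transposition_word w)) \<le> length w"
      by (rule Cons.IH) (use Cons.prems in simp)
    then show ?case
      unfolding eq length_Cons
      using card_inversions_transpose_le[OF permutes_transposition_word, of w t a] Cons.prems
      by (meson Suc_le_mono list.set_intros order_trans)
  next
    case Nil
    have "inversions t (transposition_word []) = {}"
      by (auto simp: inversions_def)
    then show ?case by (simp only: card.empty)
  qed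
  obtain w where w: "length w \<le> card (inversions t \<sigma>)" "\<forall>a\<in>set w. Suc a < t" "\<sigma> = transposition_word w"
    using exists_transposition_word[OF assms] by blast
  show ?thesis
    unfolding coxeter_length_def
  proof (rule Least_equality)
    show "\<exists>w. length w = card (inversions t \<sigma>) \<and> (\<forall>a\<in>set w. Suc a < t) \<and> \<sigma> = transposition_word w"
      using w le[OF w(2)] by (intro exI[of _ w]) simp
  qed (use le in auto)
qed

lemma bij_betw_permutes_permutations_of_set:
  "bij_betw (\<lambda>\<sigma>. map (\<lambda>a. Suc (\<sigma> a)) [0..<t]) {\<sigma>. \<sigma> permutes {..<t}} (permutations_of_set {1..t})"
proof -
  let ?f = "\<lambda>\<sigma>. map (\<lambda>a. Suc (\<sigma> a)) [0..<t]" and ?P = "{\<sigma>. \<sigma> permutes {..<t}}"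
  have inj: "inj_on ?f ?P"
  proof (rule inj_onI, rule ext)
    fix \<sigma> \<tau> a assume *: "\<sigma> \<in> ?P" "\<tau> \<in> ?P" "?f \<sigma> = ?f \<tau>"
    show "\<sigma> a = \<tau> a"
    proof (cases "a < t")
      case True
      then show ?thesis using *(3) by (simp add: list_eq_iff_nth_eq)
    next
      case False
      then show ?thesis
        using * permutes_not_in[of \<sigma> "{..<t}" a] permutes_not_in[of \<tau> "{..<t}" a] by simp
    qed
  qed
  have "?f ` ?P \<subseteq> permutations_of_set {1..t}"
  proof clarify
    fix \<sigma> assume s: "\<sigma> permutes {..<t}"
    have "set (?f \<sigma>) = Suc ` \<sigma> ` {..<t}" by (auto simp: atLeast0LessThan)
    also have "\<dots> = {1..t}" using permutes_image[OF s] by (simp add: image_Suc_lessThan)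
    finally show "?f \<sigma> \<in> permutations_of_set {1..t}"
      using inj_on_subset[OF permutes_inj[OF s]] by (intro permutations_of_setI) (auto simp: distinct_map inj_on_def)
  qed
  moreover have "card (?f ` ?P) = card (permutations_of_set {1..t})"
    using card_permutations[of "{..<t}" t] by (simp add: card_image[OF inj])
  ultimately have "?f ` ?P = permutations_of_set {1..t}"
    by (intro card_subset_eq) auto
  with inj show ?thesis by (simp add: bij_betw_def)
qed


section \<open>Moving the last column to the front\<close>

locale qmatrices =
  fixes q :: "'k::field" and m n :: nat
  assumes q: "q \<noteq> 0" and m: "0 < m" and mn: "m < n"
begin

abbreviation x :: "nat \<Rightarrow> nat \<Rightarrow> ('k, nat \<times> nat) nc_poly" where "x i j \<equiv> nc_var (i, j)"

abbreviation z :: 'k where "z \<equiv> q - inverse q"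

text \<open>A single straightening rule for two different columns, which puts the entry of the
  earlier column first; it unites the three families of defining relations for two columns.\<close>

definition rel_cols :: "nat \<Rightarrow> nat \<Rightarrow> nat \<Rightarrow> nat \<Rightarrow> ('k, nat \<times> nat) nc_poly" where
  "rel_cols a j b l = x b l * x a j - (if a = b then inverse q else 1) \<cdot> (x a j * x b l)
     + (if a < b then z else 0) \<cdot> (x b j * x a l)"

definition rel_col :: "nat \<Rightarrow> nat \<Rightarrow> nat \<Rightarrow> ('k, nat \<times> nat) nc_poly" where
  "rel_col a b j = x b j * x a j - inverse q \<cdot> (x a j * x b j)"

text \<open>The bound \<open>l'\<close> restricts only the relations between different columns. The
  relations inside each of the \<open>n\<close> columns always belong to it, as the tensor product
  requires for \<open>l' = n - 1\<close>.\<close>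

definition qrels :: "nat \<Rightarrow> ('k, nat \<times> nat) nc_poly set" where
  "qrels l' = {rel_cols a j b l | a j b l. a \<in> {1..m} \<and> b \<in> {1..m} \<and> 1 \<le> j \<and> j < l \<and> l \<le> l'}
     \<union> {rel_col a b j | a b j. a \<in> {1..m} \<and> b \<in> {1..m} \<and> a < b \<and> j \<in> {1..n}}"

definition \<R> :: "('k, nat \<times> nat) nc_poly set" where "\<R> = ideal_gen (qmat_relations q m n)"

sublocale nc_ideal \<R>
  unfolding \<R>_def by (rule nc_ideal_ideal_gen)

notation cong (infix "\<approx>" 50)

lemma inverse_q [simp]: "q * inverse q = 1" "inverse q * q = 1" "q * (inverse q * c) = c" "inverse q * (q * c) = c"
  using q by (simp_all flip: mult.assoc)

lemmas scale_simps = nc.scale_right_distrib nc.scale_right_diff_distrib nc.scale_left_distrib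
  nc.scale_left_diff_distrib algebra_simps

lemma qmat_relations_subset:
  assumes "nc_ideal J" and J: "qrels n \<subseteq> J"
  shows "qmat_relations q m n \<subseteq> J"
proof -
  interpret J: nc_ideal J by fact
  have E: "rel_cols a j b l \<in> J" if "a \<in> {1..m}" "b \<in> {1..m}" "1 \<le> j" "j < l" "l \<le> n" for a j b l
    using that J unfolding qrels_def by blast
  have D: "rel_col a b j \<in> J" if "a \<in> {1..m}" "b \<in> {1..m}" "a < b" "j \<in> {1..n}" for a j b
    using that J unfolding qrels_def by blast
  have e1: "x i j * x i l - q \<cdot> (x i l * x i j) = (- q) \<cdot> rel_cols i j i l" for i j l
    by (simp add: rel_cols_def scale_simps)
  have e2: "x i j * x k j - q \<cdot> (x k j * x i j) = (- q) \<cdot> rel_col i k j" for i j k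
    by (simp add: rel_col_def scale_simps)
  have e3: "x i j * x k l - x k l * x i j = (- 1) \<cdot> rel_cols i j k l" if "k < i" for i j k l
    using that by (simp add: rel_cols_def scale_simps)
  \<comment> \<open>The defining relation contains \<open>x i l * x k j\<close>, the straightening
    rule the same two factors in the opposite order; the second summand interchanges them.\<close>
  have e4: "x i j * x k l - x k l * x i j - z \<cdot> (x i l * x k j) = (- 1) \<cdot> rel_cols i j k l - z \<cdot> rel_cols k j i l"
    if "i < k" for i j k l
    using that by (simp add: rel_cols_def scale_simps)
  show ?thesis
    unfolding qmat_relations_def Let_def
  proof (safe, goal_cases)
    case (1 _ i j l)
    then show ?case unfolding e1 by (intro J.mem_scale E) auto
  next
    case (2 _ i k j)
    then show ?case unfolding e2 by (intro J.mem_scale D) auto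
  next
    case (3 _ i j k l)
    then show ?case unfolding e3[OF \<open>k < i\<close>] by (intro J.mem_scale E) auto
  next
    case (4 _ i j k l)
    then show ?case unfolding e4[OF \<open>i < k\<close>] by (intro J.mem_diff J.mem_scale E) auto
  qed
qed

lemma rel_cols_mem:
  assumes "a \<in> {1..m}" "b \<in> {1..m}" "1 \<le> j" "j < l" "l \<le> n"
  shows "rel_cols a j b l \<in> \<R>"
proof -
  have jl: "j \<in> {1..n}" "l \<in> {1..n}" using assms by auto
  have 1: "x i j * x i l - q \<cdot> (x i l * x i j) \<in> \<R>" if "i \<in> {1..m}" for i
    unfolding \<R>_def by (rule ideal_gen_base) (use that jl assms(4) in \<open>unfold qmat_relations_def Let_def, blast\<close>)
  have 3: "x i j * x k l - x k l * x i j \<in> \<R>" if "i \<in> {1..m}" "k \<in> {1..m}" "k < i" for i k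
    unfolding \<R>_def by (rule ideal_gen_base) (use that jl assms(4) in \<open>unfold qmat_relations_def Let_def, blast\<close>)
  have 4: "x i j * x k l - x k l * x i j - z \<cdot> (x i l * x k j) \<in> \<R>" if "i \<in> {1..m}" "k \<in> {1..m}" "i < k" for i k
    unfolding \<R>_def by (rule ideal_gen_base) (use that jl assms(4) in \<open>unfold qmat_relations_def Let_def, blast\<close>)
  consider "a = b" | "a < b" | "b < a" by linarith
  then show ?thesis
  proof cases
    case 1
    then have "rel_cols a j b l = (- inverse q) \<cdot> (x a j * x a l - q \<cdot> (x a l * x a j))"
      by (simp add: rel_cols_def scale_simps)
    then show ?thesis using \<open>\<And>i. i \<in> {1..m} \<Longrightarrow> x i j * x i l - q \<cdot> (x i l * x i j) \<in> \<R>\<close>[OF assms(1)]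
      by (simp only: mem_scale)
  next
    case 2
    then have "rel_cols a j b l = (- 1) \<cdot> (x a j * x b l - x b l * x a j - z \<cdot> (x a l * x b j))
       + z \<cdot> (x b j * x a l - x a l * x b j)"
      by (simp add: rel_cols_def scale_simps)
    then show ?thesis using 4[OF assms(1,2) 2] 3[OF assms(2,1) 2] by (simp only: mem_scale mem_add)
  next
    case 3
    then have "rel_cols a j b l = (- 1) \<cdot> (x a j * x b l - x b l * x a j)"
      by (simp add: rel_cols_def scale_simps)
    then show ?thesis using \<open>\<And>i k. i \<in> {1..m} \<Longrightarrow> k \<in> {1..m} \<Longrightarrow> k < i \<Longrightarrow> x i j * x k l - x k l * x i j \<in> \<R>\<close>[OF assms(1,2) 3]
      by (simp only: mem_scale)
  qed
qed

lemma rel_col_mem: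
  assumes "a \<in> {1..m}" "b \<in> {1..m}" "a < b" "j \<in> {1..n}"
  shows "rel_col a b j \<in> \<R>"
proof -
  have "x a j * x b j - q \<cdot> (x b j * x a j) \<in> \<R>"
    unfolding \<R>_def by (rule ideal_gen_base) (use assms in \<open>unfold qmat_relations_def Let_def, blast\<close>)
  moreover have "rel_col a b j = (- inverse q) \<cdot> (x a j * x b j - q \<cdot> (x b j * x a j))"
    by (simp add: rel_col_def scale_simps)
  ultimately show ?thesis by (simp only: mem_scale)
qed

lemma \<R>_eq: "\<R> = ideal_gen (qrels n)"
proof
  show "\<R> \<subseteq> ideal_gen (qrels n)"
    unfolding \<R>_def
    by (intro ideal_gen_minimal nc_ideal_ideal_gen qmat_relations_subset) (auto intro: ideal_gen_base)
  show "ideal_gen (qrels n) \<subseteq> \<R>"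
    by (rule ideal_gen_minimal[OF nc_ideal_axioms]) (auto simp: qrels_def intro: rel_cols_mem rel_col_mem)
qed

section \<open>Maximal minors and the entries of the first and the last column\<close>

abbreviation qdet :: "nat list \<Rightarrow> ('k, nat \<times> nat) nc_poly" where
  "qdet js \<equiv> lap q x {1..m} js"

lemma same_col_cong:
  assumes "a \<in> {1..m}" "b \<in> {1..m}" "j \<in> {1..n}" "a < b"
  shows "x b j * x a j \<approx> inverse q \<cdot> (x a j * x b j)" "x a j * x b j \<approx> q \<cdot> (x b j * x a j)"
proof -
  show *: "x b j * x a j \<approx> inverse q \<cdot> (x a j * x b j)"
    using rel_col_mem[of a b j] assms by (simp add: cong_def rel_col_def)
  then have "q \<cdot> (x b j * x a j) \<approx> q \<cdot> (inverse q \<cdot> (x a j * x b j))" by (rule cong_scale)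
  then show "x a j * x b j \<approx> q \<cdot> (x b j * x a j)" using cong_sym by simp
qed

text \<open>Entries of column \<open>n\<close> satisfy among themselves the exchange rule for
  different columns multiplied by \<open>q\<close>. Hence each occurrence of \<open>n\<close> in
  \<open>js\<close> adds a factor \<open>q\<close> to the \<open>inverse q\<close> from the
  crossing.\<close>

lemma last_col_mult_qdet:
  assumes "i \<in> {1..m}" "set js \<subseteq> {1..n}"
  shows "x i n * qdet js \<approx> (prod_list (map (\<lambda>j. if j = n then q else 1) js) * inverse q) \<cdot> (qdet js * x i n)"
proof (rule mult_full_lap_cong[of _ q js "\<lambda>i. x i n"])
  fix a i j assume "a \<in> {1..m}" "i \<in> {1..m}" "j \<in> set js"
  then have j: "j \<in> {1..n}" and ai: "a \<in> {1..m}" "i \<in> {1..m}" using assms by auto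
  show "x i n * x a j \<approx> (if j = n then q else 1) \<cdot>
     ((if a = i then inverse q else 1) \<cdot> (x a j * x i n) - (if a < i then z else 0) \<cdot> (x i j * x a n))"
  proof (cases "j = n")
    case False
    then show ?thesis
      using rel_cols_mem[of a i j n] ai j by (simp add: rel_cols_def cong_def algebra_simps)
  next
    case True
    consider "a = i" | "i < a" | "a < i" by linarith
    then show ?thesis
    proof cases
      case 2
      then show ?thesis using True ai same_col_cong(2)[of i a n] mn by simp
    next
      case 3
      \<comment> \<open>Writing \<open>inverse q\<close> as \<open>q - z\<close> produces the
        correction term of the exchange rule, although the relation inside a column has
        none.\<close>
      have "x i n * x a n = q \<cdot> (inverse q \<cdot> (x i n * x a n))" by simp
      also have "\<dots> = q \<cdot> (q \<cdot> (x i n * x a n) - z \<cdot> (x i n * x a n))"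
        by (simp add: nc.scale_left_diff_distrib[symmetric])
      also have "\<dots> \<approx> q \<cdot> (x a n * x i n - z \<cdot> (x i n * x a n))"
        using 3 ai mn by (intro cong_scale cong_diff cong_refl cong_sym[OF same_col_cong(2)]) auto
      finally show ?thesis using 3 True by simp
    qed (simp add: True)
  qed
qed (use assms q in auto)

lemma qdet_mult_first_col:
  assumes "i \<in> {1..m}" "set js \<subseteq> {1..n}"
  shows "qdet js * x i 1 \<approx> (prod_list (map (\<lambda>j. if j = 1 then q else 1) js) * inverse q) \<cdot> (x i 1 * qdet js)"
proof (rule full_lap_mult_cong[of _ q js x "\<lambda>i. x i 1"])
  fix a i j assume "a \<in> {1..m}" "i \<in> {1..m}" "j \<in> set js"
  then have j: "j \<in> {1..n}" and ai: "a \<in> {1..m}" "i \<in> {1..m}" using assms by auto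
  show "x a j * x i 1 \<approx> (if j = 1 then q else 1) \<cdot>
     ((if a = i then inverse q else 1) \<cdot> (x i 1 * x a j) - (if i < a then z else 0) \<cdot> (x a 1 * x i j))"
  proof (cases "j = 1")
    case False
    then show ?thesis
      using rel_cols_mem[of i a 1 j] ai j by (auto simp: rel_cols_def cong_def algebra_simps)
  next
    case True
    consider "a = i" | "a < i" | "i < a" by linarith
    then show ?thesis
    proof cases
      case 2
      then show ?thesis using True ai same_col_cong(2)[of a i 1] mn by simp
    next
      case 3
      have "x a 1 * x i 1 = q \<cdot> (inverse q \<cdot> (x a 1 * x i 1))" by simp
      also have "\<dots> = q \<cdot> (q \<cdot> (x a 1 * x i 1) - z \<cdot> (x a 1 * x i 1))"
        by (simp add: nc.scale_left_diff_distrib[symmetric])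
      also have "\<dots> \<approx> q \<cdot> (x i 1 * x a 1 - z \<cdot> (x a 1 * x i 1))"
        using 3 ai mn by (intro cong_scale cong_diff cong_refl cong_sym[OF same_col_cong(2)]) auto
      finally show ?thesis using 3 True by simp
    qed (simp add: True)
  qed
qed (use assms q in auto)

section \<open>The tensor product model and the operators of column \<open>n\<close>\<close>

abbreviation V :: "(nat \<times> nat) set" where "V \<equiv> qmat_indices m n"

text \<open>
  Modulo \<open>\<T>\<close> the column \<open>n\<close> commutes with the other columns: the quotient is the tensor product
  of the algebra of the columns \<open>1, \<dots>, n - 1\<close> with the algebra of the column \<open>n\<close>.
\<close>

definition tensor_rels :: "('k, nat \<times> nat) nc_poly set" where
  "tensor_rels = qrels (n - 1) \<union>
     {x s j * x i n - x i n * x s j | s j i. s \<in> {1..m} \<and> i \<in> {1..m} \<and> 1 \<le> j \<and> j < n}"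

definition \<T> :: "('k, nat \<times> nat) nc_poly set" where "\<T> = ideal_gen tensor_rels"

lemma nc_ideal_\<T>: "nc_ideal \<T>"
  unfolding \<T>_def by (rule nc_ideal_ideal_gen)

sublocale T: nc_ideal \<T>
  by (rule nc_ideal_\<T>)

notation T.cong (infix "\<approx>\<^sub>T" 50)

lemma "f \<approx>\<^sub>T f" by simp


lemmas [trans] = cong_mem T.cong_mem

text \<open>The matrix of straightening: for a word \<open>w\<close> in the columns before
  \<open>n\<close>, the product of \<open>x i n\<close> and \<open>w\<close> is congruent modulo
  \<open>\<R>\<close> to the sum over \<open>k\<close> of \<open>rho_word i k w * x k n\<close>.
  Letters of column \<open>n\<close> are left alone since only the first tensor factor is to be
  acted on. Words with letters outside \<open>V\<close> are sent to 0, as also in \<open>act\<close>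
  and \<open>to_front\<close>.\<close>

fun rho_word :: "nat \<Rightarrow> nat \<Rightarrow> (nat \<times> nat) list \<Rightarrow> ('k, nat \<times> nat) nc_poly" where
  "rho_word i k [] = (if i = k then 1 else 0)"
| "rho_word i k ((s, j) # w) =
     (if (s, j) \<notin> V then 0
      else if j = n then x s j * rho_word i k w
      else (if s = i then inverse q else 1) \<cdot> (x s j * rho_word i k w)
         - (if s < i then z else 0) \<cdot> (x i j * rho_word s k w))"

definition rho :: "nat \<Rightarrow> nat \<Rightarrow> ('k, nat \<times> nat) nc_poly \<Rightarrow> ('k, nat \<times> nat) nc_poly" where
  "rho i k = lin_ext (rho_word i k)"

lemma lin_rho: "lin (rho i k)"
  by (simp add: rho_def lin_lin_ext)

lemma rho_word_eq [simp]: "rho i k (word w) = rho_word i k w"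
  by (simp add: rho_def)

lemma rho_one: "rho i k 1 = (if i = k then 1 else 0)"
  using rho_word_eq[of i k "[]"] by (simp add: word_Nil)

lemma mem_V: "(s, j) \<in> V \<longleftrightarrow> s \<in> {1..m} \<and> j \<in> {1..n}"
  by (auto simp: qmat_indices_def)

lemma rho_last:
  assumes "s \<in> {1..m}"
  shows "rho i k (x s n * f) = x s n * rho i k f"
  by (rule lin_eqI[of "\<lambda>f. rho i k (x s n * f)" "\<lambda>f. x s n * rho i k f",
      OF lin_comp[OF lin_rho lin_mult_left] lin_comp[OF lin_mult_left lin_rho]])
    (use assms mn in \<open>simp add: word_Cons[symmetric] mem_V\<close>)

lemma lin_diff_fun: "lin L \<Longrightarrow> lin L' \<Longrightarrow> lin (\<lambda>f. L f - L' f)"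
  by (rule linI) (simp_all add: lin_add lin_scale nc.scale_right_diff_distrib)

lemma rho_var:
  assumes "s \<in> {1..m}" "1 \<le> j" "j < n"
  shows "rho i k (x s j * f) = (if s = i then inverse q else 1) \<cdot> (x s j * rho i k f)
         - (if s < i then z else 0) \<cdot> (x i j * rho s k f)"
  by (rule lin_eqI[of "\<lambda>f. rho i k (x s j * f)" "\<lambda>f. (if s = i then inverse q else 1) \<cdot> (x s j * rho i k f)
         - (if s < i then z else 0) \<cdot> (x i j * rho s k f)",
      OF lin_comp[OF lin_rho lin_mult_left] lin_diff_fun[OF lin_scaled[OF lin_comp[OF lin_mult_left lin_rho]]
        lin_scaled[OF lin_comp[OF lin_mult_left lin_rho]]]])
    (use assms in \<open>simp add: word_Cons[symmetric] mem_V\<close>)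

lemma rho_junk:
  assumes "(s, j) \<notin> V"
  shows "rho i k (x s j * f) = 0"
  by (rule lin_eqI[of "\<lambda>f. rho i k (x s j * f)" "\<lambda>f. 0", OF lin_comp[OF lin_rho lin_mult_left]])
    (use assms in \<open>simp_all add: word_Cons[symmetric] linI\<close>)

lemma rho_word_append_last: "s \<in> {1..m} \<Longrightarrow> rho_word i k (w @ [(s, n)]) = rho_word i k w * x s n"
  by (induction i k w rule: rho_word.induct) (use mn in \<open>auto simp: mem_V left_diff_distrib mult.assoc\<close>)

lemma rho_mult_last:
  assumes "s \<in> {1..m}"
  shows "rho i k (f * x s n) = rho i k f * x s n"
  by (rule lin_eqI[of "\<lambda>f. rho i k (f * x s n)" "\<lambda>f. rho i k f * x s n",
      OF lin_comp[OF lin_rho lin_mult_right] lin_comp[OF lin_mult_right lin_rho]])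
    (use assms in \<open>simp add: nc_var_eq word_mult rho_word_append_last\<close>)

lemma tensor_cols_mem:
  assumes "a \<in> {1..m}" "b \<in> {1..m}" "1 \<le> j" "j < l" "l < n"
  shows "rel_cols a j b l \<in> \<T>"
  unfolding \<T>_def tensor_rels_def qrels_def
  by (rule ideal_gen_base, rule UnI1, rule UnI1, rule CollectI, intro exI conjI, rule refl) (use assms in auto)

lemma tensor_col_mem:
  assumes "a \<in> {1..m}" "b \<in> {1..m}" "a < b" "j \<in> {1..n}"
  shows "rel_col a b j \<in> \<T>"
  unfolding \<T>_def tensor_rels_def qrels_def
  by (rule ideal_gen_base, rule UnI1, rule UnI2, rule CollectI, intro exI conjI, rule refl) (use assms in auto)

lemma tensor_commute:
  assumes "s \<in> {1..m}" "i \<in> {1..m}" "1 \<le> j" "j < n"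
  shows "x s j * x i n - x i n * x s j \<in> \<T>"
  unfolding \<T>_def tensor_rels_def
  by (rule ideal_gen_base, rule UnI2, rule CollectI, intro exI conjI, rule refl) (use assms in auto)

text \<open>A form of the Yang-Baxter equation: straightening across a relation gives a combination
  of relations of the same two columns, with the row \<open>i\<close> exchanged in. It is an
  identity in the free algebra, so it suffices to compare coefficients for each relative position of
  the rows \<open>i\<close>, \<open>a\<close>, \<open>b\<close>.\<close>

lemma rho_rel_cols:
  assumes "a \<in> {1..m}" "b \<in> {1..m}" "1 \<le> j" "j < l" "l < n"
  shows "rho i k (rel_cols a j b l * g) =
     ((if i = a then inverse q else 1) * (if i = b then inverse q else 1)) \<cdot> (rel_cols a j b l * rho i k g)
     - (if a < i then z * (if i = b then inverse q else 1) else 0) \<cdot> (rel_cols i j b l * rho a k g)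
     - (if b < i then z * (if a = b then inverse q else 1) else 0) \<cdot> (rel_cols a j i l * rho b k g)
     + (if a < b \<and> b < i then z * z else 0) \<cdot> (rel_cols b j i l * rho a k g)"
proof -
  have r: "rho i k (x s j * f) = (if s = i then inverse q else 1) \<cdot> (x s j * rho i k f)
         - (if s < i then z else 0) \<cdot> (x i j * rho s k f)"
    "rho i k (x s l * f) = (if s = i then inverse q else 1) \<cdot> (x s l * rho i k f)
         - (if s < i then z else 0) \<cdot> (x i l * rho s k f)" if "s \<in> {1..m}" for i s f
    using rho_var that assms by auto
  note r = r[OF assms(1)] r[OF assms(2)]
  note lin = lin_simps[OF lin_rho]
  consider "a < b \<and> b < i \<or> b < a \<and> a < i"
    | "i < a" "a < b" | "i = a" "a < b" | "a < i" "i < b" | "i = b" "a < b"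
    | "i < b" "b < a" | "i = b" "b < a" | "b < i" "i < a" | "i = a" "b < a"
    | "i < a" "a = b" | "i = a" "a = b" | "a < i" "a = b"
    using linorder_less_linear[of i a] linorder_less_linear[of i b] linorder_less_linear[of a b]
    by (elim disjE) auto
  then show ?thesis
  proof cases
    case 1
    \<comment> \<open>For these positions the identity holds with any scalar in place of
      \<open>z\<close>; hiding \<open>z\<close> keeps it from being expanded.\<close>
    define w where "w = z"
    from 1 show ?thesis
      unfolding rel_cols_def w_def[symmetric]
      by (elim disjE) (simp_all add: scale_simps lin r[folded w_def])
  qed (simp_all add: rel_cols_def scale_simps lin r)
qed

lemma rho_rel_col:
  assumes "a \<in> {1..m}" "b \<in> {1..m}" "a < b" "1 \<le> j" "j < n"
  shows "rho i k (rel_col a b j * g) =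
     ((if i = a then inverse q else 1) * (if i = b then inverse q else 1)) \<cdot> (rel_col a b j * rho i k g)
     + (if b < i then (z * (z + inverse q)) \<cdot> (rel_col b i j * rho a k g) - z \<cdot> (rel_col a i j * rho b k g)
        else if a < i \<and> i < b then (- z) \<cdot> (rel_col i b j * rho a k g) else 0)"
proof -
  have r: "rho i k (x s j * f) = (if s = i then inverse q else 1) \<cdot> (x s j * rho i k f)
         - (if s < i then z else 0) \<cdot> (x i j * rho s k f)" if "s \<in> {1..m}" for i s f
    using rho_var that assms by auto
  note r = r[OF assms(1)] r[OF assms(2)]
  note lin = lin_simps[OF lin_rho]
  consider "b < i" | "i < a" | "i = a" | "a < i" "i < b" | "i = b" using assms(3) by linarith
  then show ?thesis
  proof cases
    case 1
    define w where "w = z"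
    \<comment> \<open>This is \<open>z + inverse q = q\<close>, multiplied by
      \<open>z * inverse q\<close>.\<close>
    have "w * (w * inverse q) + w * (inverse q * inverse q) = w"
      by (simp add: w_def algebra_simps)
    then have w: "(w * (w * inverse q)) \<cdot> f + (w * (inverse q * inverse q)) \<cdot> f = w \<cdot> f"
      for f :: "('k, nat \<times> nat) nc_poly"
      by (simp only: nc.scale_left_distrib[symmetric])
    from 1 assms(3) show ?thesis
      unfolding rel_col_def w_def[symmetric] by (simp add: scale_simps lin r[folded w_def] w)
  qed (use assms(3) in \<open>simp_all add: rel_col_def scale_simps lin r\<close>)
qed

lemma tensor_relsE:
  assumes "r \<in> tensor_rels"
  obtains a j b l where "r = rel_cols a j b l" "a \<in> {1..m}" "b \<in> {1..m}" "1 \<le> j" "j < l" "l < n"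
    | a b j where "r = rel_col a b j" "a \<in> {1..m}" "b \<in> {1..m}" "a < b" "1 \<le> j" "j < n"
    | a b where "r = rel_col a b n" "a \<in> {1..m}" "b \<in> {1..m}" "a < b"
    | s j i where "r = x s j * x i n - x i n * x s j" "s \<in> {1..m}" "i \<in> {1..m}" "1 \<le> j" "j < n"
proof -
  from assms consider a j b l where "r = rel_cols a j b l" "a \<in> {1..m}" "b \<in> {1..m}" "1 \<le> j" "j < l" "l < n"
    | a b j where "r = rel_col a b j" "a \<in> {1..m}" "b \<in> {1..m}" "a < b" "j \<in> {1..n}"
    | s j i where "r = x s j * x i n - x i n * x s j" "s \<in> {1..m}" "i \<in> {1..m}" "1 \<le> j" "j < n"
    unfolding tensor_rels_def qrels_def using mn by force
  then show ?thesis
  proof cases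
    case (2 a b j)
    then show ?thesis using that(2)[of a b j] that(3)[of a b] by (cases "j = n") auto
  qed (use that in blast)+
qed

lemma rho_tensor_rel:
  assumes r: "r \<in> tensor_rels" and i: "i \<in> {1..m}"
  shows "rho i k (r * g) \<in> \<T>"
  using r
proof (cases rule: tensor_relsE)
  case (1 a j b l)
  show ?thesis
    unfolding 1(1) rho_rel_cols[OF 1(2-6)]
    by (intro T.mem_add T.mem_diff T.mem_scale T.mult_right tensor_cols_mem) (use 1 i in auto)
next
  case (2 a b j)
  have "rel_col s t j * f \<in> \<T>" if "s \<in> {1..m}" "t \<in> {1..m}" "s < t" for s t f
    using that 2 by (intro T.mult_right tensor_col_mem) auto
  then show ?thesis
    unfolding 2(1) rho_rel_col[OF 2(2-6)]
    using 2 i by (auto intro!: T.mem_add T.mem_diff T.mem_scale T.mem_zero)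
next
  case (3 a b)
  have "rho i k (r * g) = r * rho i k g"
    using 3 by (simp add: rel_col_def left_diff_distrib mult.assoc lin_simps[OF lin_rho] rho_last)
  then show ?thesis using 3 mn by (simp add: T.mult_right tensor_col_mem)
next
  case (4 s j t)
  have "rho i k (r * g) = (if s = i then inverse q else 1) \<cdot> ((x s j * x t n - x t n * x s j) * rho i k g)
     - (if s < i then z else 0) \<cdot> ((x i j * x t n - x t n * x i j) * rho s k g)"
    unfolding 4(1) left_diff_distrib mult.assoc lin_diff[OF lin_rho] rho_var[OF 4(2,4,5)] rho_last[OF 4(3)]
    by (simp add: scale_simps)
  then show ?thesis
    using 4 i by (simp add: T.mem_diff T.mem_scale T.mult_right tensor_commute)
qed

lemma rho_tensor:
  assumes "f \<in> \<T>" "i \<in> {1..m}"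
  shows "rho i k f \<in> \<T>"
proof -
  have "rho i k (word u * r * word v) \<in> \<T>" if r: "r \<in> tensor_rels" and i: "i \<in> {1..m}" for i u r v
    using i
  proof (induction u arbitrary: i)
    case Nil
    then show ?case using rho_tensor_rel[OF r] by (simp add: word_Nil)
  next
    case (Cons w u)
    obtain s j where w: "w = (s, j)" by (cases w)
    have e: "word (w # u) * r * word v = x s j * (word u * r * word v)"
      by (simp add: word_Cons w mult.assoc)
    consider "(s, j) \<notin> V" | "s \<in> {1..m}" "j = n" | "s \<in> {1..m}" "1 \<le> j" "j < n"
      by (fastforce simp: mem_V)
    then show ?case
    proof cases
      case 1
      then show ?thesis unfolding e by (simp add: rho_junk T.mem_zero)
    next
      case 2
      then show ?thesis unfolding e using Cons by (simp add: rho_last T.mult_left)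
    next
      case 3
      then show ?thesis unfolding e rho_var[OF 3] using Cons
        by (intro T.mem_diff T.mem_scale T.mult_left) auto
    qed
  qed
  then show ?thesis
    using ideal_gen_image[OF lin_rho T.subspace, of tensor_rels i k f] assms unfolding \<T>_def by blast
qed

text \<open>Left multiplication by \<open>x i n\<close> in the tensor product model. The factor
  \<open>x k n\<close> belongs between the two tensor factors, but may stand in front since it
  commutes with the first one modulo \<open>\<T>\<close>.\<close>

definition Y :: "nat \<Rightarrow> ('k, nat \<times> nat) nc_poly \<Rightarrow> ('k, nat \<times> nat) nc_poly" where
  "Y i f = (\<Sum>k\<in>{1..m}. x k n * rho i k f)"

lemma lin_Y: "lin (Y i)"
  unfolding Y_def by (intro lin_sum_fun lin_comp[OF lin_mult_left lin_rho])

lemma Y_tensor: "f \<in> \<T> \<Longrightarrow> i \<in> {1..m} \<Longrightarrow> Y i f \<in> \<T>"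
  unfolding Y_def by (intro T.mem_sum T.mult_left rho_tensor)

lemma Y_cong: "f \<approx>\<^sub>T g \<Longrightarrow> i \<in> {1..m} \<Longrightarrow> Y i f \<approx>\<^sub>T Y i g"
  unfolding T.cong_def using Y_tensor by (simp flip: lin_diff[OF lin_Y])

lemma Y_one: "i \<in> {1..m} \<Longrightarrow> Y i 1 = x i n"
  by (simp add: Y_def rho_one if_distrib cong: if_cong)

lemma Y_mult_last: "s \<in> {1..m} \<Longrightarrow> Y i (f * x s n) = Y i f * x s n"
  by (simp add: Y_def rho_mult_last sum_distrib_right mult.assoc)

lemma Y_var:
  assumes "s \<in> {1..m}" "i \<in> {1..m}" "1 \<le> j" "j < n"
  shows "Y i (x s j * f) \<approx>\<^sub>T (if s = i then inverse q else 1) \<cdot> (x s j * Y i f) - (if s < i then z else 0) \<cdot> (x i j * Y s f)"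
proof -
  have c: "x k n * (x t j * h) \<approx>\<^sub>T x t j * (x k n * h)" if "t \<in> {1..m}" "k \<in> {1..m}" for t k h
    using T.mult_right[OF tensor_commute[of t k j], of "- h"] that assms
    by (simp add: T.cong_def algebra_simps)
  have "Y i (x s j * f) = (\<Sum>k\<in>{1..m}. (if s = i then inverse q else 1) \<cdot> (x k n * (x s j * rho i k f))
      - (if s < i then z else 0) \<cdot> (x k n * (x i j * rho s k f)))"
    by (simp add: Y_def rho_var[OF assms(1,3,4)] right_diff_distrib)
  also have "\<dots> \<approx>\<^sub>T (\<Sum>k\<in>{1..m}. (if s = i then inverse q else 1) \<cdot> (x s j * (x k n * rho i k f))
      - (if s < i then z else 0) \<cdot> (x i j * (x k n * rho s k f)))"
    by (intro T.cong_sum T.cong_diff T.cong_scale c assms)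
  finally show ?thesis
    by (simp add: Y_def sum_subtractf sum_distrib_left nc.scale_sum_right)
qed

text \<open>When both sides are pushed through \<open>x s j\<close>, their difference becomes a
  combination of the defects \<open>A\<close> of the same relation at \<open>f\<close>, taken at
  pairs of rows among \<open>i\<close>, \<open>k\<close>, \<open>s\<close>. Therefore the hypothesis
  has to cover all pairs of rows at once.\<close>

lemma Y_commute_var:
  assumes IH: "\<And>i k. \<lbrakk>i \<in> {1..m}; k \<in> {1..m}; i < k\<rbrakk> \<Longrightarrow> Y i (Y k f) \<approx>\<^sub>T q \<cdot> Y k (Y i f)"
    and s: "s \<in> {1..m}" "1 \<le> j" "j < n" and ik: "i \<in> {1..m}" "k \<in> {1..m}" "i < k"
  shows "Y i (Y k (x s j * f)) \<approx>\<^sub>T q \<cdot> Y k (Y i (x s j * f))"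
proof -
  let ?d = "\<lambda>i s. if s = i then inverse q else 1" and ?e = "\<lambda>i s. if s < i then z else (0 :: 'k)"
  have YY: "Y i (Y k (x s j * f)) \<approx>\<^sub>T
      ?d k s \<cdot> (?d i s \<cdot> (x s j * Y i (Y k f)) - ?e i s \<cdot> (x i j * Y s (Y k f)))
      - ?e k s \<cdot> (?d i k \<cdot> (x k j * Y i (Y s f)) - ?e i k \<cdot> (x i j * Y k (Y s f)))"
    if "i \<in> {1..m}" "k \<in> {1..m}" for i k
  proof -
    have "Y i (Y k (x s j * f)) \<approx>\<^sub>T Y i (?d k s \<cdot> (x s j * Y k f) - ?e k s \<cdot> (x k j * Y s f))"
      using that s by (intro Y_cong Y_var)
    also have "\<dots> = ?d k s \<cdot> Y i (x s j * Y k f) - ?e k s \<cdot> Y i (x k j * Y s f)"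
      by (simp add: lin_simps[OF lin_Y])
    also have "\<dots> \<approx>\<^sub>T ?d k s \<cdot> (?d i s \<cdot> (x s j * Y i (Y k f)) - ?e i s \<cdot> (x i j * Y s (Y k f)))
      - ?e k s \<cdot> (?d i k \<cdot> (x k j * Y i (Y s f)) - ?e i k \<cdot> (x i j * Y k (Y s f)))"
      using that s by (intro T.cong_diff T.cong_scale Y_var)
    finally show ?thesis .
  qed
  define A where "A = (\<lambda>i k. Y i (Y k f) - q \<cdot> Y k (Y i f))"
  have A: "A i k \<in> \<T>" if "i \<in> {1..m}" "k \<in> {1..m}" "i < k" for i k
    using IH[OF that] by (simp add: A_def T.cong_def)
  have "Y i (Y k (x s j * f)) - q \<cdot> Y k (Y i (x s j * f)) \<approx>\<^sub>T
     (?d k s \<cdot> (?d i s \<cdot> (x s j * Y i (Y k f)) - ?e i s \<cdot> (x i j * Y s (Y k f)))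
      - ?e k s \<cdot> (?d i k \<cdot> (x k j * Y i (Y s f)) - ?e i k \<cdot> (x i j * Y k (Y s f))))
     - q \<cdot> (?d i s \<cdot> (?d k s \<cdot> (x s j * Y k (Y i f)) - ?e k s \<cdot> (x k j * Y s (Y i f)))
      - ?e i s \<cdot> (?d k i \<cdot> (x i j * Y k (Y s f)) - ?e k i \<cdot> (x k j * Y i (Y s f))))"
    using ik by (intro T.cong_diff T.cong_scale YY)
  also have "\<dots> = (?d k s * ?d i s) \<cdot> (x s j * A i k) - (if s < i then z else 0) \<cdot> (x i j * A s k)
      + (if s < i then z * q else 0) \<cdot> (x k j * A s i)
      - (if i < s \<and> s < k then z else 0) \<cdot> (x k j * A i s)"
  proof -
    consider "s < i" | "s = i" | "i < s" "s < k" | "s = k" | "k < s" using ik(3) by linarith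
    then show ?thesis
    proof cases
      case 1
      define w where "w = z"
      \<comment> \<open>The quadratic relation satisfied by \<open>z\<close>; it merges the terms
        linear and quadratic in \<open>z\<close> that arise when \<open>s\<close> lies below both
        rows.\<close>
      have "q * w = q * q - 1"
        by (simp add: w_def right_diff_distrib)
      then have "q * (w * w) = (q * q - 1) * w"
        by (simp only: mult.assoc[symmetric])
      then have w: "w \<cdot> f + (q * (w * w)) \<cdot> f = (q * (q * w)) \<cdot> f" for f :: "('k, nat \<times> nat) nc_poly"
        by (simp add: nc.scale_left_distrib[symmetric] left_diff_distrib mult.assoc)
      from 1 ik(3) show ?thesis
        unfolding w_def[symmetric] by (simp add: A_def scale_simps w)
    qed (use ik(3) in \<open>simp_all add: A_def scale_simps\<close>)
  qed
  also have "\<dots> \<in> \<T>"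
  proof -
    have h: "(if s < i then z else 0) \<cdot> (x i j * A s k) \<in> \<T>" "(if s < i then z * q else 0) \<cdot> (x k j * A s i) \<in> \<T>"
       "(if i < s \<and> s < k then z else 0) \<cdot> (x k j * A i s) \<in> \<T>"
      using A s ik by (auto intro!: T.mem_scale T.mult_left T.mem_zero)
    have "(?d k s * ?d i s) \<cdot> (x s j * A i k) \<in> \<T>"
      using ik by (intro T.mem_scale T.mult_left A)
    then show ?thesis
      by (intro T.mem_add T.mem_diff h)
  qed
  finally show ?thesis by (simp add: T.cong_def)
qed


lemma tensor_word_cong:
  assumes "set w \<subseteq> V"
  shows "word w \<approx>\<^sub>T word (filter (\<lambda>v. snd v \<noteq> n) w) * word (filter (\<lambda>v. snd v = n) w)"
  using assms
proof (induction w)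
  case (Cons v w)
  obtain s j where v: "v = (s, j)" by (cases v)
  have s: "s \<in> {1..m}" "1 \<le> j" "j \<le> n" using Cons.prems v by (auto simp: mem_V)
  let ?A = "\<lambda>w. word (filter (\<lambda>v. snd v \<noteq> n) w)" and ?B = "\<lambda>w. word (filter (\<lambda>v. snd v = n) w)"
  have IH: "word w \<approx>\<^sub>T ?A w * ?B w" using Cons by simp
  show ?case
  proof (cases "j = n")
    case False
    then show ?thesis using T.cong_mult_left[OF IH, of "x s j"] v by (simp add: word_Cons mult.assoc)
  next
    case True
    have "x s n * ?A u \<approx>\<^sub>T ?A u * x s n" if "set u \<subseteq> V" for u
      using that
    proof (induction u)
      case (Cons t u)
      obtain a l where t: "t = (a, l)" by (cases t)
      have a: "a \<in> {1..m}" "1 \<le> l" "l \<le> n" using Cons.prems t by (auto simp: mem_V)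
      show ?case
      proof (cases "l = n")
        case False
        have "x s n * x a l \<approx>\<^sub>T x a l * x s n"
          using T.mem_scale[OF tensor_commute[OF a(1) s(1) a(2)], of "- 1"] False a(3)
          by (simp add: T.cong_def)
        then have "x s n * x a l * ?A u \<approx>\<^sub>T x a l * x s n * ?A u" by (rule T.cong_mult_right)
        also have "\<dots> = x a l * (x s n * ?A u)" by (simp add: mult.assoc)
        also have "\<dots> \<approx>\<^sub>T x a l * (?A u * x s n)" using Cons by (intro T.cong_mult_left) simp
        finally show ?thesis using t False by (simp add: word_Cons mult.assoc)
      qed (use Cons t in simp)
    qed (simp add: word_Nil)
    then have A: "x s n * ?A w * ?B w \<approx>\<^sub>T ?A w * x s n * ?B w"
      using Cons.prems by (intro T.cong_mult_right) simp
    have "x s n * word w \<approx>\<^sub>T x s n * ?A w * ?B w"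
      using T.cong_mult_left[OF IH, of "x s n"] by (simp add: mult.assoc)
    also note A
    finally show ?thesis using v True by (simp add: word_Cons mult.assoc)
  qed
qed (simp add: word_Nil)

lemma rho_word_junk: "\<not> set w \<subseteq> V \<Longrightarrow> rho_word i k w = 0"
  by (induction i k w rule: rho_word.induct) auto

text \<open>Since \<open>Y\<close> respects \<open>\<T>\<close>, the word may be split into its
  letters before column \<open>n\<close> and those in it. On a word in column \<open>n\<close> alone
  \<open>Y i\<close> is left multiplication by \<open>x i n\<close>, and the claim is the relation
  inside that column; the remaining letters are then put in front one at a time.\<close>

lemma Y_commute:
  assumes "i \<in> {1..m}" "k \<in> {1..m}" "i < k"
  shows "Y i (Y k f) \<approx>\<^sub>T q \<cdot> Y k (Y i f)"
proof (induction f rule: nc_poly_induct)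
  case (add f g)
  then show ?case by (simp add: lin_add[OF lin_Y] nc.scale_right_distrib T.cong_add)
next
  case (scale c f)
  then show ?case using T.cong_scale[OF scale.IH, of c] by (simp add: lin_scale[OF lin_Y] mult.commute)
next
  case (word w)
  show ?case
  proof (cases "set w \<subseteq> V")
    case False
    then have "Y i (word w) = 0" for i
      by (simp add: Y_def rho_word_junk)
    then show ?thesis by (simp add: lin_zero[OF lin_Y])
  next
    case True
    have last: "Y i (Y k (word (filter (\<lambda>v. snd v = n) w))) \<approx>\<^sub>T q \<cdot> Y k (Y i (word (filter (\<lambda>v. snd v = n) w)))"
      if "set w \<subseteq> V" "i \<in> {1..m}" "k \<in> {1..m}" "i < k" for w i k
      using that(1)
    proof (induction w rule: rev_induct)
      case Nil
      have "x i n = 1 * x i n" for i by simp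
      then have "Y i (x k n) = x i n * x k n" if "i \<in> {1..m}" "k \<in> {1..m}" for i k
        using that by (metis Y_mult_last Y_one)
      then have e: "Y i (x k n) = x i n * x k n" "Y k (x i n) = x k n * x i n" using that by auto
      have "x i n * x k n - q \<cdot> (x k n * x i n) = (- q) \<cdot> rel_col i k n"
        by (simp add: rel_col_def scale_simps)
      moreover have "rel_col i k n \<in> \<T>"
        using tensor_col_mem[of i k n] that mn by simp
      ultimately have "x i n * x k n \<approx>\<^sub>T q \<cdot> (x k n * x i n)"
        by (simp only: T.cong_def T.mem_scale)
      then show ?case using that e by (simp add: word_Nil Y_one)
    next
      case (snoc v w)
      obtain s j where v: "v = (s, j)" by (cases v)
      then have s: "s \<in> {1..m}" using snoc.prems by (auto simp: mem_V)
      then show ?case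
        using snoc v T.cong_mult_right[OF snoc.IH, of "x s n"]
        by (auto simp: word_mult[symmetric] nc_var_eq[symmetric] word_Nil Y_mult_last)
    qed
    have "Y i (Y k (word (filter (\<lambda>v. snd v \<noteq> n) w) * g)) \<approx>\<^sub>T q \<cdot> Y k (Y i (word (filter (\<lambda>v. snd v \<noteq> n) w) * g))"
      if "set w \<subseteq> V" and g: "\<And>i k. \<lbrakk>i \<in> {1..m}; k \<in> {1..m}; i < k\<rbrakk> \<Longrightarrow> Y i (Y k g) \<approx>\<^sub>T q \<cdot> Y k (Y i g)"
        and "i \<in> {1..m}" "k \<in> {1..m}" "i < k" for w g i k
      using that(1,3-)
    proof (induction w arbitrary: i k)
      case Nil
      then show ?case using g by (simp add: word_Nil)
    next
      case (Cons v w)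
      obtain s j where v: "v = (s, j)" by (cases v)
      then have s: "s \<in> {1..m}" "1 \<le> j" "j \<le> n" using Cons.prems by (auto simp: mem_V)
      show ?case
      proof (cases "j = n")
        case False
        then have "Y i (Y k (x s j * (word (filter (\<lambda>v. snd v \<noteq> n) w) * g)))
            \<approx>\<^sub>T q \<cdot> Y k (Y i (x s j * (word (filter (\<lambda>v. snd v \<noteq> n) w) * g)))"
          using s Cons.prems by (intro Y_commute_var Cons.IH) auto
        then show ?thesis using v False by (simp add: word_Cons mult.assoc)
      qed (use Cons v in simp)
    qed
    from this[OF True last[OF True] assms]
    have *: "Y i (Y k (word (filter (\<lambda>v. snd v \<noteq> n) w) * word (filter (\<lambda>v. snd v = n) w))) \<approx>\<^sub>T
      q \<cdot> Y k (Y i (word (filter (\<lambda>v. snd v \<noteq> n) w) * word (filter (\<lambda>v. snd v = n) w)))" .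
    note w = tensor_word_cong[OF True]
    have "Y i (Y k (word w)) \<approx>\<^sub>T Y i (Y k (word (filter (\<lambda>v. snd v \<noteq> n) w) * word (filter (\<lambda>v. snd v = n) w)))"
      by (intro Y_cong w assms)
    also note *
    also have "q \<cdot> Y k (Y i (word (filter (\<lambda>v. snd v \<noteq> n) w) * word (filter (\<lambda>v. snd v = n) w))) \<approx>\<^sub>T q \<cdot> Y k (Y i (word w))"
      by (intro T.cong_scale Y_cong T.cong_sym[OF w] assms)
    finally show ?thesis .
  qed
qed

section \<open>The normal form with column \<open>n\<close> last, obtained by letting words act on
  1\<close>

definition act :: "nat \<times> nat \<Rightarrow> ('k, nat \<times> nat) nc_poly \<Rightarrow> ('k, nat \<times> nat) nc_poly" where
  "act v f = (if v \<notin> V then 0 else if snd v = n then Y (fst v) f else nc_var v * f)"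

lemma lin_act: "lin (act v)"
  by (rule linI) (simp_all add: act_def lin_simps[OF lin_Y] distrib_left)

lemma act_tensor: "f \<in> \<T> \<Longrightarrow> act v f \<in> \<T>"
  by (cases v) (auto simp: act_def T.mem_zero T.mult_left mem_V intro: Y_tensor)

text \<open>
  \<open>reorder\<close> rewrites a word so that the letters from column \<open>n\<close> come last; on words that are already
  in this form it is the identity.
\<close>

definition reorder :: "('k, nat \<times> nat) nc_poly \<Rightarrow> ('k, nat \<times> nat) nc_poly" where
  "reorder = lin_ext (\<lambda>w. foldr act w 1)"

lemma lin_reorder: "lin reorder"
  by (simp add: reorder_def lin_lin_ext)

lemma reorder_word: "reorder (word w) = foldr act w 1"
  by (simp add: reorder_def)

lemma reorder_var: "reorder (nc_var v * f) = act v (reorder f)"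
  by (rule lin_eqI[of "\<lambda>f. reorder (nc_var v * f)" "\<lambda>f. act v (reorder f)",
      OF lin_comp[OF lin_reorder lin_mult_left] lin_comp[OF lin_act lin_reorder]])
    (simp add: word_Cons[symmetric] reorder_word)

text \<open>This makes the tensor product a module over quantum matrices. Entries before column
  \<open>n\<close> act by left multiplication, so their relations hold by definition of
  \<open>\<T>\<close>; a relation between column \<open>n\<close> and an earlier column is
  \<open>Y_var\<close>, and one inside column \<open>n\<close> is \<open>Y_commute\<close>.\<close>

lemma reorder_rel:
  assumes "r \<in> qrels n"
  shows "reorder (r * g) \<in> \<T>"
proof -
  consider a j b l where "r = rel_cols a j b l" "a \<in> {1..m}" "b \<in> {1..m}" "1 \<le> j" "j < l" "l \<le> n"
    | a b j where "r = rel_col a b j" "a \<in> {1..m}" "b \<in> {1..m}" "a < b" "j \<in> {1..n}"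
    using assms unfolding qrels_def by blast
  then show ?thesis
  proof cases
    case (1 a j b l)
    have o: "reorder (x s i * f) = x s i * reorder f" if "s \<in> {1..m}" "1 \<le> i" "i < n" for s i f
      using that by (simp add: reorder_var act_def mem_V)
    have on: "reorder (x s n * f) = Y s (reorder f)" if "s \<in> {1..m}" for s f
      using that mn by (simp add: reorder_var act_def mem_V)
    show ?thesis
    proof (cases "l = n")
      case False
      then have "reorder (r * g) = rel_cols a j b l * reorder g"
        using 1 o[OF 1(2), of j] o[OF 1(2), of l] o[OF 1(3), of j] o[OF 1(3), of l]
        by (simp add: rel_cols_def distrib_right left_diff_distrib mult.assoc
            lin_simps[OF lin_reorder])
      then show ?thesis using 1 False by (simp add: T.mult_right tensor_cols_mem)
    next
      case True
      have j: "1 \<le> j" "j < n" using 1 True by auto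
      have "reorder (r * g) = Y b (x a j * reorder g) - (if a = b then inverse q else 1) \<cdot> (x a j * Y b (reorder g))
           + (if a < b then z else 0) \<cdot> (x b j * Y a (reorder g))"
        using o[OF 1(2) j] o[OF 1(3) j] on[OF 1(2)] on[OF 1(3)] 1(1) True
        by (simp add: rel_cols_def distrib_right left_diff_distrib mult.assoc
            lin_simps[OF lin_reorder])
      also have "\<dots> = Y b (x a j * reorder g) - ((if a = b then inverse q else 1) \<cdot> (x a j * Y b (reorder g))
           - (if a < b then z else 0) \<cdot> (x b j * Y a (reorder g)))"
        by simp
      also have "\<dots> \<in> \<T>"
        using Y_var[OF 1(2,3) j, of "reorder g"] unfolding T.cong_def .
      finally show ?thesis .
    qed
  next
    case (2 a b j)
    show ?thesis
    proof (cases "j = n")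
      case False
      have o: "reorder (x s j * f) = x s j * reorder f" if "s \<in> {1..m}" for s f
        using that False 2 by (simp add: reorder_var act_def mem_V)
      have "reorder (r * g) = rel_col a b j * reorder g"
        using o[OF 2(2)] o[OF 2(3)] 2(1)
        by (simp add: rel_col_def left_diff_distrib mult.assoc lin_simps[OF lin_reorder])
      then show ?thesis using 2 by (simp add: T.mult_right tensor_col_mem)
    next
      case True
      have on: "reorder (x s n * f) = Y s (reorder f)" if "s \<in> {1..m}" for s f
        using that mn by (simp add: reorder_var act_def mem_V)
      have "reorder (r * g) = (- inverse q) \<cdot> (Y a (Y b (reorder g)) - q \<cdot> Y b (Y a (reorder g)))"
        unfolding 2(1) True
        by (simp add: on[OF 2(2)] on[OF 2(3)] rel_col_def left_diff_distrib mult.assoc lin_simps[OF lin_reorder] scale_simps)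
      then show ?thesis
        using Y_commute[OF 2(2,3,4), of "reorder g"] by (simp only: T.cong_def T.mem_scale)
    qed
  qed
qed

lemma reorder_tensor:
  assumes "f \<in> \<R>"
  shows "reorder f \<in> \<T>"
proof -
  have "reorder (word u * r * word v) \<in> \<T>" if "r \<in> qrels n" for u r v
    by (induction u) (simp_all add: word_Nil word_Cons mult.assoc reorder_rel[OF that] reorder_var act_tensor)
  then show ?thesis
    using ideal_gen_image[OF lin_reorder T.subspace, of "qrels n" f] assms unfolding \<R>_eq by blast
qed

text \<open>\<open>reorder\<close> need not be multiplicative, but right factors from column
  \<open>n\<close> pass through it, and so do left factors from the other columns. This is all that
  the two expansions of minors require.\<close>

lemma reorder_mult_last:
  assumes "s \<in> {1..m}"
  shows "reorder (f * x s n) = reorder f * x s n"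
proof (rule lin_eqI[of "\<lambda>f. reorder (f * x s n)" "\<lambda>f. reorder f * x s n",
      OF lin_comp[OF lin_reorder lin_mult_right] lin_comp[OF lin_mult_right lin_reorder]])
  fix w
  have "foldr act w (x s n) = foldr act w 1 * x s n"
    by (induction w) (use assms in \<open>auto simp: act_def Y_mult_last mult.assoc\<close>)
  moreover have "act (s, n) 1 = x s n" using assms mn by (simp add: act_def mem_V Y_one)
  ultimately show "reorder (word w * x s n) = reorder (word w) * x s n"
    by (simp add: nc_var_eq word_mult reorder_word)
qed

definition early :: "('k, nat \<times> nat) nc_poly set" where
  "early = nc.span {word w | w. set w \<subseteq> V \<and> (\<forall>v\<in>set w. snd v \<noteq> n)}"

lemma early_induct [consumes 1, case_names add scale word]:
  assumes "a \<in> early" "\<And>f g. P f \<Longrightarrow> P g \<Longrightarrow> P (f + g)" "\<And>c f. P f \<Longrightarrow> P (c \<cdot> f)"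
    "\<And>w. \<lbrakk>set w \<subseteq> V; \<forall>v\<in>set w. snd v \<noteq> n\<rbrakk> \<Longrightarrow> P (word w)"
  shows "P a"
  using assms(1) unfolding early_def
proof (induction rule: nc.span_induct_alt)
  case base
  have "P (word [])" using assms(4)[of "[]"] by simp
  from assms(3)[OF this, of 0] show ?case by simp
qed (use assms(2-4) in auto)

lemma early_word: "set w \<subseteq> V \<Longrightarrow> \<forall>v\<in>set w. snd v \<noteq> n \<Longrightarrow> word w \<in> early"
  unfolding early_def by (intro nc.span_base) auto

lemma early_add: "f \<in> early \<Longrightarrow> g \<in> early \<Longrightarrow> f + g \<in> early"
  and early_scale: "f \<in> early \<Longrightarrow> c \<cdot> f \<in> early"
  and early_zero: "0 \<in> early"
  and early_sum: "(\<And>a. a \<in> A \<Longrightarrow> h a \<in> early) \<Longrightarrow> sum h A \<in> early"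
  unfolding early_def by (auto intro: nc.span_add nc.span_scale nc.span_zero nc.span_sum)

lemma early_var_mult:
  assumes "f \<in> early" "s \<in> {1..m}" "1 \<le> j" "j < n"
  shows "x s j * f \<in> early"
  using assms(1)
proof (induction rule: early_induct)
  case (word w)
  then show ?case using assms(2-) early_word[of "(s, j) # w"] by (simp add: word_Cons mem_V)
qed (simp_all add: distrib_left early_add early_scale)

lemma lap_early:
  assumes "I \<subseteq> {1..m}" "set js \<subseteq> {1..<n}"
  shows "lap q x I js \<in> early"
  using assms
proof (induction js arbitrary: I)
  case Nil
  then show ?case using early_word[of "[]"] by (simp add: word_Nil early_zero)
next
  case (Cons j js)
  then show ?case
    unfolding lap.simps by (intro early_sum early_scale early_var_mult Cons.IH) auto
qed

lemma reorder_early_mult: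
  assumes "a \<in> early"
  shows "reorder (a * f) = a * reorder f"
  using assms
proof (induction rule: early_induct)
  case (word w)
  then show ?case
    by (induction w) (simp_all add: word_Nil word_Cons mult.assoc reorder_var act_def)
qed (simp_all add: distrib_right lin_simps[OF lin_reorder])


text \<open>
  The scalars are those turning the expansion of a minor along the last column into the expansion
  along the first column of the cyclically shifted minor.
\<close>

definition tau :: "nat \<Rightarrow> 'k" where
  "tau k = inverse q * (- q) ^ card {r \<in> {1..m}. r < k} * inverse ((- q) ^ card {r \<in> {1..m}. k < r})"

definition front :: "(nat \<times> nat) list \<Rightarrow> ('k, nat \<times> nat) nc_poly" where
  "front w = prod_list (map (\<lambda>v. tau (fst v) \<cdot> x (fst v) 1) (filter (\<lambda>v. snd v = n) w))"

definition rear :: "(nat \<times> nat) list \<Rightarrow> ('k, nat \<times> nat) nc_poly" where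
  "rear w = word (map (map_prod id Suc) (filter (\<lambda>v. snd v \<noteq> n) w))"

definition to_front :: "('k, nat \<times> nat) nc_poly \<Rightarrow> ('k, nat \<times> nat) nc_poly" where
  "to_front = lin_ext (\<lambda>w. if set w \<subseteq> V then front w * rear w else 0)"

lemma lin_to_front: "lin to_front"
  by (simp add: to_front_def lin_lin_ext)

lemma to_front_word: "to_front (word w) = (if set w \<subseteq> V then front w * rear w else 0)"
  by (simp add: to_front_def)

lemma front_append: "front (u @ v) = front u * front v"
  and rear_append: "rear (u @ v) = rear u * rear v"
  by (simp_all add: front_def rear_def word_mult)

lemma to_front_two_letters:
  assumes "set u \<subseteq> V" "set v \<subseteq> V" "a \<in> {1..m}" "b \<in> {1..m}" "j \<in> {1..n}" "l \<in> {1..n}"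
  shows "to_front (word u * (x a j * x b l) * word v) =
    front u * (front [(a, j), (b, l)] * front v * (rear u * (rear [(a, j), (b, l)] * rear v)))"
proof -
  have "word u * (x a j * x b l) * word v = word (u @ [(a, j), (b, l)] @ v)"
    by (simp add: nc_var_eq word_mult)
  moreover have "set (u @ [(a, j), (b, l)] @ v) \<subseteq> V"
    using assms by (auto simp: qmat_indices_def)
  ultimately show ?thesis
    by (simp only: to_front_word front_append rear_append if_True mult.assoc)
qed

text \<open>Relations before column \<open>n\<close> are shifted, and those inside column
  \<open>n\<close> become relations of column 1, scaled by \<open>tau a * tau b\<close>. A
  commutator of column \<open>n\<close> with another column goes to 0 in the free algebra itself,
  its two words having the same front and the same rear.\<close>

lemma to_front_rel:
  assumes r: "r \<in> tensor_rels"
  shows "to_front (word u * r * word v) \<in> \<R>"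
proof (cases "set u \<subseteq> V \<and> set v \<subseteq> V")
  case False
  have z: "to_front (word u * (x a j * x b l) * word v) = 0" for a j b l
    using False by (auto simp: nc_var_eq word_mult to_front_word)
  note lin = lin_simps[OF lin_to_front]
  have "to_front (word u * r * word v) = 0"
    using r by (cases rule: tensor_relsE)
      (simp_all only: rel_cols_def rel_col_def distrib_left distrib_right left_diff_distrib right_diff_distrib lin z
         mult_scale_right scale_mult_left nc.scale_zero_right diff_self add_0)
  then show ?thesis by (simp add: mem_zero)
next
  case True
  then have uv: "set u \<subseteq> V" "set v \<subseteq> V" by auto
  note lin = lin_simps[OF lin_to_front]
  note two = to_front_two_letters[OF uv]
  have early: "front [(a, j), (b, l)] = 1" "rear [(a, j), (b, l)] = x a (Suc j) * x b (Suc l)"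
    if "j < n" "l < n" for a b j l
    using that by (simp_all add: front_def rear_def nc_var_eq word_mult)
  have late: "front [(a, n), (b, n)] = (tau a * tau b) \<cdot> (x a 1 * x b 1)" "rear [(a, n), (b, n)] = 1" for a b
    by (simp_all add: front_def rear_def word_Nil mult.commute)
  have E: "to_front (word u * (x c i * x d k) * word v) =
      front u * (front v * (rear u * (x c (Suc i) * (x d (Suc k) * rear v))))"
    if "c \<in> {1..m}" "d \<in> {1..m}" "1 \<le> i" "i < n" "1 \<le> k" "k < n" for c d i k
    by (subst two) (use that in \<open>simp_all add: early mult.assoc\<close>)
  have L: "to_front (word u * (x c n * x d n) * word v) =
      (tau c * tau d) \<cdot> (front u * (x c 1 * (x d 1 * (front v * (rear u * rear v)))))"
    if "c \<in> {1..m}" "d \<in> {1..m}" for c d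
    by (subst two) (use that mn in \<open>simp_all add: late mult.assoc\<close>)
  show ?thesis
    using r
  proof (cases rule: tensor_relsE)
    case (1 a j b l)
    then have jl: "j < n" "1 \<le> l" by auto
    note E1 = E[OF 1(3,2) jl(2) 1(6) 1(4) jl(1)] E[OF 1(2,3) 1(4) jl(1) jl(2) 1(6)] E[OF 1(3,2) 1(4) jl(1) jl(2) 1(6)]
    have "to_front (word u * r * word v) =
        front u * (front v * (rear u * (rel_cols a (Suc j) b (Suc l) * rear v)))"
      unfolding 1(1) rel_cols_def distrib_left distrib_right left_diff_distrib right_diff_distrib lin
         mult_scale_right scale_mult_left E1
      by (simp add: mult.assoc)
    then show ?thesis using 1 by (simp add: mult_left mult_right rel_cols_mem)
  next
    case (2 a b j)
    note E2 = E[OF 2(3,2,5,6,5,6)] E[OF 2(2,3,5,6,5,6)]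
    have "to_front (word u * r * word v) =
        front u * (front v * (rear u * (rel_col a b (Suc j) * rear v)))"
      unfolding 2(1) rel_col_def distrib_left distrib_right left_diff_distrib right_diff_distrib lin
         mult_scale_right scale_mult_left E2
      by (simp add: mult.assoc)
    then show ?thesis using 2 by (simp add: mult_left mult_right rel_col_mem)
  next
    case (3 a b)
    have "to_front (word u * r * word v) =
        (tau a * tau b) \<cdot> (front u * (rel_col a b 1 * (front v * (rear u * rear v))))"
      unfolding 3(1) rel_col_def distrib_left distrib_right left_diff_distrib right_diff_distrib lin
         mult_scale_right scale_mult_left L[OF 3(3,2)] L[OF 3(2,3)]
      by (simp add: mult.assoc nc.scale_right_diff_distrib mult.commute mult.left_commute)
    then show ?thesis using 3 mn by (simp add: mult_left mult_right rel_col_mem mem_scale)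
  next
    case (4 s j i)
    have "front [(s, j), (i, n)] = front [(i, n), (s, j)]" "rear [(s, j), (i, n)] = rear [(i, n), (s, j)]"
      using 4 by (simp_all add: front_def rear_def)
    then have "to_front (word u * r * word v) = 0"
      unfolding 4(1) distrib_left distrib_right left_diff_distrib right_diff_distrib lin
      using 4(2-5) by (simp add: two)
    then show ?thesis by (simp add: mem_zero)
  qed
qed

lemma to_front_tensor: "f \<in> \<T> \<Longrightarrow> to_front f \<in> \<R>"
  using ideal_gen_image[OF lin_to_front subspace, of tensor_rels f] to_front_rel unfolding \<T>_def by blast

section \<open>The linear cyclic shift of the columns and its effect on products with a
  minor\<close>

definition cycle :: "('k, nat \<times> nat) nc_poly \<Rightarrow> ('k, nat \<times> nat) nc_poly" where
  "cycle f = to_front (reorder f)"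

lemma lin_cycle: "lin cycle"
  unfolding cycle_def by (rule lin_comp[OF lin_to_front lin_reorder])

lemma cycle_mem: "f \<in> \<R> \<Longrightarrow> cycle f \<in> \<R>"
  by (simp add: cycle_def to_front_tensor reorder_tensor)

lemma cycle_cong: "f \<approx> g \<Longrightarrow> cycle f \<approx> cycle g"
  unfolding cong_def by (simp flip: lin_diff[OF lin_cycle] add: cycle_mem)

lemma cycle_one: "cycle 1 = 1"
proof -
  have "reorder 1 = 1" using reorder_word[of "[]"] by (simp add: word_Nil)
  moreover have "to_front 1 = 1"
    using to_front_word[of "[]"] by (simp add: word_Nil front_def rear_def)
  ultimately show ?thesis by (simp add: cycle_def)
qed

definition shift :: "('k, nat \<times> nat) nc_poly \<Rightarrow> ('k, nat \<times> nat) nc_poly" where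
  "shift = lin_ext (\<lambda>w. word (map (map_prod id Suc) w))"

lemma lin_shift: "lin shift"
  by (simp add: shift_def lin_lin_ext)

lemma shift_var: "shift (x s j * f) = x s (Suc j) * shift f"
  by (rule lin_eqI[of "\<lambda>f. shift (x s j * f)" "\<lambda>f. x s (Suc j) * shift f",
      OF lin_comp[OF lin_shift lin_mult_left] lin_comp[OF lin_mult_left lin_shift]])
    (simp add: word_Cons[symmetric] shift_def)

lemma shift_lap: "shift (lap q x I js) = lap q x I (map Suc js)"
proof (induction js arbitrary: I)
  case Nil
  have "shift 1 = 1" by (metis lin_ext_word list.map(1) shift_def word_Nil)
  then show ?case by (simp add: lin_zero[OF lin_shift])
qed (simp add: lin_simps[OF lin_shift] shift_var)

lemma to_front_early_mult:
  assumes "a \<in> early"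
  shows "to_front (a * word t) = (if set t \<subseteq> V then front t * (shift a * rear t) else 0)"
  using assms
proof (induction rule: early_induct)
  case (word w)
  then have "front w = 1" "rear w = shift (word w)"
    by (auto simp: front_def rear_def shift_def filter_empty_conv filter_id_conv intro!: arg_cong[of _ _ word])
  then show ?case using word by (simp add: word_mult to_front_word front_append rear_append)
qed (simp_all add: distrib_right distrib_left lin_simps[OF lin_to_front] lin_simps[OF lin_shift])

lemma front_mult_cong:
  assumes "set t \<subseteq> V" "\<And>i. i \<in> {1..m} \<Longrightarrow> x i 1 * f \<approx> c \<cdot> (f * x i 1)"
  shows "front t * f \<approx> c ^ length (filter (\<lambda>v. snd v = n) t) \<cdot> (f * front t)"
  using assms(1)
proof (induction t)
  case (Cons v t)
  let ?d = "length (filter (\<lambda>v. snd v = n) t)"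
  show ?case
  proof (cases "snd v = n")
    case True
    then have v: "fst v \<in> {1..m}" using Cons.prems by (cases v) (auto simp: mem_V)
    have "tau (fst v) \<cdot> (x (fst v) 1 * (front t * f)) \<approx> tau (fst v) \<cdot> (x (fst v) 1 * (c ^ ?d \<cdot> (f * front t)))"
      using Cons by (intro cong_scale cong_mult_left) simp
    also have "\<dots> = (tau (fst v) * c ^ ?d) \<cdot> (x (fst v) 1 * f * front t)"
      by (simp add: mult.assoc)
    also have "\<dots> \<approx> (tau (fst v) * c ^ ?d) \<cdot> (c \<cdot> (f * x (fst v) 1) * front t)"
      by (intro cong_scale cong_mult_right assms(2) v)
    finally show ?thesis using True by (simp add: front_def mult.assoc ac_simps)
  qed (use Cons in \<open>simp add: front_def\<close>)
qed (simp add: front_def)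

lemma first_col_mult_qdet:
  assumes "i \<in> {1..m}" "set js \<subseteq> {1..n}"
  shows "x i 1 * qdet js \<approx> (q * inverse (prod_list (map (\<lambda>j. if j = 1 then q else 1) js))) \<cdot> (qdet js * x i 1)"
proof -
  let ?p = "prod_list (map (\<lambda>j. if j = 1 then q else 1) js)"
  have p: "?p \<noteq> 0" using q by (induction js) auto
  have "(q * inverse ?p) \<cdot> (qdet js * x i 1) \<approx> (q * inverse ?p) \<cdot> ((?p * inverse q) \<cdot> (x i 1 * qdet js))"
    by (intro cong_scale qdet_mult_first_col assms)
  also have "\<dots> = x i 1 * qdet js"
    using p q by (simp add: field_simps)
  finally show ?thesis by (rule cong_sym)
qed

text \<open>A degree of representatives in the free algebra. \<open>Y\<close> raises it by exactly
  one and \<open>reorder\<close> keeps it, so the number of entries that end up in the front is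
  known without any statement about a grading of the quotient.\<close>

definition late_deg :: "nat \<Rightarrow> ('k, nat \<times> nat) nc_poly set" where
  "late_deg d = nc.span {word w | w. length (filter (\<lambda>v. snd v = n) w) = d}"

lemma late_deg_induct [consumes 1, case_names add scale word]:
  assumes "a \<in> late_deg d" "\<And>f g. P f \<Longrightarrow> P g \<Longrightarrow> P (f + g)" "\<And>c f. P f \<Longrightarrow> P (c \<cdot> f)"
    "\<And>w. length (filter (\<lambda>v. snd v = n) w) = d \<Longrightarrow> P (word w)"
  shows "P a"
  using assms(1) unfolding late_deg_def
proof (induction rule: nc.span_induct_alt)
  case base
  \<comment> \<open>Any word with \<open>d\<close> letters from column \<open>n\<close> serves, as
    its multiple by 0 is the zero vector. That row 0 lies outside \<open>V\<close> is harmless,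
    since \<open>late_deg\<close> puts no other condition on the letters.\<close>
  have "P (word (replicate d (0, n)))" by (rule assms(4)) simp
  from assms(3)[OF this, of 0] show ?case by simp
qed (use assms(2-4) in auto)

lemma late_deg_subspace: "nc.subspace (late_deg d)"
  unfolding late_deg_def by simp

lemmas late_deg_add = nc.subspace_add[OF late_deg_subspace]
  and late_deg_diff = nc.subspace_diff[OF late_deg_subspace]
  and late_deg_scale = nc.subspace_scale[OF late_deg_subspace]
  and late_deg_zero = nc.subspace_0[OF late_deg_subspace]
  and late_deg_sum = nc.subspace_sum[OF late_deg_subspace]

lemma late_deg_word: "word w \<in> late_deg (length (filter (\<lambda>v. snd v = n) w))"
  unfolding late_deg_def by (rule nc.span_base) blast

lemma late_deg_var_mult:
  assumes "f \<in> late_deg d"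
  shows "x s j * f \<in> late_deg ((if j = n then 1 else 0) + d)"
  using assms
proof (induction rule: late_deg_induct)
  case (word w)
  then show ?case using late_deg_word[of "(s, j) # w"] by (auto simp: word_Cons)
qed (auto simp: distrib_left late_deg_add late_deg_scale)

lemma rho_word_late_deg: "rho_word i k w \<in> late_deg (length (filter (\<lambda>v. snd v = n) w))"
proof (induction i k w rule: rho_word.induct)
  case (1 i k)
  then show ?case using late_deg_word[of "[]"] by (simp add: word_Nil late_deg_zero)
next
  case (2 i k s j w)
  show ?case
  proof (cases "(s, j) \<in> V \<and> j \<noteq> n")
    case True
    have "x a j * f \<in> late_deg d" if "f \<in> late_deg d" for a f d
      using late_deg_var_mult[OF that, of a j] True by simp
    then show ?thesis using True 2 by (simp add: late_deg_diff late_deg_scale late_deg_zero)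
  next
    case False
    then show ?thesis using late_deg_var_mult[of _ _ s j] 2 by (auto simp: late_deg_zero)
  qed
qed

lemma Y_late_deg:
  assumes "f \<in> late_deg d"
  shows "Y i f \<in> late_deg (Suc d)"
  using assms
proof (induction rule: late_deg_induct)
  case (word w)
  then show ?case
    unfolding Y_def using late_deg_var_mult[OF rho_word_late_deg[of i _ w], of _ n] by (intro late_deg_sum) auto
qed (simp_all add: lin_simps[OF lin_Y] late_deg_add late_deg_scale)

lemma reorder_late_deg:
  assumes "f \<in> late_deg d"
  shows "reorder f \<in> late_deg d"
  using assms
proof (induction rule: late_deg_induct)
  case (word w)
  have "foldr act w 1 \<in> late_deg (length (filter (\<lambda>v. snd v = n) w))"
  proof (induction w)
    case Nil
    then show ?case using late_deg_word[of "[]"] by (simp add: word_Nil)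
  next
    case (Cons v w)
    then show ?case
      using late_deg_var_mult[OF Cons.IH, of "fst v" "snd v"]
      by (cases "snd v = n") (simp_all add: act_def late_deg_zero Y_late_deg)
  qed
  with word show ?case by (simp add: reorder_word)
qed (simp_all add: lin_simps[OF lin_reorder] late_deg_add late_deg_scale)

lemma lap_late_deg:
  "lap q x I js \<in> late_deg (length (filter (\<lambda>j. j = n) js))"
proof (induction js arbitrary: I)
  case Nil
  then show ?case using late_deg_word[of "[]"] by (simp add: word_Nil late_deg_zero)
next
  case (Cons j js)
  have "x i j * lap q x (I - {i}) js \<in> late_deg (length (filter (\<lambda>j. j = n) (j # js)))" for i
    using late_deg_var_mult[OF Cons[of "I - {i}"], of i j] by (cases "j = n") simp_all
  then show ?case unfolding lap.simps by (intro late_deg_sum late_deg_scale)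
qed

lemma late_deg_mult:
  assumes "f \<in> late_deg d" "g \<in> late_deg e"
  shows "f * g \<in> late_deg (d + e)"
  using assms(1)
proof (induction rule: late_deg_induct)
  case (word u)
  from assms(2) show ?case
  proof (induction rule: late_deg_induct)
    case (word v)
    then show ?case using \<open>length (filter _ u) = d\<close> late_deg_word[of "u @ v"] by (simp add: word_mult)
  qed (simp_all add: distrib_left late_deg_add late_deg_scale)
qed (simp_all add: distrib_right late_deg_add late_deg_scale)

text \<open>The minor passes through \<open>reorder\<close> as a left factor and is then shifted,
  but it comes to stand behind the front, which consists of \<open>d\<close> entries of column 1.
  The shifted minor does not contain column 1, so each crossing costs one \<open>q\<close>.\<close>

lemma cycle_qdet_mult_early:
  assumes js: "set js \<subseteq> {1..<n}" and g: "g \<in> late_deg d"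
  shows "cycle (qdet js * g) \<approx> q ^ d \<cdot> (qdet (map Suc js) * cycle g)"
proof -
  have e: "qdet js \<in> early" using js by (intro lap_early) auto
  have p: "prod_list (map ((\<lambda>j. if j = Suc 0 then q else 1) \<circ> Suc) js) = 1"
    using js by (induction js) auto
  have sub: "set (map Suc js) \<subseteq> {1..n}" using js by fastforce
  have c: "x i 1 * qdet (map Suc js) \<approx> q \<cdot> (qdet (map Suc js) * x i 1)" if "i \<in> {1..m}" for i
    using first_col_mult_qdet[OF that sub] by (simp add: p)
  have "to_front (qdet js * h) \<approx> q ^ d \<cdot> (qdet (map Suc js) * to_front h)" if "h \<in> late_deg d" for h
    using that
  proof (induction rule: late_deg_induct)
    case (add f g)
    then show ?case
      using cong_add[OF add] by (simp add: distrib_left lin_add[OF lin_to_front] nc.scale_right_distrib)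
  next
    case (scale a f)
    then show ?case
      using cong_scale[OF scale, of a] by (simp add: lin_scale[OF lin_to_front] mult.commute)
  next
    case (word t)
    show ?case
    proof (cases "set t \<subseteq> V")
      case True
      have "front t * qdet (map Suc js) * rear t \<approx> q ^ d \<cdot> (qdet (map Suc js) * front t) * rear t"
        using front_mult_cong[OF True c] word by (intro cong_mult_right) simp
      then show ?thesis
        unfolding to_front_early_mult[OF e] to_front_word shift_lap if_P[OF True] by (simp add: mult.assoc)
    next
      case False
      then show ?thesis unfolding to_front_early_mult[OF e] to_front_word by simp
    qed
  qed
  from this[OF reorder_late_deg[OF g]] show ?thesis
    unfolding cycle_def reorder_early_mult[OF e] .
qed

lemma tau_eq: "(- q) ^ card {r \<in> {1..m}. k < r} * tau k = inverse q * (- q) ^ card {r \<in> {1..m}. r < k}"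
  using q by (simp add: tau_def field_simps)

text \<open>Expansion along the last column leaves the entries \<open>x k n\<close> in the middle.
  The hypothesis on \<open>g\<close> carries them to the far right, where they pass through
  \<open>reorder\<close>; moved to column 1 they are collected again by the expansion along the
  first column. The new minor contains column 1 and hence commutes with the front.\<close>

lemma cycle_qdet_mult_last:
  assumes js: "set js \<subseteq> {1..<n}" and g: "\<And>k. k \<in> {1..m} \<Longrightarrow> x k n * g \<approx> c \<cdot> (g * x k n)"
  shows "cycle (qdet (js @ [n]) * g) \<approx> (c * inverse q) \<cdot> (qdet (1 # map Suc js) * cycle g)"
proof -
  let ?M = "\<lambda>k. lap q x ({1..m} - {k}) js" and ?Q = "\<lambda>k. (- q) ^ card {r \<in> {1..m}. k < r}"
  let ?D = "qdet (1 # map Suc js)"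
  have e: "?M k \<in> early" for k using js by (intro lap_early) auto
  have p: "prod_list (map ((\<lambda>j. if j = Suc 0 then q else 1) \<circ> Suc) js) = 1"
    using js by (induction js) auto
  have sub: "set (1 # map Suc js) \<subseteq> {1..n}" using js mn by fastforce
  have 1: "x i 1 * ?D \<approx> 1 \<cdot> (?D * x i 1)" if "i \<in> {1..m}" for i
    using first_col_mult_qdet[OF that sub] by (simp add: p del: lap.simps)
  \<comment> \<open>Here the weights \<open>tau\<close> enter: by \<open>tau_eq\<close> they convert
    the signs of the expansion along the last column into those along the first one, up to
    \<open>inverse q\<close>.\<close>
  have t: "(\<Sum>k\<in>{1..m}. ?Q k \<cdot> to_front (?M k * h * x k n)) \<approx> inverse q \<cdot> (?D * to_front h)" for h
  proof (induction h rule: nc_poly_induct)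
    case (add f g)
    then show ?case
      using cong_add[OF add]
      by (simp add: distrib_left distrib_right lin_add[OF lin_to_front] nc.scale_right_distrib sum.distrib)
  next
    case (scale a f)
    then show ?case
      using cong_scale[OF scale, of a]
      by (simp add: lin_scale[OF lin_to_front] mult.commute nc.scale_sum_right nc.scale_left_commute)
  next
    case (word t)
    show ?case
    proof (cases "set t \<subseteq> V")
      case True
      have "to_front (?M k * word t * x k n) = front t * (tau k \<cdot> (x k 1 * lap q x ({1..m} - {k}) (map Suc js)) * rear t)"
        if "k \<in> {1..m}" for k
      proof -
        have "?M k * word t * x k n = ?M k * word (t @ [(k, n)])"
          by (simp add: nc_var_eq word_mult mult.assoc)
        moreover have "set (t @ [(k, n)]) \<subseteq> V" using True that mn by (simp add: mem_V)
        moreover have "front [(k, n)] = tau k \<cdot> x k 1" "rear [(k, n)] = 1"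
          by (simp_all add: front_def rear_def word_Nil)
        ultimately show ?thesis
          by (simp only: to_front_early_mult[OF e] if_True front_append rear_append shift_lap) (simp add: mult.assoc)
      qed
      then have "(\<Sum>k\<in>{1..m}. ?Q k \<cdot> to_front (?M k * word t * x k n)) = (\<Sum>k\<in>{1..m}.
          inverse q \<cdot> (front t * ((- q) ^ card {r \<in> {1..m}. r < k} \<cdot> (x k 1 * lap q x ({1..m} - {k}) (map Suc js)) * rear t)))"
        by (intro sum.cong refl) (simp only: mult_scale_right scale_mult_left nc.scale_scale tau_eq)
      also have "\<dots> = inverse q \<cdot> (front t * ?D * rear t)"
        by (simp add: sum_distrib_left sum_distrib_right nc.scale_sum_right mult.assoc)
      also have "\<dots> \<approx> inverse q \<cdot> (1 ^ length (filter (\<lambda>v. snd v = n) t) \<cdot> (?D * front t) * rear t)"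
        by (intro cong_scale cong_mult_right front_mult_cong True 1)
      finally show ?thesis by (simp add: to_front_word True mult.assoc del: lap.simps)
    next
      case False
      have zero: "to_front (?M k * word t * x k n) = 0" for k
      proof -
        have "?M k * word t * x k n = ?M k * word (t @ [(k, n)])"
          by (simp add: nc_var_eq word_mult mult.assoc)
        then show ?thesis using False unfolding to_front_early_mult[OF e] by (simp only: to_front_early_mult[OF e]) simp
      qed
      show ?thesis
        unfolding zero to_front_word if_not_P[OF False] by simp
    qed
  qed
  have "qdet (js @ [n]) * g = (\<Sum>k\<in>{1..m}. ?Q k \<cdot> (?M k * (x k n * g)))"
    by (simp add: lap_snoc sum_distrib_right mult.assoc)
  also have "\<dots> \<approx> (\<Sum>k\<in>{1..m}. ?Q k \<cdot> (?M k * (c \<cdot> (g * x k n))))"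
    by (intro cong_sum cong_scale cong_mult_left g)
  finally have "cycle (qdet (js @ [n]) * g) \<approx> cycle (\<Sum>k\<in>{1..m}. ?Q k \<cdot> (?M k * (c \<cdot> (g * x k n))))"
    by (rule cycle_cong)
  also have "\<dots> = c \<cdot> (\<Sum>k\<in>{1..m}. ?Q k \<cdot> to_front (?M k * reorder g * x k n))"
  proof -
    have "cycle (?M k * (c \<cdot> (g * x k n))) = c \<cdot> to_front (?M k * reorder g * x k n)" if "k \<in> {1..m}" for k
      unfolding cycle_def reorder_early_mult[OF e] lin_scale[OF lin_reorder] reorder_mult_last[OF that]
      by (simp add: lin_scale[OF lin_to_front] mult.assoc)
    then show ?thesis
      unfolding lin_simps[OF lin_cycle] nc.scale_sum_right
      by (intro sum.cong refl) (simp only: nc.scale_left_commute)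
  qed
  also have "\<dots> \<approx> c \<cdot> (inverse q \<cdot> (?D * to_front (reorder g)))"
    by (intro cong_scale t)
  finally show ?thesis by (simp add: cycle_def del: lap.simps)
qed

end


section \<open>Quantum Pluecker coordinates and their monomials\<close>

lemma prod_list_indicator:
  "distinct xs \<Longrightarrow> prod_list (map (\<lambda>j. if j = a then c else 1) xs) = (if a \<in> set xs then c else (1 :: 'a::comm_monoid_mult))"
  by (induction xs) auto

lemma length_filter_eq_distinct:
  "distinct xs \<Longrightarrow> length (filter (\<lambda>j. j = a) xs) = (if a \<in> set xs then 1 else 0)"
  by (induction xs) auto

context qmatrices
begin

abbreviation plucker :: "nat set \<Rightarrow> ('k, nat \<times> nat) nc_poly" where
  "plucker J \<equiv> qdet (sorted_list_of_set J)"

abbreviation monomial :: "nat set list \<Rightarrow> ('k, nat \<times> nat) nc_poly" where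
  "monomial Js \<equiv> prod_list (map plucker Js)"

abbreviation \<G> :: "nat set set" where "\<G> \<equiv> grass_indices m n"

definition rot :: "nat set \<Rightarrow> nat set" where "rot J = (\<lambda>j. Suc (j mod n)) ` J"

lemma grass_finite: "J \<in> \<G> \<Longrightarrow> finite J"
  using m by (auto simp: grass_indices_def intro: card_ge_0_finite)

lemma grass_subset: "J \<in> \<G> \<Longrightarrow> J \<subseteq> {1..n}"
  by (simp add: grass_indices_def)

lemma grass_mod: "J \<in> \<G> \<Longrightarrow> j \<in> J \<Longrightarrow> j \<noteq> n \<Longrightarrow> j mod n = j"
  using grass_subset[of J] by (intro mod_less) (auto simp: subset_iff le_less)

lemma rot_early: "J \<in> \<G> \<Longrightarrow> n \<notin> J \<Longrightarrow> rot J = Suc ` J"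
  unfolding rot_def by (rule image_cong[OF refl]) (metis grass_mod)

lemma rot_late:
  assumes "J \<in> \<G>" "n \<in> J"
  shows "rot J = insert 1 (Suc ` (J - {n}))"
proof -
  have "rot J = rot (insert n (J - {n}))" using assms by (simp add: insert_absorb)
  also have "\<dots> = insert 1 (rot (J - {n}))" unfolding rot_def image_insert by simp
  also have "rot (J - {n}) = Suc ` (J - {n})"
    unfolding rot_def by (rule image_cong) (auto simp: grass_mod[OF assms(1)])
  finally show ?thesis .
qed

text \<open>Subtracting 1 identifies \<open>{1..n}\<close> with the residues modulo
  \<open>n\<close>, on which \<open>rot\<close> adds 1.\<close>

lemma rot_power: "J \<subseteq> {1..n} \<Longrightarrow> (rot ^^ k) J = (\<lambda>j. Suc ((j - 1 + k) mod n)) ` J"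
proof (induction k)
  case 0
  have "(\<lambda>j. Suc ((j - 1) mod n)) ` J = (\<lambda>j. j) ` J"
  proof (rule image_cong)
    fix j assume "j \<in> J"
    then have "1 \<le> j" "j \<le> n" using 0 by auto
    then show "Suc ((j - 1) mod n) = j" by simp
  qed simp
  then show ?case by simp
next
  case (Suc k)
  then show ?case by (simp add: rot_def image_image mod_Suc_eq)
qed

lemma rot_power_n: "J \<in> \<G> \<Longrightarrow> (rot ^^ n) J = J"
proof -
  assume "J \<in> \<G>"
  then have J: "J \<subseteq> {1..n}" by (rule grass_subset)
  have "(\<lambda>j. Suc ((j - 1 + n) mod n)) ` J = (\<lambda>j. Suc ((j - 1 + 0) mod n)) ` J" by simp
  then show ?thesis using rot_power[OF J, of 0] rot_power[OF J, of n] by simp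
qed

lemma rot_grass: "J \<in> \<G> \<Longrightarrow> rot J \<in> \<G>"
proof -
  assume J: "J \<in> \<G>"
  have "inj_on (\<lambda>j. Suc (j mod n)) J"
  proof (rule inj_onI)
    fix a b assume ab: "a \<in> J" "b \<in> J" "Suc (a mod n) = Suc (b mod n)"
    then have "1 \<le> a" "a \<le> n" "1 \<le> b" "b \<le> n" "a mod n = b mod n" using grass_subset[OF J] by auto
    then show "a = b" by (cases "a = n"; cases "b = n") auto
  qed
  then have "card (rot J) = m" using J by (simp add: rot_def card_image grass_indices_def)
  moreover have "rot J \<subseteq> {1..n}"
    using mn mod_less_divisor[of n] by (auto simp: rot_def Suc_le_eq)
  ultimately show ?thesis by (simp add: grass_indices_def)
qed

lemma sorted_list_Suc_image: "finite J \<Longrightarrow> sorted_list_of_set (Suc ` J) = map Suc (sorted_list_of_set J)"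
  using sorted_list_of_set.idem_if_sorted_distinct[of "map Suc (sorted_list_of_set J)"]
  by (simp add: sorted_map distinct_map)

lemma sorted_list_late:
  assumes "J \<in> \<G>" "n \<in> J"
  shows "sorted_list_of_set J = sorted_list_of_set (J - {n}) @ [n]"
proof -
  have "set (sorted_list_of_set (J - {n}) @ [n]) = J"
    using assms grass_finite by auto
  moreover have "sorted (sorted_list_of_set (J - {n}) @ [n])" "distinct (sorted_list_of_set (J - {n}) @ [n])"
    using assms grass_finite grass_subset[OF assms(1)] by (auto simp: sorted_append)
  ultimately show ?thesis using sorted_list_of_set.idem_if_sorted_distinct by metis
qed

lemma plucker_rot_late:
  assumes "J \<in> \<G>" "n \<in> J"
  shows "plucker (rot J) = qdet (1 # map Suc (sorted_list_of_set (J - {n})))"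
proof -
  let ?xs = "1 # map Suc (sorted_list_of_set (J - {n}))"
  have "set ?xs = rot J" using assms grass_finite by (auto simp: rot_late)
  moreover have "sorted ?xs" "distinct ?xs"
    using assms grass_subset[OF assms(1)] mn by (auto simp: sorted_map distinct_map grass_finite)
  ultimately show ?thesis using sorted_list_of_set.idem_if_sorted_distinct by metis
qed

text \<open>The crossing costs \<open>inverse q\<close>, and a column \<open>n\<close> in the minor
  compensates for it.\<close>

lemma last_col_mult_plucker:
  assumes "J \<in> \<G>" "k \<in> {1..m}"
  shows "x k n * plucker J \<approx> (if n \<in> J then 1 else inverse q) \<cdot> (plucker J * x k n)"
  using last_col_mult_qdet[OF assms(2), of "sorted_list_of_set J"] grass_subset[OF assms(1)] grass_finite[OF assms(1)]
  by (simp add: prod_list_indicator split: if_splits)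

lemma last_col_mult_monomial:
  assumes "set Js \<subseteq> \<G>" "k \<in> {1..m}"
  shows "x k n * monomial Js \<approx> inverse q ^ length (filter (\<lambda>J. n \<notin> J) Js) \<cdot> (monomial Js * x k n)"
  using assms(1)
proof (induction Js)
  case (Cons J Js)
  let ?c = "if n \<in> J then 1 else inverse q" and ?d = "inverse q ^ length (filter (\<lambda>J. n \<notin> J) Js)"
  have "x k n * plucker J * monomial Js \<approx> ?c \<cdot> (plucker J * x k n) * monomial Js"
    using Cons.prems assms(2) by (intro cong_mult_right last_col_mult_plucker) auto
  also have "\<dots> = ?c \<cdot> (plucker J * (x k n * monomial Js))" by (simp add: mult.assoc)
  also have "\<dots> \<approx> ?c \<cdot> (plucker J * (?d \<cdot> (monomial Js * x k n)))"
    using Cons by (intro cong_scale cong_mult_left) simp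
  finally show ?case by (simp add: mult.assoc split: if_splits)
qed simp

lemma plucker_late_deg: "J \<in> \<G> \<Longrightarrow> plucker J \<in> late_deg (if n \<in> J then 1 else 0)"
  using lap_late_deg[of "{1..m}" "sorted_list_of_set J"] by (simp add: length_filter_eq_distinct grass_finite)

lemma monomial_late_deg: "set Js \<subseteq> \<G> \<Longrightarrow> monomial Js \<in> late_deg (length (filter (\<lambda>J. n \<in> J) Js))"
proof (induction Js)
  case Nil
  then show ?case using late_deg_word[of "[]"] by (simp add: word_Nil)
next
  case (Cons J Js)
  then have "plucker J * monomial Js \<in> late_deg ((if n \<in> J then 1 else 0) + length (filter (\<lambda>J. n \<in> J) Js))"
    by (intro late_deg_mult plucker_late_deg) auto
  then show ?case by (auto split: if_splits)
qed

text \<open>If \<open>t\<close> of the \<open>d\<close> factors in \<open>Js\<close> contain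
  \<open>n\<close>, the exponent of q is t for \<open>n \<notin> J\<close> and t - d - 1 for
  \<open>n \<in> J\<close>. The -1 belongs to \<open>J\<close> alone; the rest is the value at
  \<open>J\<close> of the alternating bicharacter d_s t_n - s_n d_t, where d counts factors and the
  index n marks those containing \<open>n\<close>.\<close>

definition cycle_coeff :: "nat set \<Rightarrow> nat set list \<Rightarrow> 'k" where
  "cycle_coeff J Js = (if n \<in> J then inverse q ^ Suc (length (filter (\<lambda>J. n \<notin> J) Js))
     else q ^ length (filter (\<lambda>J. n \<in> J) Js))"

lemma cycle_plucker_mult:
  assumes "J \<in> \<G>" "set Js \<subseteq> \<G>"
  shows "cycle (plucker J * monomial Js) \<approx> cycle_coeff J Js \<cdot> (plucker (rot J) * cycle (monomial Js))"
proof (cases "n \<in> J")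
  case False
  have "set (sorted_list_of_set J) \<subseteq> {1..<n}"
    using False assms(1) grass_subset[OF assms(1)] by (auto simp: grass_finite le_less)
  from cycle_qdet_mult_early[OF this monomial_late_deg[OF assms(2)]]
  show ?thesis using False assms(1) by (simp add: cycle_coeff_def rot_early sorted_list_Suc_image grass_finite)
next
  case True
  have "set (sorted_list_of_set (J - {n})) \<subseteq> {1..<n}"
    using assms(1) grass_subset[OF assms(1)] by (auto simp: grass_finite le_less)
  from cycle_qdet_mult_last[OF this last_col_mult_monomial[OF assms(2)]]
  show ?thesis
    unfolding plucker_rot_late[OF assms(1) True] sorted_list_late[OF assms(1) True, symmetric]
    using True by (simp add: cycle_coeff_def mult.commute del: lap.simps)
qed

section \<open>The grading by contents\<close>

definition word_content :: "(nat \<times> nat) list \<Rightarrow> nat \<Rightarrow>\<^sub>0 int" where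
  "word_content w = sum_list (map (\<lambda>v. Poly_Mapping.single (snd v) 1) w)"

lemma word_content_simps [simp]:
  "word_content [] = 0"
  "word_content (v # w) = Poly_Mapping.single (snd v) 1 + word_content w"
  "word_content (u @ w) = word_content u + word_content w"
  by (simp_all add: word_content_def)

text \<open>The function \<open>c\<close> is arbitrary: a cochain on the degrees enters
  \<open>\<theta>\<close>, and an indicator function gives the projection to a homogeneous
  component.\<close>

definition degree_scale :: "((nat \<Rightarrow>\<^sub>0 int) \<Rightarrow> 'k) \<Rightarrow> ('k, nat \<times> nat) nc_poly \<Rightarrow> ('k, nat \<times> nat) nc_poly" where
  "degree_scale c = lin_ext (\<lambda>w. c (word_content w) \<cdot> word w)"

lemma lin_degree_scale: "lin (degree_scale c)"
  by (simp add: degree_scale_def lin_lin_ext)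

lemma degree_scale_word: "degree_scale c (word w) = c (word_content w) \<cdot> word w"
  by (simp add: degree_scale_def)

text \<open>The two or three products in a relation use the same columns, so every two-sided
  multiple of a relation by words is scaled by a single value of \<open>c\<close>.\<close>

lemma degree_scale_mem:
  assumes "f \<in> \<R>"
  shows "degree_scale c f \<in> \<R>"
proof -
  note lin = lin_simps[OF lin_degree_scale]
  have two: "degree_scale c (word u * (x a j * x b l) * word v) =
      c (word_content (u @ v) + Poly_Mapping.single j 1 + Poly_Mapping.single l 1) \<cdot> (word u * (x a j * x b l) * word v)"
    for u v a b j l
    by (simp add: nc_var_eq word_mult degree_scale_word ac_simps)
  have "\<exists>s. degree_scale c (word u * r * word v) = c s \<cdot> (word u * r * word v)" if r: "r \<in> qrels n" for u v r
  proof -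
    consider a j b l where "r = rel_cols a j b l" | a b j where "r = rel_col a b j"
      using r unfolding qrels_def by blast
    then show ?thesis
    proof cases
      case (1 a j b l)
      show ?thesis
        by (rule exI[of _ "word_content (u @ v) + Poly_Mapping.single j 1 + Poly_Mapping.single l 1"])
          (simp only: 1 rel_cols_def distrib_left distrib_right left_diff_distrib right_diff_distrib lin
             mult_scale_right scale_mult_left two nc.scale_right_distrib nc.scale_right_diff_distrib
             nc.scale_left_commute[of _ "c _"] add.assoc add.commute[of "Poly_Mapping.single l _" "Poly_Mapping.single j _"])
    next
      case (2 a b j)
      show ?thesis
        by (rule exI[of _ "word_content (u @ v) + Poly_Mapping.single j 1 + Poly_Mapping.single j 1"])
          (simp only: 2 rel_col_def left_diff_distrib right_diff_distrib lin
             mult_scale_right scale_mult_left two nc.scale_right_diff_distrib nc.scale_left_commute[of _ "c _"])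
    qed
  qed
  moreover have "c s \<cdot> (word u * r * word v) \<in> \<R>" if "r \<in> qrels n" for s u v r
    using that unfolding \<R>_eq
    by (metis \<R>_eq ideal_gen_base mem_scale mult_left mult_right)
  ultimately have "degree_scale c (word u * r * word v) \<in> \<R>" if "r \<in> qrels n" for u v r
    using that by metis
  then show ?thesis
    using ideal_gen_image[OF lin_degree_scale subspace, of "qrels n" c f] assms unfolding \<R>_eq by blast
qed

text \<open>Required for all \<open>c\<close> at once, this means that every word in
  \<open>f\<close> has content \<open>s\<close>, in the form in which it is applied.\<close>

definition of_degree :: "(nat \<Rightarrow>\<^sub>0 int) \<Rightarrow> ('k, nat \<times> nat) nc_poly set" where
  "of_degree s = {f. \<forall>c. degree_scale c f = c s \<cdot> f}"

lemma of_degree_subspace: "nc.subspace (of_degree s)"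
  by (auto simp: nc.subspace_def of_degree_def lin_simps[OF lin_degree_scale] nc.scale_right_distrib mult.commute)

lemma of_degree_var_mult: "f \<in> of_degree s \<Longrightarrow> x i j * f \<in> of_degree (Poly_Mapping.single j 1 + s)"
proof -
  assume f: "f \<in> of_degree s"
  have "degree_scale c (x i j * f) = x i j * degree_scale (\<lambda>t. c (Poly_Mapping.single j 1 + t)) f" for c
    by (rule lin_eqI[of "\<lambda>f. degree_scale c (x i j * f)" "\<lambda>f. x i j * degree_scale (\<lambda>t. c (Poly_Mapping.single j 1 + t)) f",
      OF lin_comp[OF lin_degree_scale lin_mult_left] lin_comp[OF lin_mult_left lin_degree_scale]])
      (simp add: word_Cons[symmetric] degree_scale_word)
  then show ?thesis using f by (simp add: of_degree_def)
qed

lemma of_degree_word: "word w \<in> of_degree (word_content w)"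
  by (simp add: of_degree_def degree_scale_word)

lemma lap_of_degree: "lap q x I js \<in> of_degree (\<Sum>j\<leftarrow>js. Poly_Mapping.single j 1)"
proof (induction js arbitrary: I)
  case Nil
  then show ?case using of_degree_word[of "[]"] by (simp add: word_Nil nc.subspace_0[OF of_degree_subspace])
next
  case (Cons j js)
  show ?case
    unfolding lap.simps list.map sum_list.Cons
    by (intro nc.subspace_sum[OF of_degree_subspace] nc.subspace_scale[OF of_degree_subspace] of_degree_var_mult Cons)
qed

lemma plucker_of_degree: "J \<in> \<G> \<Longrightarrow> plucker J \<in> of_degree (content J)"
  using lap_of_degree[of "{1..m}" "sorted_list_of_set J"]
  by (simp add: content_def sum_list_distinct_conv_sum_set grass_finite)

lemma word_mult_of_degree: "f \<in> of_degree s \<Longrightarrow> word w * f \<in> of_degree (word_content w + s)"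
proof (induction w)
  case (Cons v w)
  then show ?case using of_degree_var_mult[of "word w * f" _ "fst v" "snd v"] by (simp add: word_Cons mult.assoc add.assoc)
qed (simp add: word_Nil)

lemma of_degree_mult:
  assumes "f \<in> of_degree s" "g \<in> of_degree t"
  shows "f * g \<in> of_degree (s + t)"
proof -
  have "degree_scale c (h * g) = degree_scale (\<lambda>s. c (s + t)) h * g" for c h
    by (rule lin_eqI[of "\<lambda>h. degree_scale c (h * g)" "\<lambda>h. degree_scale (\<lambda>s. c (s + t)) h * g",
      OF lin_comp[OF lin_degree_scale lin_mult_right] lin_comp[OF lin_mult_right lin_degree_scale]])
      (use word_mult_of_degree[OF assms(2)] in \<open>simp add: of_degree_def degree_scale_word\<close>)
  then show ?thesis using assms(1) by (simp add: of_degree_def)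
qed

abbreviation monomial_degree :: "nat set list \<Rightarrow> nat \<Rightarrow>\<^sub>0 int" where
  "monomial_degree Js \<equiv> sum_list (map content Js)"

lemma monomial_of_degree: "set Js \<subseteq> \<G> \<Longrightarrow> monomial Js \<in> of_degree (monomial_degree Js)"
proof (induction Js)
  case Nil
  then show ?case using of_degree_word[of "[]"] by (simp add: word_Nil)
next
  case (Cons J Js)
  then show ?case
    unfolding list.map prod_list.Cons sum_list.Cons by (intro of_degree_mult plucker_of_degree) auto
qed

lemma lookup_content: "finite J \<Longrightarrow> Poly_Mapping.lookup (content J) j = (if j \<in> J then 1 else 0)"
  by (simp add: content_def lookup_sum lookup_single when_def)

lemma lookup_monomial_degree:
  "set Js \<subseteq> \<G> \<Longrightarrow> Poly_Mapping.lookup (monomial_degree Js) n = int (length (filter (\<lambda>J. n \<in> J) Js))"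
  by (induction Js) (auto simp: lookup_add lookup_content grass_finite)

definition total_degree :: "(nat \<Rightarrow>\<^sub>0 int) \<Rightarrow> int" where
  "total_degree s = (\<Sum>j\<in>{1..n}. Poly_Mapping.lookup s j)"

lemma total_degree_add: "total_degree (s + t) = total_degree s + total_degree t"
  by (simp add: total_degree_def lookup_add sum.distrib)

lemma total_degree_content: "J \<in> \<G> \<Longrightarrow> total_degree (content J) = int m"
proof -
  assume J: "J \<in> \<G>"
  have "total_degree (content J) = (\<Sum>j\<in>{1..n}. if j \<in> J then 1 else 0)"
    using J by (simp add: total_degree_def lookup_content grass_finite)
  also have "\<dots> = int (card ({1..n} \<inter> J))" by (simp add: sum.If_cases)
  also have "{1..n} \<inter> J = J" using grass_subset[OF J] by auto
  finally show ?thesis using J by (simp add: grass_indices_def)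
qed

lemma total_degree_monomial: "set Js \<subseteq> \<G> \<Longrightarrow> total_degree (monomial_degree Js) = int m * int (length Js)"
  by (induction Js) (simp_all add: total_degree_add total_degree_content distrib_left, simp add: total_degree_def)

definition Gr :: "('k, nat \<times> nat) nc_poly set" where
  "Gr = nc.span {monomial Js | Js. set Js \<subseteq> \<G>}"

end


section \<open>The twisted cyclic shift\<close>

lemma prod_power_int:
  "p \<noteq> (0 :: 'k::field) \<Longrightarrow> (\<Prod>j\<in>A. p powi f j) = p powi (\<Sum>j\<in>A. f j)"
  by (induction A rule: infinite_finite_induct) (simp_all add: power_int_add)

lemma choose_two_small: "0 choose 2 = 0" "Suc 0 choose 2 = 0"
  by (simp_all add: numeral_2_eq_2)

locale qgrass_twisting = qmatrices q m n for q :: "'k::field" and m n :: nat +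
  fixes p :: 'k
  assumes p: "p ^ m = q ^ 2"
begin

lemma p_nonzero: "p \<noteq> 0"
  using p q m by (metis power_eq_0_iff zero_power)

abbreviation cocycle :: "(nat \<Rightarrow>\<^sub>0 int) \<Rightarrow> (nat \<Rightarrow>\<^sub>0 int) \<Rightarrow> 'k" where
  "cocycle \<equiv> grass_cocycle p n"

lemma cocycle_eq: "cocycle s t = p powi (Poly_Mapping.lookup s n * (total_degree t - Poly_Mapping.lookup t n))"
proof -
  have "total_degree t = Poly_Mapping.lookup t n + (\<Sum>j\<in>{1..n} - {n}. Poly_Mapping.lookup t j)"
    unfolding total_degree_def by (rule sum.remove) (use mn in auto)
  then show ?thesis
    by (simp add: grass_cocycle_def prod_power_int[OF p_nonzero] sum_distrib_left)
qed

lemma cocycle_nonzero: "cocycle s t \<noteq> 0"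
  by (simp add: cocycle_eq p_nonzero)

lemma cocycle_add_left: "cocycle (s + s') t = cocycle s t * cocycle s' t"
  by (simp add: cocycle_eq lookup_add distrib_right power_int_add p_nonzero)

lemma cocycle_add_right: "cocycle s (t + t') = cocycle s t * cocycle s t'"
  by (simp add: cocycle_eq lookup_add total_degree_add power_int_add[symmetric] p_nonzero algebra_simps)

lemma cocycle_zero: "cocycle 0 t = 1" "cocycle s 0 = 1"
  by (simp_all add: cocycle_eq total_degree_def)

text \<open>
  The coboundary of this cochain is the quotient of the given cocycle by the bicharacter with which
  \<open>cycle\<close> fails to be multiplicative.
\<close>

definition cobound :: "(nat \<Rightarrow>\<^sub>0 int) \<Rightarrow> 'k" where
  "cobound s = inverse q ^ nat (Poly_Mapping.lookup s n * (total_degree s div int m))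
     * p ^ (nat (Poly_Mapping.lookup s n) choose 2)"

definition \<theta> :: "('k, nat \<times> nat) nc_poly \<Rightarrow> ('k, nat \<times> nat) nc_poly" where
  "\<theta> f = cycle (degree_scale cobound f)"

lemma lin_\<theta>: "lin \<theta>"
  unfolding \<theta>_def by (rule lin_comp[OF lin_cycle lin_degree_scale])

lemma \<theta>_mem: "f \<in> \<R> \<Longrightarrow> \<theta> f \<in> \<R>"
  by (simp add: \<theta>_def cycle_mem degree_scale_mem)

lemma \<theta>_cong: "f \<approx> g \<Longrightarrow> \<theta> f \<approx> \<theta> g"
  unfolding cong_def by (simp flip: lin_diff[OF lin_\<theta>] add: \<theta>_mem)

text \<open>The truncations \<open>nat\<close> and \<open>div\<close> in \<open>cobound\<close> are
  exact here: the n-th entry of the degree counts the factors containing \<open>n\<close>, and the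
  total degree is \<open>m\<close> times the number of factors.\<close>

lemma cobound_monomial:
  assumes "set Js \<subseteq> \<G>"
  shows "cobound (monomial_degree Js) =
    inverse q ^ (length (filter (\<lambda>J. n \<in> J) Js) * length Js) * p ^ (length (filter (\<lambda>J. n \<in> J) Js) choose 2)"
  using m by (simp add: cobound_def lookup_monomial_degree[OF assms] total_degree_monomial[OF assms] nat_mult_distrib)

lemma \<theta>_monomial:
  "set Js \<subseteq> \<G> \<Longrightarrow> \<theta> (monomial Js) = cobound (monomial_degree Js) \<cdot> cycle (monomial Js)"
  using monomial_of_degree[of Js] by (simp add: \<theta>_def of_degree_def lin_scale[OF lin_cycle])

lemma \<theta>_one: "\<theta> 1 = 1"
  using \<theta>_monomial[of "[]"] by (simp add: cycle_one cobound_def total_degree_def choose_two_small)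

text \<open>The scalar q^(-2) has two sources: one \<open>inverse q\<close> is the normalisation of
  \<open>tau\<close>, the other one is the value of \<open>cobound\<close> at the content of a
  single set containing \<open>n\<close>.\<close>

lemma \<theta>_plucker:
  assumes "J \<in> \<G>"
  shows "\<theta> (plucker J) \<approx> (if n \<in> J then inverse q ^ 2 else 1) \<cdot> plucker (rot J)"
proof -
  have "\<theta> (plucker J) = cobound (content J) \<cdot> cycle (plucker J * monomial [])"
    using \<theta>_monomial[of "[J]"] assms by simp
  also have "\<dots> \<approx> cobound (content J) \<cdot> (cycle_coeff J [] \<cdot> (plucker (rot J) * cycle (monomial [])))"
    using assms by (intro cong_scale cycle_plucker_mult) auto
  also have "\<dots> = (if n \<in> J then inverse q ^ 2 else 1) \<cdot> plucker (rot J)"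
    using cobound_monomial[of "[J]"] assms
    by (cases "n \<in> J") (simp_all add: cycle_coeff_def cycle_one power2_eq_square choose_two_small)
  finally show ?thesis .
qed

text \<open>For degrees s, t let s_n, t_n be the entries at n and d_s, d_t the numbers of factors.
  \<open>cycle\<close> is multiplicative on monomials up to q^(d_s t_n - s_n d_t). The quotient of
  \<open>cobound\<close> at s + t by its values at s and t is q^(-s_n d_t - t_n d_s) p^(s_n t_n).
  The product of the two is q^(-2 s_n d_t) p^(s_n t_n), and as p^m = q^2 this is p^(-s_n (m d_t -
  t_n)), the inverse of the cocycle. The lemma is the case d_s = 1, with the scalar of
  \<open>J\<close> itself kept separate on the right.\<close>

lemma cobound_coeff:
  assumes "J \<in> \<G>" "set Js \<subseteq> \<G>"
  shows "cobound (monomial_degree (J # Js)) * cycle_coeff J Js =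
    inverse (cocycle (content J) (monomial_degree Js)) * ((if n \<in> J then inverse q ^ 2 else 1) * cobound (monomial_degree Js))"
proof -
  define t where "t = length (filter (\<lambda>J. n \<in> J) Js)"
  define u where "u = length (filter (\<lambda>J. n \<notin> J) Js)"
  have len: "length Js = t + u"
    unfolding t_def u_def using sum_length_filter_compl[of "\<lambda>J. n \<in> J" Js] by simp
  have JJs: "set (J # Js) \<subseteq> \<G>" using assms by auto
  have c0: "cobound (monomial_degree Js) = inverse q ^ (t * (t + u)) * p ^ (t choose 2)"
    using cobound_monomial[OF assms(2)] by (simp add: t_def[symmetric] len)
  show ?thesis
  proof (cases "n \<in> J")
    case False
    have "cobound (monomial_degree (J # Js)) = inverse q ^ (t * Suc (t + u)) * p ^ (t choose 2)"
      using cobound_monomial[OF JJs] False by (simp add: t_def[symmetric] len)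
    moreover have "inverse q ^ t * q ^ t = 1"
      using q by (simp add: power_mult_distrib[symmetric])
    moreover have "cocycle (content J) (monomial_degree Js) = 1"
      using False assms(1) by (simp add: cocycle_eq lookup_content grass_finite)
    ultimately show ?thesis
      unfolding c0 using False by (simp add: cycle_coeff_def t_def[symmetric] power_add mult.commute mult.left_commute)
  next
    case True
    have c1: "cobound (monomial_degree (J # Js)) = inverse q ^ (Suc t * Suc (t + u)) * p ^ (Suc t choose 2)"
      using cobound_monomial[OF JJs] True by (simp add: t_def[symmetric] len)
    have c2: "cycle_coeff J Js = inverse q ^ Suc u"
      using True by (simp add: cycle_coeff_def u_def)
    have "cocycle (content J) (monomial_degree Js) = p powi (int (m * (t + u)) - int t)"
      using True assms
      by (simp add: cocycle_eq lookup_content grass_finite total_degree_monomial lookup_monomial_degree t_def[symmetric] len)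
    also have "\<dots> = (p ^ m) ^ (t + u) / p ^ t"
      by (simp only: power_int_diff[OF disjI1[OF p_nonzero]] power_int_of_nat power_mult)
    finally have c3: "inverse (cocycle (content J) (monomial_degree Js)) = inverse q ^ (2 * (t + u)) * p ^ t"
      by (simp only: p power_mult[symmetric] inverse_divide power_inverse) (simp add: divide_inverse mult.commute)
    have c4: "p ^ (Suc t choose 2) = p ^ (t choose 2) * p ^ t"
      by (simp add: numeral_2_eq_2 power_add mult.commute)
    have "Suc t * Suc (t + u) + Suc u = 2 * (t + u) + 2 + t * (t + u)" by simp
    then have c5: "inverse q ^ (Suc t * Suc (t + u)) * inverse q ^ Suc u =
        inverse q ^ (2 * (t + u)) * inverse q ^ 2 * inverse q ^ (t * (t + u))"
      by (simp only: power_add[symmetric])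
    have "cobound (monomial_degree (J # Js)) * cycle_coeff J Js =
        (inverse q ^ (Suc t * Suc (t + u)) * inverse q ^ Suc u) * (p ^ (t choose 2) * p ^ t)"
      unfolding c1 c2 c4 by (simp only: mult.assoc mult.commute mult.left_commute)
    also have "\<dots> = inverse q ^ (2 * (t + u)) * p ^ t * (inverse q ^ 2 * (inverse q ^ (t * (t + u)) * p ^ (t choose 2)))"
      unfolding c5 by (simp only: mult.assoc mult.commute mult.left_commute)
    finally show ?thesis
      unfolding c0 c3 using True by simp
  qed
qed

lemma \<theta>_plucker_mult:
  assumes "J \<in> \<G>" "set Js \<subseteq> \<G>"
  shows "\<theta> (plucker J * monomial Js) \<approx>
    inverse (cocycle (content J) (monomial_degree Js)) \<cdot> (\<theta> (plucker J) * \<theta> (monomial Js))"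
proof -
  let ?c = "inverse (cocycle (content J) (monomial_degree Js))" and ?d = "if n \<in> J then inverse q ^ 2 else 1"
  have "\<theta> (plucker J * monomial Js) = cobound (monomial_degree (J # Js)) \<cdot> cycle (plucker J * monomial Js)"
    using \<theta>_monomial[of "J # Js"] assms by simp
  also have "\<dots> \<approx> cobound (monomial_degree (J # Js)) \<cdot> (cycle_coeff J Js \<cdot> (plucker (rot J) * cycle (monomial Js)))"
    by (intro cong_scale cycle_plucker_mult assms)
  also have "\<dots> = ?c \<cdot> (?d \<cdot> plucker (rot J) * \<theta> (monomial Js))"
    by (simp only: nc.scale_scale cobound_coeff[OF assms] \<theta>_monomial[OF assms(2)] scale_mult_left mult_scale_right)
      (simp only: mult.commute mult.left_commute)
  also have "\<dots> \<approx> ?c \<cdot> (\<theta> (plucker J) * \<theta> (monomial Js))"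
    by (intro cong_scale cong_mult_right cong_sym[OF \<theta>_plucker[OF assms(1)]])
  finally show ?thesis .
qed

text \<open>The cocycle is multiplicative in either argument, which reduces the claim to a single
  generator as left factor.\<close>

lemma \<theta>_monomial_mult:
  assumes "set Js \<subseteq> \<G>" "set Ks \<subseteq> \<G>"
  shows "\<theta> (monomial Js * monomial Ks) \<approx>
    inverse (cocycle (monomial_degree Js) (monomial_degree Ks)) \<cdot> (\<theta> (monomial Js) * \<theta> (monomial Ks))"
  using assms(1)
proof (induction Js)
  case Nil
  then show ?case by (simp add: \<theta>_one cocycle_zero)
next
  case (Cons J Js)
  let ?j = "content J" and ?s = "monomial_degree Js" and ?t = "monomial_degree Ks"
  have J: "J \<in> \<G>" and Js: "set Js \<subseteq> \<G>" using Cons.prems by auto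
  have "\<theta> (monomial (J # Js) * monomial Ks) = \<theta> (plucker J * monomial (Js @ Ks))"
    by (simp add: mult.assoc)
  also have "\<dots> \<approx> inverse (cocycle ?j (monomial_degree (Js @ Ks))) \<cdot> (\<theta> (plucker J) * \<theta> (monomial (Js @ Ks)))"
    using J Js assms(2) by (intro \<theta>_plucker_mult) auto
  also have "\<dots> = inverse (cocycle ?j ?s * cocycle ?j ?t) \<cdot> (\<theta> (plucker J) * \<theta> (monomial Js * monomial Ks))"
    by (simp add: cocycle_add_right)
  also have "\<dots> \<approx> inverse (cocycle ?j ?s * cocycle ?j ?t) \<cdot> (\<theta> (plucker J) * (inverse (cocycle ?s ?t) \<cdot> (\<theta> (monomial Js) * \<theta> (monomial Ks))))"
    by (intro cong_scale cong_mult_left Cons.IH Js)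
  also have "\<dots> = inverse (cocycle (?j + ?s) ?t) \<cdot> (inverse (cocycle ?j ?s) \<cdot> (\<theta> (plucker J) * \<theta> (monomial Js)) * \<theta> (monomial Ks))"
    by (simp add: cocycle_add_left mult.assoc mult.commute mult.left_commute)
  also have "\<dots> \<approx> inverse (cocycle (?j + ?s) ?t) \<cdot> (\<theta> (plucker J * monomial Js) * \<theta> (monomial Ks))"
    by (intro cong_scale cong_mult_right cong_sym[OF \<theta>_plucker_mult] J Js)
  finally show ?case by simp
qed

lemma \<theta>_monomial_rot:
  assumes "set Js \<subseteq> \<G>"
  shows "\<exists>\<mu>. \<mu> \<noteq> 0 \<and> \<theta> (monomial Js) \<approx> \<mu> \<cdot> monomial (map rot Js)"
  using assms
proof (induction Js)
  case Nil
  then show ?case by (intro exI[of _ 1]) (simp add: \<theta>_one)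
next
  case (Cons J Js)
  then obtain \<mu> where \<mu>: "\<mu> \<noteq> 0" "\<theta> (monomial Js) \<approx> \<mu> \<cdot> monomial (map rot Js)" by auto
  let ?c = "inverse (cocycle (content J) (monomial_degree Js))" and ?d = "if n \<in> J then inverse q ^ 2 else 1"
  have "\<theta> (monomial (J # Js)) \<approx> ?c \<cdot> (\<theta> (plucker J) * \<theta> (monomial Js))"
    using Cons.prems \<theta>_plucker_mult[of J Js] by simp
  also have "\<dots> \<approx> ?c \<cdot> (?d \<cdot> plucker (rot J) * (\<mu> \<cdot> monomial (map rot Js)))"
    using Cons.prems by (intro cong_scale cong_mult \<theta>_plucker \<mu>) auto
  also have "\<dots> = (?c * (?d * \<mu>)) \<cdot> monomial (map rot (J # Js))"
    by (simp add: mult.commute mult.left_commute)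
  finally show ?case
    using \<mu>(1) q cocycle_nonzero by (intro exI[of _ "?c * (?d * \<mu>)"]) auto
qed

section \<open>Iterates of \<open>\<theta>\<close> and injectivity\<close>

lemma lin_\<theta>_power: "lin (\<theta> ^^ k)"
proof (induction k)
  case (Suc k)
  then show ?case using lin_comp[OF lin_\<theta> Suc] by (simp add: o_def)
qed (simp add: lin_id id_def)

lemma \<theta>_power_mem: "f \<in> \<R> \<Longrightarrow> (\<theta> ^^ k) f \<in> \<R>"
  by (induction k) (simp_all add: \<theta>_mem)

lemma \<theta>_power_monomial:
  assumes "set Js \<subseteq> \<G>"
  shows "\<exists>\<mu>. \<mu> \<noteq> 0 \<and> (\<theta> ^^ k) (monomial Js) \<approx> \<mu> \<cdot> monomial (map (rot ^^ k) Js)"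
proof (induction k)
  case 0
  then show ?case by (intro exI[of _ 1]) simp
next
  case (Suc k)
  then obtain \<mu> where \<mu>: "\<mu> \<noteq> 0" "(\<theta> ^^ k) (monomial Js) \<approx> \<mu> \<cdot> monomial (map (rot ^^ k) Js)" by auto
  have "(rot ^^ k) J \<in> \<G>" if "J \<in> \<G>" for J
    by (induction k) (simp_all add: that rot_grass)
  then have "set (map (rot ^^ k) Js) \<subseteq> \<G>" using assms by auto
  from \<theta>_monomial_rot[OF this] obtain \<nu> where
    \<nu>: "\<nu> \<noteq> 0" "\<theta> (monomial (map (rot ^^ k) Js)) \<approx> \<nu> \<cdot> monomial (map rot (map (rot ^^ k) Js))" by auto
  have "(\<theta> ^^ Suc k) (monomial Js) \<approx> \<theta> (\<mu> \<cdot> monomial (map (rot ^^ k) Js))"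
    using \<theta>_cong[OF \<mu>(2)] by simp
  also have "\<dots> \<approx> \<mu> \<cdot> (\<nu> \<cdot> monomial (map rot (map (rot ^^ k) Js)))"
    unfolding lin_scale[OF lin_\<theta>] by (intro cong_scale \<nu>)
  also have "\<dots> = (\<mu> * \<nu>) \<cdot> monomial (map (rot ^^ Suc k) Js)"
    by (simp only: nc.scale_scale map_map funpow.simps)
  finally have e: "(\<theta> ^^ Suc k) (monomial Js) \<approx> (\<mu> * \<nu>) \<cdot> monomial (map (rot ^^ Suc k) Js)" .
  have "\<mu> * \<nu> \<noteq> 0" using \<mu>(1) \<nu>(1) by simp
  with e show ?case by blast
qed

definition annihilator :: "'k list \<Rightarrow> ('k, nat \<times> nat) nc_poly \<Rightarrow> ('k, nat \<times> nat) nc_poly" where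
  "annihilator \<mu>s f = foldr (\<lambda>\<mu> g. (\<theta> ^^ n) g - \<mu> \<cdot> g) \<mu>s f"

lemma annihilator_simps [simp]:
  "annihilator [] f = f"
  "annihilator (\<mu> # \<mu>s) f = (\<theta> ^^ n) (annihilator \<mu>s f) - \<mu> \<cdot> annihilator \<mu>s f"
  by (simp_all add: annihilator_def)

lemma lin_annihilator: "lin (annihilator \<mu>s)"
  by (rule linI; induction \<mu>s)
    (simp_all add: lin_simps[OF lin_\<theta>_power] nc.scale_right_distrib
      nc.scale_right_diff_distrib nc.scale_left_commute)

lemma annihilator_commute: "annihilator \<mu>s ((\<theta> ^^ n) f) = (\<theta> ^^ n) (annihilator \<mu>s f)"
  by (induction \<mu>s) (simp_all add: lin_simps[OF lin_\<theta>_power])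

lemma annihilator_mem: "f \<in> \<R> \<Longrightarrow> annihilator \<mu>s f \<in> \<R>"
  by (induction \<mu>s) (simp_all add: mem_diff mem_scale \<theta>_power_mem)

text \<open>Monomials may have different eigenvalues and are not known to be independent, so one
  eigenvalue is collected for each monomial in some representation of the element. The factors
  commute, hence each one may be applied first to the monomial it kills.\<close>

lemma exists_annihilator:
  assumes "f \<in> Gr"
  shows "\<exists>\<mu>s. 0 \<notin> set \<mu>s \<and> annihilator \<mu>s f \<in> \<R>"
  using assms unfolding Gr_def
proof (induction rule: nc.span_induct_alt)
  case base
  then show ?case by (intro exI[of _ "[]"]) (simp add: mem_zero)
next
  case (step c b f)
  then obtain Js \<mu>s where Js: "b = monomial Js" "set Js \<subseteq> \<G>" and \<mu>s: "0 \<notin> set \<mu>s" "annihilator \<mu>s f \<in> \<R>" by auto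
  obtain \<mu> where \<mu>: "\<mu> \<noteq> 0" "(\<theta> ^^ n) b \<approx> \<mu> \<cdot> monomial (map (rot ^^ n) Js)"
    using \<theta>_power_monomial[OF Js(2)] Js(1) by auto
  have "map (rot ^^ n) Js = Js"
    using Js(2) by (intro map_idI) (auto simp: rot_power_n)
  then have "(\<theta> ^^ n) b - \<mu> \<cdot> b \<in> \<R>" using \<mu>(2) Js(1) by (simp add: cong_def)
  from annihilator_mem[OF this, of \<mu>s]
  have "annihilator (\<mu> # \<mu>s) b \<in> \<R>"
    by (simp add: lin_simps[OF lin_annihilator] annihilator_commute)
  moreover have "annihilator (\<mu> # \<mu>s) f \<in> \<R>"
    using \<mu>s(2) by (simp add: mem_diff mem_scale \<theta>_power_mem)
  ultimately have "annihilator (\<mu> # \<mu>s) (c \<cdot> b + f) \<in> \<R>"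
    unfolding lin_simps[OF lin_annihilator] by (intro mem_add mem_scale)
  then show ?case using \<mu>(1) \<mu>s(1) by (intro exI[of _ "\<mu> # \<mu>s"]) auto
qed

text \<open>
  The monomials are eigenvectors of \<open>\<theta> ^^ n\<close> with nonzero eigenvalues, so \<open>\<theta> ^^ n\<close> satisfies a
  polynomial with nonzero constant term on every element.
\<close>

lemma \<theta>_injective:
  assumes "f \<in> Gr" "\<theta> f \<in> \<R>"
  shows "f \<in> \<R>"
proof -
  obtain k where k: "n = Suc k" using mn by (cases n) auto
  have L: "(\<theta> ^^ n) f \<in> \<R>"
    using \<theta>_power_mem[OF assms(2), of k] by (simp add: k funpow_swap1)
  \<comment> \<open>As \<open>(\<theta> ^^ n) f\<close> vanishes modulo \<open>\<R>\<close>, so does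
    \<open>\<theta> ^^ n\<close> on everything made from \<open>f\<close> by the earlier factors;
    each factor reduces to multiplication by \<open>- \<mu>\<close>.\<close>
  have "annihilator \<mu>s f \<approx> prod_list (map uminus \<mu>s) \<cdot> f" for \<mu>s
  proof (induction \<mu>s)
    case (Cons \<mu> \<mu>s)
    have "(\<theta> ^^ n) (annihilator \<mu>s f) \<in> \<R>"
      unfolding annihilator_commute[symmetric] by (rule annihilator_mem[OF L])
    then have "annihilator (\<mu> # \<mu>s) f \<approx> 0 - \<mu> \<cdot> annihilator \<mu>s f"
      unfolding annihilator_simps by (intro cong_diff cong_refl) (simp add: cong_def)
    also have "\<dots> \<approx> 0 - \<mu> \<cdot> (prod_list (map uminus \<mu>s) \<cdot> f)"
      by (intro cong_diff cong_scale cong_refl Cons)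
    finally show ?case by simp
  qed simp
  moreover obtain \<mu>s where \<mu>s: "0 \<notin> set \<mu>s" "annihilator \<mu>s f \<in> \<R>"
    using exists_annihilator[OF assms(1)] by auto
  ultimately have "prod_list (map uminus \<mu>s) \<cdot> f \<in> \<R>"
    using cong_mem cong_sym by blast
  from mem_scale[OF this, of "inverse (prod_list (map uminus \<mu>s))"]
  moreover have "prod_list (map uminus \<mu>s) \<noteq> 0"
    using \<mu>s(1) by (induction \<mu>s) auto
  ultimately show ?thesis by simp
qed

end


section \<open>Presented algebras as quotients\<close>

lemma word_mem_free_alg: "word w \<in> carrier (free_alg V) \<longleftrightarrow> set w \<subseteq> V"
  by (simp add: free_alg_def)

lemma subspace_free_alg: "nc.subspace (carrier (free_alg V))"
proof -
  have "Poly_Mapping.keys (c \<cdot> f) \<subseteq> Poly_Mapping.keys f" for c :: 'a and f :: "('a, 'b) nc_poly"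
    by (auto simp: in_keys_iff)
  then show ?thesis
    unfolding nc.subspace_def free_alg_def using Poly_Mapping.keys_add by fastforce
qed

lemma mult_free_alg:
  "f \<in> carrier (free_alg V) \<Longrightarrow> g \<in> carrier (free_alg V) \<Longrightarrow> f * g \<in> carrier (free_alg V)"
  using keys_mult[of f g] by (force simp: free_alg_def plus_free_monoid_def)

lemma one_free_alg: "1 \<in> carrier (free_alg V)"
  using word_mem_free_alg[of "[]"] by (simp add: word_Nil)

lemma var_free_alg: "v \<in> V \<Longrightarrow> nc_var v \<in> carrier (free_alg V)"
  by (simp add: nc_var_eq word_mem_free_alg)

lemmas free_alg_closed = nc.subspace_0[OF subspace_free_alg] nc.subspace_add[OF subspace_free_alg]
  nc.subspace_diff[OF subspace_free_alg] nc.subspace_scale[OF subspace_free_alg]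
  mult_free_alg one_free_alg var_free_alg

lemma free_alg_simps [simp]:
  "mult (free_alg V) = (*)" "add (free_alg V) = (+)" "one (free_alg V) = 1" "zero (free_alg V) = 0"
  "module.smult (free_alg V) = nc_scale"
  by (simp_all add: free_alg_def fun_eq_iff)

lemma ring_free_alg: "ring (free_alg V)"
proof (rule ringI)
  show "abelian_group (free_alg V)"
  proof (rule abelian_groupI)
    fix f assume "f \<in> carrier (free_alg V)"
    then show "\<exists>g\<in>carrier (free_alg V). g \<oplus>\<^bsub>free_alg V\<^esub> f = \<zero>\<^bsub>free_alg V\<^esub>"
      using free_alg_closed(4)[of f V "- 1"] by (intro bexI[of _ "- f"]) simp_all
  qed (simp_all add: free_alg_closed add.assoc add.commute)
  show "monoid (free_alg V)"
    by (rule monoidI) (simp_all add: free_alg_closed mult.assoc)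
qed (simp_all add: distrib_left distrib_right)

locale presentation =
  fixes V :: "'v set" and R :: "('k::field, 'v) nc_poly set"
  assumes rels: "R \<subseteq> carrier (free_alg V)"
begin

abbreviation \<F> :: "('k, 'v) nc_poly set" where "\<F> \<equiv> carrier (free_alg V)"

text \<open>The presented ideal lives in the free algebra on \<open>V\<close>, while
  \<open>ideal_gen\<close> allows all letters of the type as multipliers. Foreign letters create no
  new relations between polynomials in \<open>V\<close>, because words containing them can be sent
  to 0.\<close>

lemma presented_ideal_eq: "presented_ideal V R = ideal_gen R \<inter> \<F>"
proof
  interpret F: ring "free_alg V :: ('k, ('k, 'v) nc_poly) module" by (rule ring_free_alg)
  interpret J: nc_ideal "ideal_gen R" by (rule nc_ideal_ideal_gen)
  have uminus: "\<ominus>\<^bsub>free_alg V\<^esub> f = - f" if "f \<in> \<F>" for f :: "('k, 'v) nc_poly"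
    using that free_alg_closed(4)[OF that, of "- 1"] by (intro F.minus_equality) simp_all
  have "ideal (ideal_gen R \<inter> \<F>) (free_alg V)"
  proof (rule idealI[OF ring_free_alg])
    show "subgroup (ideal_gen R \<inter> \<F>) (add_monoid (free_alg V))"
    proof (rule F.add.subgroupI)
      show "ideal_gen R \<inter> \<F> \<noteq> {}" using J.mem_zero free_alg_closed(1) by blast
      fix f assume f: "f \<in> ideal_gen R \<inter> \<F>"
      then show "\<ominus>\<^bsub>free_alg V\<^esub> f \<in> ideal_gen R \<inter> \<F>"
        using J.mem_scale[of f "- 1"] free_alg_closed(4)[of f V "- 1"] by (simp add: uminus)
    qed (auto simp: J.mem_add free_alg_closed)
  qed (auto simp: J.mult_left J.mult_right free_alg_closed)
  then show "presented_ideal V R \<subseteq> ideal_gen R \<inter> \<F>"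
    unfolding presented_ideal_def
    by (rule F.genideal_minimal) (use rels ideal_gen_base in blast)
  interpret K: ideal "presented_ideal V R" "free_alg V :: ('k, ('k, 'v) nc_poly) module"
    unfolding presented_ideal_def by (rule F.genideal_ideal[OF rels])
  have "c \<cdot> f \<in> presented_ideal V R" if "f \<in> presented_ideal V R" for c f
  proof -
    have "c \<cdot> 1 \<in> \<F>" by (simp add: free_alg_closed)
    from K.I_l_closed[OF that this] show ?thesis by simp
  qed
  then have sub: "nc.subspace (presented_ideal V R)"
    using K.additive_subgroup_axioms additive_subgroup.zero_closed[OF K.additive_subgroup_axioms]
      additive_subgroup.a_closed[OF K.additive_subgroup_axioms]
    by (auto simp: nc.subspace_def)
  \<comment> \<open>A retraction onto the free algebra on \<open>V\<close>; it is multiplicative and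
    fixes the relations.\<close>
  define \<pi> :: "('k, 'v) nc_poly \<Rightarrow> ('k, 'v) nc_poly" where "\<pi> = lin_ext (\<lambda>w. if set w \<subseteq> V then word w else 0)"
  have lin: "lin \<pi>" by (simp add: \<pi>_def lin_lin_ext)
  have id: "\<pi> f = f" if "f \<in> \<F>" for f
  proof -
    have "\<pi> f = (\<Sum>w\<in>Poly_Mapping.keys f. Poly_Mapping.lookup f w \<cdot> word (letters w))"
      unfolding \<pi>_def lin_ext_def using that by (intro sum.cong) (auto simp: free_alg_def)
    then show ?thesis using nc_poly_eq_sum[of f] by simp
  qed
  have mult: "\<pi> (f * g) = \<pi> f * \<pi> g" for f g
  proof -
    have "\<pi> (word u * g) = \<pi> (word u) * \<pi> g" for u
      by (rule lin_eqI[of "\<lambda>g. \<pi> (word u * g)" "\<lambda>g. \<pi> (word u) * \<pi> g", OF lin_comp[OF lin lin_mult_left]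
          lin_comp[OF lin_mult_left lin]]) (simp add: \<pi>_def word_mult)
    then show ?thesis
      by (rule lin_eqI[of "\<lambda>f. \<pi> (f * g)" "\<lambda>f. \<pi> f * \<pi> g", OF lin_comp[OF lin lin_mult_right]
          lin_comp[OF lin_mult_right lin]])
  qed
  have "\<pi> (word u * r * word v) \<in> presented_ideal V R" if "r \<in> R" for u r v
  proof -
    have "\<pi> (word w) \<in> \<F>" for w by (simp add: \<pi>_def word_mem_free_alg free_alg_closed)
    moreover have "r \<in> presented_ideal V R"
      unfolding presented_ideal_def using F.genideal_self[OF rels] that by blast
    moreover have "\<pi> r = r" using rels that by (intro id) auto
    ultimately show ?thesis using K.I_l_closed K.I_r_closed by (simp add: mult)
  qed
  from ideal_gen_image[OF lin sub this]
  show "ideal_gen R \<inter> \<F> \<subseteq> presented_ideal V R"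
    using id by force
qed

sublocale nc_ideal "ideal_gen R"
  by (rule nc_ideal_ideal_gen)

notation cong (infix "\<approx>" 50)

lemma ideal_presented: "ideal (presented_ideal V R) (free_alg V)"
  unfolding presented_ideal_def by (rule ring.genideal_ideal[OF ring_free_alg rels])

definition cls :: "('k, 'v) nc_poly \<Rightarrow> ('k, 'v) nc_poly set" where
  "cls f = presented_ideal V R +>\<^bsub>free_alg V\<^esub> f"

lemma cls_eq_image: "cls f = (\<lambda>h. h + f) ` (ideal_gen R \<inter> \<F>)"
  unfolding cls_def a_r_coset_def' presented_ideal_eq by auto

lemma cls_eq_iff:
  assumes "f \<in> \<F>" "g \<in> \<F>"
  shows "cls f = cls g \<longleftrightarrow> f \<approx> g"
proof
  assume "cls f = cls g"
  moreover have "f \<in> cls f" unfolding cls_eq_image by (rule image_eqI[of _ _ 0]) (simp_all add: mem_zero free_alg_closed)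
  ultimately show "f \<approx> g" by (auto simp: cls_eq_image cong_def)
next
  have "cls f \<subseteq> cls g" if fg: "f \<approx> g" "f \<in> \<F>" "g \<in> \<F>" for f g
  proof
    fix u assume "u \<in> cls f"
    then obtain h where h: "u = h + f" "h \<in> ideal_gen R" "h \<in> \<F>" by (auto simp: cls_eq_image)
    then have "u = (h + (f - g)) + g" "h + (f - g) \<in> ideal_gen R \<inter> \<F>"
      using fg by (auto simp: cong_def mem_add free_alg_closed)
    then show "u \<in> cls g" unfolding cls_eq_image by blast
  qed
  then show "f \<approx> g \<Longrightarrow> cls f = cls g" using assms cong_sym by blast
qed

abbreviation P :: "('k, ('k, 'v) nc_poly set) module" where "P \<equiv> presented_alg V R"

lemma P_carrier: "carrier P = cls ` \<F>"
  by (auto simp: presented_alg_def ring.defs FactRing_def A_RCOSETS_def' cls_def)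

lemma P_mult: "f \<in> \<F> \<Longrightarrow> g \<in> \<F> \<Longrightarrow> cls f \<otimes>\<^bsub>P\<^esub> cls g = cls (f * g)"
  using ideal.rcoset_mult_add[OF ideal_presented, of f g]
  by (simp add: presented_alg_def ring.defs FactRing_def cls_def)

lemma P_add: "f \<in> \<F> \<Longrightarrow> g \<in> \<F> \<Longrightarrow> cls f \<oplus>\<^bsub>P\<^esub> cls g = cls (f + g)"
  using ideal.a_rcos_sum[OF ideal_presented, of f g]
  by (simp add: presented_alg_def ring.defs FactRing_def cls_def)

lemma P_one: "\<one>\<^bsub>P\<^esub> = cls 1"
  by (simp add: presented_alg_def ring.defs FactRing_def cls_def)

lemma P_zero: "\<zero>\<^bsub>P\<^esub> = cls 0"
  by (simp add: presented_alg_def ring.defs FactRing_def cls_eq_image presented_ideal_eq)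

lemma P_smult:
  assumes "f \<in> \<F>"
  shows "c \<odot>\<^bsub>P\<^esub> cls f = cls (c \<cdot> f)"
proof -
  have "cls (c \<cdot> g) = cls (c \<cdot> f)" if "g \<in> cls f" for g
  proof -
    have "g \<approx> f" "g \<in> \<F>" using that assms by (auto simp: cls_eq_image cong_def free_alg_closed)
    then show ?thesis using assms by (simp add: cls_eq_iff free_alg_closed cong_scale)
  qed
  then have "(\<Union>g\<in>cls f. cls (c \<cdot> g)) = (\<Union>g\<in>cls f. cls (c \<cdot> f))"
    by (intro SUP_cong refl)
  also have "f \<in> cls f"
    unfolding cls_eq_image by (rule image_eqI[of _ _ 0]) (simp_all add: mem_zero free_alg_closed)
  then have "(\<Union>g\<in>cls f. cls (c \<cdot> f)) = cls (c \<cdot> f)" by auto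
  finally show ?thesis
    by (simp add: presented_alg_def ring.defs cls_def)
qed

end

section \<open>Algebras of cosets represented by a subspace of the free algebra\<close>

locale class_algebra = presentation V R
  for V :: "'v set" and R :: "('k::field, 'v) nc_poly set" +
  fixes S :: "('k, 'v) nc_poly set" and B :: "('k, ('k, 'v) nc_poly set) module"
  assumes S_subspace: "nc.subspace S" and S_subset: "S \<subseteq> carrier (free_alg V)" and S_one: "1 \<in> S"
    and S_mult: "f \<in> S \<Longrightarrow> g \<in> S \<Longrightarrow> f * g \<in> S"
    and B_carrier: "carrier B = presentation.cls V R ` S"
    and B_ops: "mult B = mult (presented_alg V R)" "add B = add (presented_alg V R)" "one B = one (presented_alg V R)"
      "zero B = zero (presented_alg V R)" "module.smult B = module.smult (presented_alg V R)"
begin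

lemma S_F: "f \<in> S \<Longrightarrow> f \<in> \<F>" using S_subset by blast

lemmas S_add = nc.subspace_add[OF S_subspace] and S_scale = nc.subspace_scale[OF S_subspace]
  and S_zero = nc.subspace_0[OF S_subspace] and S_sum = nc.subspace_sum[OF S_subspace]

lemma B_simps:
  "f \<in> \<F> \<Longrightarrow> g \<in> \<F> \<Longrightarrow> cls f \<otimes>\<^bsub>B\<^esub> cls g = cls (f * g)"
  "f \<in> \<F> \<Longrightarrow> g \<in> \<F> \<Longrightarrow> cls f \<oplus>\<^bsub>B\<^esub> cls g = cls (f + g)"
  "\<one>\<^bsub>B\<^esub> = cls 1" "\<zero>\<^bsub>B\<^esub> = cls 0" "f \<in> \<F> \<Longrightarrow> c \<odot>\<^bsub>B\<^esub> cls f = cls (c \<cdot> f)"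
  by (simp_all add: B_ops P_mult P_add P_one P_zero P_smult)

lemma ring_B: "ring B"
proof (rule ringI)
  show "abelian_group B"
  proof (rule abelian_groupI)
    fix a assume "a \<in> carrier B"
    then obtain f where f: "a = cls f" "f \<in> S" by (auto simp: B_carrier)
    then show "\<exists>b\<in>carrier B. b \<oplus>\<^bsub>B\<^esub> a = \<zero>\<^bsub>B\<^esub>"
      using S_scale[of f "- 1"] by (intro bexI[of _ "cls (- f)"]) (auto simp: B_carrier B_simps S_F)
  qed (auto simp: B_carrier B_simps S_F S_add S_zero free_alg_closed ac_simps)
  show "monoid B"
    by (rule monoidI) (auto simp: B_carrier B_simps S_F S_mult S_one free_alg_closed mult.assoc)
qed (auto simp: B_carrier B_simps S_F free_alg_closed distrib_left distrib_right)

sublocale B: ring B by (rule ring_B)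

lemma a_inv_cls: "f \<in> S \<Longrightarrow> \<ominus>\<^bsub>B\<^esub> cls f = cls (- f)"
  using S_scale[of f "- 1"] by (intro B.minus_equality) (auto simp: B_carrier B_simps S_F)

lemma finsum_cls:
  assumes "finite A" "\<And>i. i \<in> A \<Longrightarrow> h i \<in> S"
  shows "finsum B (\<lambda>i. cls (h i)) A = cls (\<Sum>i\<in>A. h i)"
  using assms
proof (induction A)
  case (insert i A)
  then have "(\<lambda>i. cls (h i)) \<in> A \<rightarrow> carrier B" "cls (h i) \<in> carrier B" by (auto simp: B_carrier)
  then show ?case using insert by (simp add: B_simps S_F S_sum)
qed (simp add: B_simps)

lemma list_mult_cls:
  assumes "set fs \<subseteq> \<F>"
  shows "list_mult B (map cls fs) = cls (prod_list fs)" "prod_list fs \<in> \<F>"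
  using assms by (induction fs) (auto simp: list_mult_def B_simps free_alg_closed)

lemma alg_span_cls:
  assumes "T \<subseteq> S"
  shows "alg_span B (cls ` T) = cls ` nc.span T"
  unfolding alg_span_def
proof (rule hull_unique)
  have sub: "nc.span T \<subseteq> S" using assms S_subspace by (rule nc.span_minimal)
  show "cls ` T \<subseteq> cls ` nc.span T" by (intro image_mono nc.span_superset)
  have "subgroup (cls ` nc.span T) (add_monoid B)"
  proof (rule B.add.subgroupI)
    fix a assume "a \<in> cls ` nc.span T"
    then show "\<ominus>\<^bsub>B\<^esub> a \<in> cls ` nc.span T"
      using sub by (auto simp: a_inv_cls intro!: imageI nc.span_neg)
  next
    fix a b assume "a \<in> cls ` nc.span T" "b \<in> cls ` nc.span T"
    then show "a \<oplus>\<^bsub>B\<^esub> b \<in> cls ` nc.span T"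
      using sub S_F by (auto simp: B_simps subset_iff intro!: imageI nc.span_add)
  qed (use sub nc.span_zero in \<open>auto simp: B_carrier\<close>)
  then show "alg_subspace B (cls ` nc.span T)"
    unfolding alg_subspace_def additive_subgroup_def
    using sub S_F by (auto simp: B_simps subset_iff intro!: imageI nc.span_scale)
next
  fix H assume H: "cls ` T \<subseteq> H" "alg_subspace B H"
  then interpret H: additive_subgroup H B by (simp add: alg_subspace_def)
  have "f \<in> S \<and> cls f \<in> H" if "f \<in> nc.span T" for f
    using that
  proof (induction rule: nc.span_induct_alt)
    case base
    then show ?case using H.zero_closed by (simp add: B_simps S_zero)
  next
    case (step c f g)
    then have "f \<in> S" "cls f \<in> H" using assms H(1) by auto
    moreover have "c \<odot>\<^bsub>B\<^esub> cls f \<in> H" using \<open>cls f \<in> H\<close> H(2) by (simp add: alg_subspace_def)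
    ultimately have "cls (c \<cdot> f) \<in> H" by (simp add: B_simps S_F)
    from H.a_closed[OF this] step \<open>f \<in> S\<close> have "cls (c \<cdot> f) \<oplus>\<^bsub>B\<^esub> cls g \<in> H" by blast
    then show ?case using step \<open>f \<in> S\<close> by (simp add: B_simps S_F S_add S_scale)
  qed
  then show "cls ` nc.span T \<subseteq> H" by auto
qed

end

context presentation
begin

lemma class_algebra_P: "class_algebra V R \<F> P"
  by unfold_locales (simp_all add: subspace_free_alg free_alg_closed P_carrier)

lemma subalg_hull_cls:
  assumes T: "T \<subseteq> \<F>"
  defines "S \<equiv> nc.span {prod_list fs | fs. set fs \<subseteq> T}"
  shows "subalg P hull (cls ` T) = cls ` S" "class_algebra V R S (generated_alg P (cls ` T))"
proof -
  interpret P: class_algebra V R \<F> P by (rule class_algebra_P)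
  have prod: "prod_list fs \<in> \<F>" if "set fs \<subseteq> T" for fs
    using P.list_mult_cls(2) that T by blast
  have sub: "S \<subseteq> \<F>"
    unfolding S_def by (rule nc.span_minimal[OF _ subspace_free_alg]) (auto intro: prod)
  have base: "prod_list fs \<in> S" if "set fs \<subseteq> T" for fs
    unfolding S_def using that by (intro nc.span_base) blast
  have S: "nc.subspace S" unfolding S_def by simp
  have one: "1 \<in> S" using base[of "[]"] by simp
  have mult: "f * g \<in> S" if f: "f \<in> S" and g: "g \<in> S" for f g
    using f unfolding S_def
  proof (induction rule: nc.span_induct_alt)
    case base
    then show ?case by (simp add: nc.span_zero)
  next
    case (step c f f')
    then obtain fs where fs: "f = prod_list fs" "set fs \<subseteq> T" by auto
    have "f * g \<in> nc.span {prod_list fs | fs. set fs \<subseteq> T}"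
      using g unfolding S_def
    proof (induction rule: nc.span_induct_alt)
      case (step c h h')
      then obtain gs where "h = prod_list gs" "set gs \<subseteq> T" by auto
      then have "f * h = prod_list (fs @ gs)" "set (fs @ gs) \<subseteq> T" using fs by auto
      then have "f * h \<in> nc.span {prod_list fs | fs. set fs \<subseteq> T}" by (intro nc.span_base) blast
      then show ?case using step by (simp add: distrib_left nc.span_add nc.span_scale)
    qed (simp add: nc.span_zero)
    then show ?case using step by (simp add: distrib_right nc.span_add nc.span_scale)
  qed
  show hull: "subalg P hull (cls ` T) = cls ` S"
  proof (rule hull_unique)
    show "cls ` T \<subseteq> cls ` S"
    proof (intro image_mono subsetI)
      fix f assume "f \<in> T"
      then show "f \<in> S" using base[of "[f]"] by simp
    qed
    have "subring (cls ` S) P"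
    proof (rule P.B.subringI)
      show "cls ` S \<subseteq> carrier P" using sub by (auto simp: P_carrier)
      show "\<one>\<^bsub>P\<^esub> \<in> cls ` S" using one by (simp add: P_one)
    next
      fix a assume "a \<in> cls ` S"
      then show "\<ominus>\<^bsub>P\<^esub> a \<in> cls ` S"
        using sub nc.subspace_neg[OF S] by (auto simp: P.a_inv_cls subset_iff)
    next
      fix a b assume "a \<in> cls ` S" "b \<in> cls ` S"
      then show "a \<otimes>\<^bsub>P\<^esub> b \<in> cls ` S" "a \<oplus>\<^bsub>P\<^esub> b \<in> cls ` S"
        using sub mult nc.subspace_add[OF S] by (auto simp: P_mult P_add subset_iff)
    qed
    then show "subalg P (cls ` S)"
      unfolding subalg_def using sub nc.subspace_scale[OF S] by (auto simp: P_smult subset_iff)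
  next
    fix H assume H: "cls ` T \<subseteq> H" "subalg P H"
    then interpret H: subring H P by (simp add: subalg_def)
    have p: "cls (prod_list fs) \<in> H" if "set fs \<subseteq> T" for fs
      using that
    proof (induction fs)
      case Nil
      then show ?case using H.one_closed by (simp add: P_one)
    next
      case (Cons f fs)
      then have "cls f \<otimes>\<^bsub>P\<^esub> cls (prod_list fs) \<in> H" using H(1) by (intro H.m_closed) auto
      then show ?case using Cons.prems T prod by (auto simp: P_mult)
    qed
    have "f \<in> \<F> \<and> cls f \<in> H" if "f \<in> S" for f
      using that unfolding S_def
    proof (induction rule: nc.span_induct_alt)
      case base
      have "\<zero>\<^bsub>P\<^esub> \<in> H" using subgroup.one_closed[OF H.subgroup_axioms] by simp
      then show ?case by (simp add: P_zero free_alg_closed)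
    next
      case (step c f g)
      then have f: "f \<in> \<F>" "cls f \<in> H" using p prod by auto
      moreover have "c \<odot>\<^bsub>P\<^esub> cls f \<in> H" using f(2) H(2) by (simp add: subalg_def)
      ultimately have "cls (c \<cdot> f) \<in> H" by (simp add: P_smult)
      then have "cls (c \<cdot> f) \<oplus>\<^bsub>P\<^esub> cls g \<in> H"
        using step subgroup.m_closed[OF H.subgroup_axioms] by simp
      then show ?case using step f(1) by (simp add: P_add free_alg_closed)
    qed
    then show "cls ` S \<subseteq> H" by auto
  qed
  show "class_algebra V R S (generated_alg P (cls ` T))"
    by unfold_locales (simp_all add: S sub one mult generated_alg_def hull)
qed

end


section \<open>The quantum grassmannian and its twist\<close>

context qmatrices
begin

lemma qmat_relations_free_alg: "qmat_relations q m n \<subseteq> carrier (free_alg V)"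
  unfolding qmat_relations_def Let_def
  by (safe; intro free_alg_closed) (auto simp: qmat_indices_def)

lemma presentation_qmat: "presentation V (qmat_relations q m n)"
  by unfold_locales (rule qmat_relations_free_alg)

sublocale Q: presentation V "qmat_relations q m n"
  by (rule presentation_qmat)

abbreviation cls :: "('k, nat \<times> nat) nc_poly \<Rightarrow> 'k qelem" where "cls \<equiv> Q.cls"

lemma cls_eq_iff: "f \<in> Q.\<F> \<Longrightarrow> g \<in> Q.\<F> \<Longrightarrow> cls f = cls g \<longleftrightarrow> f \<approx> g"
  by (simp add: Q.cls_eq_iff Q.cong_def cong_def \<R>_def)

lemma lap_free_alg:
  assumes "I \<subseteq> {1..m}" "set js \<subseteq> {1..n}"
  shows "lap q x I js \<in> Q.\<F>"
  using assms
proof (induction js arbitrary: I)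
  case (Cons j js)
  then show ?case
    unfolding lap.simps
    by (intro nc.subspace_sum[OF subspace_free_alg] free_alg_closed Cons.IH) (auto simp: mem_V)
qed (simp add: free_alg_closed)

lemma plucker_free_alg: "J \<in> \<G> \<Longrightarrow> plucker J \<in> Q.\<F>"
  using grass_subset grass_finite by (intro lap_free_alg) auto

text \<open>Permutations are replaced by the lists of rows they produce; Coxeter length then becomes
  the number of inversions of such a list, and the sum over lists is the iterated Laplace
  expansion.\<close>

lemma qplucker_eq:
  assumes J: "J \<in> \<G>"
  shows "qplucker q m n J = cls (plucker J)"
proof -
  let ?js = "sorted_list_of_set J"
  let ?r = "\<lambda>\<sigma>. map (\<lambda>a. Suc (\<sigma> a)) [0..<m]"
  have Q: "qmat q m n = Q.P" by (simp add: qmat_def)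
  interpret P: class_algebra V "qmat_relations q m n" Q.\<F> Q.P by (rule Q.class_algebra_P)
  have cJ: "card J = m" using J by (simp add: grass_indices_def)
  then have len: "length ?js = m" by simp
  have upt: "sorted_list_of_set {1..m} = [1..<Suc m]"
    by (metis atLeastLessThanSuc_atLeastAtMost sorted_list_of_set_range)
  have rows: "sorted_list_of_set {1..m} ! a = Suc a" if "a < m" for a
    unfolding upt using that by (simp del: upt_Suc)
  have js: "?js ! a \<in> {1..n}" if "a < m" for a
    using nth_mem[of a ?js] that len grass_subset[OF J] grass_finite[OF J] by auto
  have perm: "\<sigma> a < m" if "\<sigma> permutes {..<m}" "a < m" for \<sigma> a
    using permutes_in_image[OF that(1), of a] that(2) by simp
  define h where "h \<sigma> = (- q) ^ list_inversions (?r \<sigma>) \<cdot> prod_list (map2 x (?r \<sigma>) ?js)" for \<sigma>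
  have factors: "map2 x (?r \<sigma>) ?js = map (\<lambda>a. x (Suc (\<sigma> a)) (?js ! a)) [0..<m]" for \<sigma>
    by (rule nth_equalityI) (simp_all add: cJ)
  have factor_mem: "set (map2 x (?r \<sigma>) ?js) \<subseteq> Q.\<F>" if "\<sigma> permutes {..<m}" for \<sigma>
    unfolding factors using perm[OF that] js by (auto simp: mem_V Suc_le_eq intro!: free_alg_closed)
  have summand: "(- q) ^ coxeter_length m \<sigma> \<odot>\<^bsub>Q.P\<^esub> list_mult Q.P
      (map (\<lambda>a. qmat_gen q m n (sorted_list_of_set {1..m} ! \<sigma> a) (?js ! a)) [0..<m]) = cls (h \<sigma>)"
    if \<sigma>: "\<sigma> permutes {..<m}" for \<sigma>
  proof -
    have "map (\<lambda>a. qmat_gen q m n (sorted_list_of_set {1..m} ! \<sigma> a) (?js ! a)) [0..<m] = map cls (map2 x (?r \<sigma>) ?js)"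
      unfolding factors using perm[OF \<sigma>] rows by (simp add: qmat_gen_def presented_gen_def Q.cls_def)
    moreover have "coxeter_length m \<sigma> = list_inversions (?r \<sigma>)"
    proof -
      have "inj_on (\<lambda>a. Suc (\<sigma> a)) {..<m}"
        using permutes_inj[OF \<sigma>] by (auto simp: inj_on_def)
      from list_inversions_map[OF this] show ?thesis
        by (simp add: coxeter_length_eq_inversions[OF \<sigma>] inversions_def)
    qed
    ultimately show ?thesis
      using P.list_mult_cls[OF factor_mem[OF \<sigma>]] by (simp only: P.B_simps h_def)
  qed
  have "qplucker q m n J = finsum Q.P (\<lambda>\<sigma>. cls (h \<sigma>)) {\<sigma>. \<sigma> permutes {..<m}}"
    unfolding qplucker_def qminor_def Let_def Q card_atLeastAtMost diff_Suc_1
  proof (rule P.B.finsum_cong')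
    show "(\<lambda>\<sigma>. cls (h \<sigma>)) \<in> {\<sigma>. \<sigma> permutes {..<m}} \<rightarrow> carrier Q.P"
      using P.list_mult_cls(2)[OF factor_mem] by (auto simp: Q.P_carrier h_def free_alg_closed)
  qed (rule refl, rule summand, simp)
  also have "\<dots> = cls (\<Sum>\<sigma>\<in>{\<sigma>. \<sigma> permutes {..<m}}. h \<sigma>)"
    using P.list_mult_cls(2)[OF factor_mem]
    by (intro P.finsum_cls) (auto simp: h_def free_alg_closed finite_permutations)
  also have "(\<Sum>\<sigma>\<in>{\<sigma>. \<sigma> permutes {..<m}}. h \<sigma>) = plucker J"
  proof -
    have "plucker J = (\<Sum>r\<in>permutations_of_set {1..m}. (- q) ^ list_inversions r \<cdot> prod_list (map2 x r ?js))"
      by (rule lap_eq_sum_permutations) (simp_all add: cJ)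
    then show ?thesis
      unfolding h_def using sum.reindex_bij_betw[OF bij_betw_permutes_permutations_of_set,
        of "\<lambda>r. (- q) ^ list_inversions r \<cdot> prod_list (map2 x r ?js)" m] by (simp only:)
  qed
  finally show ?thesis .
qed

lemma Gr_eq: "Gr = nc.span {prod_list fs | fs. set fs \<subseteq> plucker ` \<G>}"
proof -
  have "{prod_list fs | fs. set fs \<subseteq> plucker ` \<G>} = {monomial Js | Js. set Js \<subseteq> \<G>}"
  proof (intro equalityI subsetI)
    fix f assume "f \<in> {prod_list fs | fs. set fs \<subseteq> plucker ` \<G>}"
    then obtain fs where "f = prod_list fs" "fs \<in> lists (plucker ` \<G>)" by auto
    then show "f \<in> {monomial Js | Js. set Js \<subseteq> \<G>}" unfolding lists_image by auto
  qed fastforce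
  then show ?thesis by (simp add: Gr_def)
qed

lemma qplucker_image: "qplucker q m n ` \<G> = cls ` plucker ` \<G>"
  by (auto simp: qplucker_eq image_image cong: image_cong)

lemma class_algebra_qgrass: "class_algebra V (qmat_relations q m n) Gr (qgrass q m n)"
  using Q.subalg_hull_cls(2)[of "plucker ` \<G>"] plucker_free_alg
  unfolding Gr_eq qgrass_def qplucker_image by (auto simp: qmat_def)

sublocale A: class_algebra V "qmat_relations q m n" Gr "qgrass q m n"
  by (rule class_algebra_qgrass)

lemma monomial_Gr: "set Js \<subseteq> \<G> \<Longrightarrow> monomial Js \<in> Gr"
  unfolding Gr_def by (rule nc.span_base) blast

definition Gr_degree :: "(nat \<Rightarrow>\<^sub>0 int) \<Rightarrow> ('k, nat \<times> nat) nc_poly set" where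
  "Gr_degree s = nc.span {monomial Js | Js. set Js \<subseteq> \<G> \<and> monomial_degree Js = s}"

lemma Gr_degree_subset: "Gr_degree s \<subseteq> Gr"
  unfolding Gr_degree_def Gr_def by (rule nc.span_mono) blast

lemma Gr_degree_of_degree: "Gr_degree s \<subseteq> of_degree s"
  unfolding Gr_degree_def
  by (rule nc.span_minimal[OF _ of_degree_subspace]) (clarify, rule monomial_of_degree)

lemma qgrass_component_eq: "qgrass_component q m n s = cls ` Gr_degree s"
proof -
  have "list_mult (qgrass q m n) (map (qplucker q m n) Js) = cls (monomial Js)" if "set Js \<subseteq> \<G>" for Js
  proof -
    have "map (qplucker q m n) Js = map cls (map plucker Js)"
      using that by (auto simp: qplucker_eq)
    moreover have "set (map plucker Js) \<subseteq> Q.\<F>" using that plucker_free_alg by auto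
    ultimately show ?thesis using A.list_mult_cls(1) by metis
  qed
  then have "{list_mult (qgrass q m n) (map (qplucker q m n) Js) | Js. set Js \<subseteq> \<G> \<and> monomial_degree Js = s}
     = cls ` {monomial Js | Js. set Js \<subseteq> \<G> \<and> monomial_degree Js = s}"
    by (auto simp: image_def)
  moreover have "{monomial Js | Js. set Js \<subseteq> \<G> \<and> monomial_degree Js = s} \<subseteq> Gr"
    by (clarify, rule monomial_Gr)
  ultimately show ?thesis
    unfolding qgrass_component_def Gr_degree_def by (simp add: A.alg_span_cls)
qed

section \<open>Homogeneous components and the directness of the grading\<close>

definition part :: "(nat \<Rightarrow>\<^sub>0 int) \<Rightarrow> ('k, nat \<times> nat) nc_poly \<Rightarrow> ('k, nat \<times> nat) nc_poly" where
  "part s = degree_scale (\<lambda>t. if t = s then 1 else 0)"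

lemma lin_part: "lin (part s)"
  by (simp add: part_def lin_degree_scale)

lemma part_mem: "f \<in> \<R> \<Longrightarrow> part s f \<in> \<R>"
  by (simp add: part_def degree_scale_mem)

lemma part_of_degree: "f \<in> of_degree t \<Longrightarrow> part s f = (if t = s then f else 0)"
  by (simp add: part_def of_degree_def)

lemma part_Gr:
  assumes "f \<in> Gr"
  shows "part s f \<in> Gr_degree s"
  using assms unfolding Gr_def
proof (induction rule: nc.span_induct_alt)
  case base
  then show ?case by (simp add: lin_zero[OF lin_part] Gr_degree_def nc.span_zero)
next
  case (step c b f)
  then obtain Js where Js: "b = monomial Js" "set Js \<subseteq> \<G>" by auto
  have "part s b \<in> Gr_degree s"
    unfolding Js(1) part_of_degree[OF monomial_of_degree[OF Js(2)]]
    using Js by (auto simp: Gr_degree_def nc.span_zero intro: nc.span_base)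
  with step show ?case
    unfolding lin_simps[OF lin_part]
    by (auto simp: Gr_degree_def intro: nc.span_add nc.span_scale)
qed

lemma part_Gr_subset: "f \<in> Gr \<Longrightarrow> part s f \<in> Gr"
  using part_Gr Gr_degree_subset by blast

lemma monomial_degree_lattice: "set Js \<subseteq> \<G> \<Longrightarrow> monomial_degree Js \<in> int_lattice n"
proof (induction Js)
  case (Cons J Js)
  have "Poly_Mapping.keys (content J) \<subseteq> {1..n}"
    using Cons.prems grass_finite[of J] grass_subset[of J] by (auto simp: in_keys_iff lookup_content split: if_splits)
  then show ?case using Cons Poly_Mapping.keys_add[of "content J" "monomial_degree Js"]
    by (auto simp: int_lattice_def)
qed (simp add: int_lattice_def)

lemma part_outside:
  assumes "f \<in> Gr" "s \<notin> int_lattice n"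
  shows "part s f = 0"
  using assms(1) unfolding Gr_def
proof (induction rule: nc.span_induct_alt)
  case (step c b f)
  then obtain Js where Js: "b = monomial Js" "set Js \<subseteq> \<G>" by auto
  then have "part s b = 0"
    using part_of_degree[OF monomial_of_degree[OF Js(2)], of s] monomial_degree_lattice[OF Js(2)] assms(2) by auto
  with step show ?case by (simp add: lin_simps[OF lin_part])
qed (simp add: lin_zero[OF lin_part])

lemma sum_parts: "\<exists>D. finite D \<and> (\<forall>s. s \<notin> D \<longrightarrow> part s f = 0) \<and> (\<Sum>s\<in>D. part s f) = f"
proof -
  let ?D = "(\<lambda>w. word_content (letters w)) ` Poly_Mapping.keys f"
  have part: "part s f = (\<Sum>w\<in>Poly_Mapping.keys f. Poly_Mapping.lookup f w \<cdot>
      ((if word_content (letters w) = s then 1 else 0) \<cdot> word (letters w)))" for s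
    by (simp add: part_def degree_scale_def lin_ext_def)
  have "(\<Sum>s\<in>?D. part s f) = (\<Sum>w\<in>Poly_Mapping.keys f. \<Sum>s\<in>?D. Poly_Mapping.lookup f w \<cdot>
     ((if word_content (letters w) = s then 1 else 0) \<cdot> word (letters w)))"
    unfolding part by (rule sum.swap)
  also have "\<dots> = (\<Sum>w\<in>Poly_Mapping.keys f. Poly_Mapping.lookup f w \<cdot> word (letters w))"
  proof (rule sum.cong[OF refl])
    fix w assume w: "w \<in> Poly_Mapping.keys f"
    have "(\<Sum>s\<in>?D. Poly_Mapping.lookup f w \<cdot> ((if word_content (letters w) = s then 1 else 0) \<cdot> word (letters w)))
      = (\<Sum>s\<in>?D. if word_content (letters w) = s then Poly_Mapping.lookup f w \<cdot> word (letters w) else 0)"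
      by (rule sum.cong) auto
    also have "\<dots> = Poly_Mapping.lookup f w \<cdot> word (letters w)"
      using w by (subst sum.delta') auto
    finally show "(\<Sum>s\<in>?D. Poly_Mapping.lookup f w \<cdot> ((if word_content (letters w) = s then 1 else 0) \<cdot> word (letters w)))
      = Poly_Mapping.lookup f w \<cdot> word (letters w)" .
  qed
  also have "\<dots> = f" by (rule nc_poly_eq_sum[symmetric])
  finally have "(\<Sum>s\<in>?D. part s f) = f" .
  moreover have "part s f = 0" if "s \<notin> ?D" for s
    unfolding part using that by (intro sum.neutral) auto
  ultimately show ?thesis by (intro exI[of _ ?D]) auto
qed

text \<open>Only components that are nonzero in the quotient count, as in the definition of
  \<open>twist\<close>. Components in \<open>\<R>\<close> are left out, so the parts over the
  support add up to \<open>f\<close> only modulo \<open>\<R>\<close>.\<close>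

definition support :: "('k, nat \<times> nat) nc_poly \<Rightarrow> (nat \<Rightarrow>\<^sub>0 int) set" where
  "support f = {s. cls (part s f) \<noteq> \<zero>\<^bsub>qgrass q m n\<^esub>}"

lemma cls_eq_zero_iff: "f \<in> Gr \<Longrightarrow> cls f = \<zero>\<^bsub>qgrass q m n\<^esub> \<longleftrightarrow> f \<in> \<R>"
  by (simp add: A.B_simps cls_eq_iff A.S_F free_alg_closed cong_def)

lemma support_sum:
  assumes "f \<in> Gr"
  shows "finite (support f)" "(\<Sum>s\<in>support f. part s f) \<approx> f"
proof -
  obtain D where D: "finite D" "\<And>s. s \<notin> D \<Longrightarrow> part s f = 0" "(\<Sum>s\<in>D. part s f) = f"
    using sum_parts[of f] by auto
  have sub: "support f \<subseteq> D"
    using D(2) by (auto simp: support_def A.B_simps)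
  then show "finite (support f)" using D(1) finite_subset by blast
  have "(\<Sum>s\<in>D. part s f) = (\<Sum>s\<in>support f. part s f) + (\<Sum>s\<in>D - support f. part s f)"
    using sub D(1) by (metis add.commute sum.subset_diff)
  moreover have "(\<Sum>s\<in>D - support f. part s f) \<in> \<R>"
    using part_Gr_subset[OF assms] by (intro mem_sum) (auto simp: support_def cls_eq_zero_iff)
  ultimately have "f \<approx> (\<Sum>s\<in>support f. part s f)"
    unfolding cong_def D(3) by (metis add_diff_cancel_left')
  then show "(\<Sum>s\<in>support f. part s f) \<approx> f" by (rule cong_sym)
qed

text \<open>Uniqueness holds because \<open>part u\<close> is defined on the whole free algebra and
  preserves \<open>\<R>\<close>: applied to any decomposition of the coset, it isolates the summand
  of degree \<open>u\<close>.\<close>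

lemma homogeneous_parts_eq:
  assumes f: "f \<in> Gr"
  shows "homogeneous_parts (qgrass q m n) (int_lattice n) (qgrass_component q m n) (cls f) = (\<lambda>s. cls (part s f))"
  unfolding homogeneous_parts_def
proof (rule the_equality, intro conjI ballI allI impI)
  let ?A = "qgrass q m n"
  show "cls (part s f) \<in> qgrass_component q m n s" for s
    unfolding qgrass_component_eq using part_Gr[OF f] by blast
  show "cls (part s f) = \<zero>\<^bsub>?A\<^esub>" if "s \<notin> int_lattice n" for s
    using part_outside[OF f that] by (simp add: A.B_simps)
  show "finite {s. cls (part s f) \<noteq> \<zero>\<^bsub>?A\<^esub>}"
    using support_sum(1)[OF f] by (simp add: support_def)
  have "finsum ?A (\<lambda>s. cls (part s f)) (support f) = cls (\<Sum>s\<in>support f. part s f)"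
    by (intro A.finsum_cls support_sum(1) f part_Gr_subset)
  also have "\<dots> = cls f"
    using support_sum(2)[OF f] f part_Gr_subset[OF f] by (subst cls_eq_iff) (auto intro: A.S_F A.S_sum)
  finally show "(\<Oplus>\<^bsub>?A\<^esub>s\<in>{s. cls (part s f) \<noteq> \<zero>\<^bsub>?A\<^esub>}. cls (part s f)) = cls f"
    by (simp add: support_def)
next
  let ?A = "qgrass q m n"
  fix h assume h: "(\<forall>s\<in>int_lattice n. h s \<in> qgrass_component q m n s) \<and>
      (\<forall>s. s \<notin> int_lattice n \<longrightarrow> h s = \<zero>\<^bsub>?A\<^esub>) \<and> finite {s. h s \<noteq> \<zero>\<^bsub>?A\<^esub>} \<and>
      (\<Oplus>\<^bsub>?A\<^esub>s\<in>{s. h s \<noteq> \<zero>\<^bsub>?A\<^esub>}. h s) = cls f"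
  let ?D = "{s. h s \<noteq> \<zero>\<^bsub>?A\<^esub>}"
  have "\<exists>g. g \<in> Gr_degree s \<and> h s = cls g" for s
  proof (cases "s \<in> int_lattice n")
    case False
    then have "h s = cls 0" using h by (simp add: A.B_simps)
    moreover have "0 \<in> Gr_degree s" by (simp add: Gr_degree_def nc.span_zero)
    ultimately show ?thesis by blast
  qed (use h in \<open>auto simp: qgrass_component_eq\<close>)
  then obtain g where g: "\<And>s. g s \<in> Gr_degree s" "\<And>s. h s = cls (g s)" by metis
  have gGr: "g s \<in> Gr" for s using g(1) Gr_degree_subset by blast
  have "cls f = finsum ?A (\<lambda>s. cls (g s)) ?D" using h by (simp add: g(2))
  also have "\<dots> = cls (\<Sum>s\<in>?D. g s)" using h gGr by (intro A.finsum_cls) auto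
  finally have "f \<approx> (\<Sum>s\<in>?D. g s)"
    using f gGr by (subst (asm) cls_eq_iff) (auto intro: A.S_F A.S_sum)
  then have *: "part u f - part u (\<Sum>s\<in>?D. g s) \<in> \<R>" for u
    using part_mem by (simp add: cong_def flip: lin_diff[OF lin_part])
  have "part u (\<Sum>s\<in>?D. g s) = (if u \<in> ?D then g u else 0)" for u
  proof -
    have "part u (g s) = (if s = u then g s else 0)" for s
      using part_of_degree g(1) Gr_degree_of_degree by blast
    then show ?thesis using h by (simp add: lin_sum[OF lin_part])
  qed
  with * have **: "part u f \<approx> (if u \<in> ?D then g u else 0)" for u by (simp add: cong_def)
  show "h = (\<lambda>s. cls (part s f))"
  proof
    fix u
    have "cls (part u f) = cls (if u \<in> ?D then g u else 0)"
      using **[of u] part_Gr_subset[OF f] gGr by (subst cls_eq_iff) (auto intro: A.S_F A.S_zero)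
    also have "\<dots> = h u" using g(2)[of u] by (simp add: A.B_simps)
    finally show "h u = cls (part u f)" by simp
  qed
qed

lemma to_front_free_alg: "to_front f \<in> Q.\<F>"
proof (induction f rule: nc_poly_induct)
  case (word w)
  show ?case
  proof (cases "set w \<subseteq> V")
    case True
    have "front w \<in> Q.\<F>" using True
    proof (induction w)
      case (Cons v w)
      then show ?case
        using mn by (cases v) (auto simp: front_def mem_V intro!: free_alg_closed)
    qed (simp add: front_def free_alg_closed)
    moreover have "rear w \<in> Q.\<F>"
      using True by (force simp: rear_def word_mem_free_alg qmat_indices_def)
    ultimately show ?thesis using True by (simp add: to_front_word free_alg_closed)
  qed (simp add: to_front_word free_alg_closed)
qed (simp_all add: lin_simps[OF lin_to_front] free_alg_closed)

end

section \<open>From \<open>\<theta>\<close> on representatives to the isomorphism of the twist with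
  the grassmannian\<close>

context qgrass_twisting
begin

lemma \<theta>_free_alg: "\<theta> f \<in> Q.\<F>"
  by (simp add: \<theta>_def cycle_def to_front_free_alg)

lemma cls_\<theta>_eq_iff: "cls (\<theta> f) = cls (\<theta> g) \<longleftrightarrow> \<theta> f \<approx> \<theta> g"
  by (intro cls_eq_iff \<theta>_free_alg)

lemma \<theta>_mult_of_degree:
  assumes "f \<in> Gr_degree s" "g \<in> Gr_degree t"
  shows "\<theta> (f * g) \<approx> inverse (cocycle s t) \<cdot> (\<theta> f * \<theta> g)"
proof -
  let ?c = "inverse (cocycle s t)"
  have 1: "\<theta> (monomial Js * g) - ?c \<cdot> (\<theta> (monomial Js) * \<theta> g) \<in> \<R>"
    if Js: "set Js \<subseteq> \<G>" "monomial_degree Js = s" for Js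
  proof -
    have "lin (\<lambda>g. \<theta> (monomial Js * g) - ?c \<cdot> (\<theta> (monomial Js) * \<theta> g))"
      by (intro lin_diff_fun lin_scaled lin_comp[OF lin_\<theta> lin_mult_left] lin_comp[OF lin_mult_left lin_\<theta>])
    note lin = lin_add[OF this] lin_scale[OF this] lin_zero[OF this]
    show ?thesis
      using assms(2) unfolding Gr_degree_def
    proof (induction rule: nc.span_induct_alt)
      case base
      show ?case by (simp only: lin(3) mem_zero)
    next
      case (step c b f)
      then have "\<theta> (monomial Js * b) - ?c \<cdot> (\<theta> (monomial Js) * \<theta> b) \<in> \<R>"
        using \<theta>_monomial_mult[OF Js(1)] Js(2) by (auto simp: cong_def)
      with step(2) show ?case unfolding lin(1,2) by (intro mem_add mem_scale)
    qed
  qed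
  have "lin (\<lambda>f. \<theta> (f * g) - ?c \<cdot> (\<theta> f * \<theta> g))"
    by (intro lin_diff_fun lin_scaled lin_comp[OF lin_\<theta> lin_mult_right] lin_comp[OF lin_mult_right lin_\<theta>])
  note lin = lin_add[OF this] lin_scale[OF this] lin_zero[OF this]
  have "\<theta> (f * g) - ?c \<cdot> (\<theta> f * \<theta> g) \<in> \<R>"
    using assms(1) unfolding Gr_degree_def
  proof (induction rule: nc.span_induct_alt)
    case base
    show ?case by (simp only: lin(3) mem_zero)
  next
    case (step c b f)
    then have "\<theta> (b * g) - ?c \<cdot> (\<theta> b * \<theta> g) \<in> \<R>" using 1 by auto
    with step(2) show ?case unfolding lin(1,2) by (intro mem_add mem_scale)
  qed
  then show ?thesis by (simp add: cong_def)
qed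

text \<open>The product of the twist, lifted to representatives; summing over the supports matches
  the index sets of \<open>twist\<close>.\<close>

definition twisted_product :: "('k, nat \<times> nat) nc_poly \<Rightarrow> ('k, nat \<times> nat) nc_poly \<Rightarrow> ('k, nat \<times> nat) nc_poly" where
  "twisted_product f g = (\<Sum>s\<in>support f. \<Sum>t\<in>support g. cocycle s t \<cdot> (part s f * part t g))"

lemma twisted_product_Gr: "f \<in> Gr \<Longrightarrow> g \<in> Gr \<Longrightarrow> twisted_product f g \<in> Gr"
  unfolding twisted_product_def by (intro A.S_sum A.S_scale A.S_mult part_Gr_subset)

abbreviation twisted :: "('k, 'k qelem) module" where
  "twisted \<equiv> qgrass_twist p q m n"

lemma twisted_simps [simp]:
  "carrier twisted = carrier (qgrass q m n)" "add twisted = add (qgrass q m n)"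
  "zero twisted = zero (qgrass q m n)" "module.smult twisted = module.smult (qgrass q m n)"
  by (simp_all add: qgrass_twist_def twist_def)

lemma twisted_one: "\<one>\<^bsub>twisted\<^esub> = cls 1"
  by (simp add: qgrass_twist_def twist_def cocycle_zero A.B_simps free_alg_closed)

lemma twisted_mult:
  assumes f: "f \<in> Gr" and g: "g \<in> Gr"
  shows "cls f \<otimes>\<^bsub>twisted\<^esub> cls g = cls (twisted_product f g)"
proof -
  let ?A = "qgrass q m n"
  let ?h = "\<lambda>s t. cocycle s t \<cdot> (part s f * part t g)"
  have mem: "part s f \<in> Gr" "part s g \<in> Gr" for s
    using f g by (auto intro: part_Gr_subset)
  have inner: "cocycle s t \<odot>\<^bsub>?A\<^esub> (cls (part s f) \<otimes>\<^bsub>?A\<^esub> cls (part t g)) = cls (?h s t)" for s t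
    using mem by (simp add: A.B_simps A.S_F A.S_mult)
  have h: "?h s t \<in> Gr" for s t by (intro A.S_scale A.S_mult mem)
  have "cls f \<otimes>\<^bsub>twisted\<^esub> cls g = (\<Oplus>\<^bsub>?A\<^esub>s\<in>support f. \<Oplus>\<^bsub>?A\<^esub>t\<in>support g. cls (?h s t))"
    by (simp add: qgrass_twist_def twist_def homogeneous_parts_eq f g Let_def support_def inner)
  also have "\<dots> = (\<Oplus>\<^bsub>?A\<^esub>s\<in>support f. cls (\<Sum>t\<in>support g. ?h s t))"
    using h by (simp add: A.finsum_cls support_sum(1) g)
  also have "\<dots> = cls (twisted_product f g)"
    unfolding twisted_product_def by (intro A.finsum_cls support_sum(1) f A.S_sum h)
  finally show ?thesis .
qed

lemma \<theta>_twisted_product: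
  assumes f: "f \<in> Gr" and g: "g \<in> Gr"
  shows "\<theta> (twisted_product f g) \<approx> \<theta> f * \<theta> g"
proof -
  have "\<theta> (twisted_product f g) = (\<Sum>s\<in>support f. \<Sum>t\<in>support g. cocycle s t \<cdot> \<theta> (part s f * part t g))"
    by (simp add: twisted_product_def lin_simps[OF lin_\<theta>])
  also have "\<dots> \<approx> (\<Sum>s\<in>support f. \<Sum>t\<in>support g. cocycle s t \<cdot> (inverse (cocycle s t) \<cdot> (\<theta> (part s f) * \<theta> (part t g))))"
    by (intro cong_sum cong_scale \<theta>_mult_of_degree part_Gr f g)
  also have "\<dots> = (\<Sum>s\<in>support f. \<Sum>t\<in>support g. \<theta> (part s f) * \<theta> (part t g))"
    by (simp add: cocycle_nonzero)
  also have "\<dots> = \<theta> (\<Sum>s\<in>support f. part s f) * \<theta> (\<Sum>t\<in>support g. part t g)"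
    by (simp add: lin_sum[OF lin_\<theta>] sum_product)
  also have "\<dots> \<approx> \<theta> f * \<theta> g"
    by (intro cong_mult \<theta>_cong support_sum(2) f g)
  finally show ?thesis .
qed

definition rotation :: "'k qelem \<Rightarrow> 'k qelem" where
  "rotation C = cls (\<theta> (SOME f. f \<in> Gr \<and> cls f = C))"

text \<open>The choice of a representative is immaterial because \<open>\<theta>\<close> preserves
  congruence modulo \<open>\<R>\<close>.\<close>

lemma rotation_cls:
  assumes "f \<in> Gr"
  shows "rotation (cls f) = cls (\<theta> f)"
proof -
  let ?g = "SOME g. g \<in> Gr \<and> cls g = cls f"
  have "\<exists>g. g \<in> Gr \<and> cls g = cls f" using assms by blast
  from someI_ex[OF this] have g: "?g \<in> Gr" "cls ?g = cls f" by blast+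
  then have "?g \<approx> f"
    unfolding cls_eq_iff[OF A.S_F[OF g(1)] A.S_F[OF assms]] by blast
  then show ?thesis unfolding rotation_def cls_\<theta>_eq_iff by (rule \<theta>_cong)
qed

lemma \<theta>_Gr:
  assumes "f \<in> Gr"
  shows "\<exists>g\<in>Gr. \<theta> f \<approx> g"
  using assms unfolding Gr_def
proof (induction rule: nc.span_induct_alt)
  case base
  show ?case by (rule bexI[of _ 0]) (simp_all add: lin_zero[OF lin_\<theta>] nc.span_zero)
next
  case (step c b f)
  then obtain Js g where Js: "b = monomial Js" "set Js \<subseteq> \<G>" and g: "g \<in> Gr" "\<theta> f \<approx> g"
    by (auto simp: Gr_def)
  obtain \<mu> where "\<theta> b \<approx> \<mu> \<cdot> monomial (map rot Js)" using \<theta>_monomial_rot[OF Js(2)] Js(1) by auto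
  then have "\<theta> (c \<cdot> b + f) \<approx> c \<cdot> (\<mu> \<cdot> monomial (map rot Js)) + g"
    unfolding lin_simps[OF lin_\<theta>] by (intro cong_add cong_scale g(2))
  moreover have "c \<cdot> (\<mu> \<cdot> monomial (map rot Js)) + g \<in> Gr"
    using Js(2) by (intro A.S_add A.S_scale monomial_Gr g(1)) (auto intro: rot_grass)
  ultimately show ?case unfolding Gr_def by blast
qed

lemma rot_surj:
  assumes "set Js \<subseteq> \<G>"
  shows "\<exists>Ks. set Ks \<subseteq> \<G> \<and> map rot Ks = Js"
proof -
  obtain k where k: "n = Suc k" using mn by (cases n) auto
  have mem: "(rot ^^ k) J \<in> \<G>" if "J \<in> \<G>" for J k
    by (induction k) (simp_all add: that rot_grass)
  \<comment> \<open>Here \<open>k = n - 1\<close>, so \<open>rot ^^ k\<close> is the inverse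
    rotation.\<close>
  have "rot ((rot ^^ k) J) = J" if "J \<in> \<G>" for J
    using rot_power_n[OF that] k by simp
  then have "map rot (map (rot ^^ k) Js) = Js"
    using assms by (simp add: map_idI subset_iff)
  moreover have "set (map (rot ^^ k) Js) \<subseteq> \<G>" using assms mem by auto
  ultimately show ?thesis by blast
qed

lemma \<theta>_surjective:
  assumes "g \<in> Gr"
  shows "\<exists>f\<in>Gr. \<theta> f \<approx> g"
  using assms unfolding Gr_def
proof (induction rule: nc.span_induct_alt)
  case base
  show ?case by (rule bexI[of _ 0]) (simp_all add: lin_zero[OF lin_\<theta>] nc.span_zero)
next
  case (step c b g)
  then obtain Js f where Js: "b = monomial Js" "set Js \<subseteq> \<G>" and f: "f \<in> Gr" "\<theta> f \<approx> g"
    by (auto simp: Gr_def)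
  obtain Ks where Ks: "set Ks \<subseteq> \<G>" "map rot Ks = Js" using rot_surj[OF Js(2)] by auto
  obtain \<mu> where \<mu>: "\<mu> \<noteq> 0" "\<theta> (monomial Ks) \<approx> \<mu> \<cdot> b"
    using \<theta>_monomial_rot[OF Ks(1)] Js(1) Ks(2) by auto
  have "\<theta> ((c * inverse \<mu>) \<cdot> monomial Ks + f) \<approx> (c * inverse \<mu>) \<cdot> (\<mu> \<cdot> b) + g"
    unfolding lin_simps[OF lin_\<theta>] by (intro cong_add cong_scale \<mu>(2) f(2))
  also have "\<dots> = c \<cdot> b + g" using \<mu>(1) by simp
  finally have "\<theta> ((c * inverse \<mu>) \<cdot> monomial Ks + f) \<approx> c \<cdot> b + g" .
  moreover have "(c * inverse \<mu>) \<cdot> monomial Ks + f \<in> Gr"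
    by (intro A.S_add A.S_scale monomial_Gr Ks(1) f(1))
  ultimately show ?case unfolding Gr_def by blast
qed

lemma rotation_bij: "bij_betw rotation (carrier (qgrass q m n)) (carrier (qgrass q m n))"
  unfolding bij_betw_def
proof
  show "inj_on rotation (carrier (qgrass q m n))"
  proof (rule inj_onI)
    fix C D assume "C \<in> carrier (qgrass q m n)" "D \<in> carrier (qgrass q m n)" and eq: "rotation C = rotation D"
    then obtain f g where f: "C = cls f" "f \<in> Gr" and g: "D = cls g" "g \<in> Gr"
      by (auto simp: A.B_carrier)
    have "\<theta> f \<approx> \<theta> g" using eq f g by (simp add: rotation_cls cls_\<theta>_eq_iff)
    then have "\<theta> (f - g) \<in> \<R>" by (simp add: cong_def lin_diff[OF lin_\<theta>])
    with nc.subspace_diff[OF A.S_subspace f(2) g(2)] have "f - g \<in> \<R>" by (rule \<theta>_injective)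
    then show "C = D"
      unfolding f(1) g(1) cls_eq_iff[OF A.S_F[OF f(2)] A.S_F[OF g(2)]] cong_def .
  qed
  show "rotation ` carrier (qgrass q m n) = carrier (qgrass q m n)"
  proof (intro equalityI subsetI)
    fix C assume "C \<in> rotation ` carrier (qgrass q m n)"
    then obtain f where f: "C = cls (\<theta> f)" "f \<in> Gr" by (auto simp: A.B_carrier rotation_cls)
    obtain g where g: "g \<in> Gr" "\<theta> f \<approx> g" using \<theta>_Gr[OF f(2)] by auto
    have "C = cls g"
      unfolding f(1) cls_eq_iff[OF \<theta>_free_alg A.S_F[OF g(1)]] by (rule g(2))
    with g(1) show "C \<in> carrier (qgrass q m n)" by (simp add: A.B_carrier)
  next
    fix C assume "C \<in> carrier (qgrass q m n)"
    then obtain g where g: "C = cls g" "g \<in> Gr" by (auto simp: A.B_carrier)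
    obtain f where f: "f \<in> Gr" "\<theta> f \<approx> g" using \<theta>_surjective[OF g(2)] by auto
    have "rotation (cls f) = C"
      unfolding g(1) rotation_cls[OF f(1)] cls_eq_iff[OF \<theta>_free_alg A.S_F[OF g(2)]] by (rule f(2))
    with f(1) show "C \<in> rotation ` carrier (qgrass q m n)" by (auto simp: A.B_carrier)
  qed
qed

lemma rotation_alg_iso: "rotation \<in> alg_iso twisted (qgrass q m n)"
proof -
  let ?A = "qgrass q m n"
  have "rotation \<in> ring_hom twisted ?A"
  proof (rule ring_hom_memI)
    fix C assume "C \<in> carrier twisted"
    then show "rotation C \<in> carrier ?A" using rotation_bij by (auto simp: bij_betw_def)
  next
    fix C D assume "C \<in> carrier twisted" "D \<in> carrier twisted"
    then obtain f g where f: "C = cls f" "f \<in> Gr" and g: "D = cls g" "g \<in> Gr" by (auto simp: A.B_carrier)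
    have "rotation (C \<otimes>\<^bsub>twisted\<^esub> D) = cls (\<theta> (twisted_product f g))"
      using f g by (simp add: twisted_mult rotation_cls twisted_product_Gr)
    also have "\<dots> = cls (\<theta> f * \<theta> g)"
      using \<theta>_twisted_product[OF f(2) g(2)] by (simp add: cls_eq_iff \<theta>_free_alg free_alg_closed)
    finally show "rotation (C \<otimes>\<^bsub>twisted\<^esub> D) = rotation C \<otimes>\<^bsub>?A\<^esub> rotation D"
      using f g by (simp add: rotation_cls A.B_simps \<theta>_free_alg)
    show "rotation (C \<oplus>\<^bsub>twisted\<^esub> D) = rotation C \<oplus>\<^bsub>?A\<^esub> rotation D"
      using f g by (simp add: rotation_cls A.B_simps \<theta>_free_alg A.S_F A.S_add lin_add[OF lin_\<theta>])
  next
    show "rotation \<one>\<^bsub>twisted\<^esub> = \<one>\<^bsub>?A\<^esub>"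
      by (simp add: twisted_one rotation_cls A.S_one \<theta>_one A.B_simps)
  qed
  moreover have "rotation (k \<odot>\<^bsub>twisted\<^esub> C) = k \<odot>\<^bsub>?A\<^esub> rotation C" if C: "C \<in> carrier twisted" for k C
  proof -
    obtain f where "C = cls f" "f \<in> Gr" using C by (auto simp: A.B_carrier)
    then show ?thesis
      by (simp add: rotation_cls A.B_simps \<theta>_free_alg A.S_F A.S_scale lin_scale[OF lin_\<theta>])
  qed
  ultimately show ?thesis
    using rotation_bij by (simp add: alg_iso_def ring_iso_def)
qed

lemma rotation_qplucker:
  assumes J: "J \<in> \<G>"
  shows "rotation (qplucker q m n J) = (if n \<in> J then inverse q ^ 2 else 1) \<odot>\<^bsub>qgrass q m n\<^esub> qplucker q m n (rot J)"
proof -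
  have "plucker J \<in> Gr" using monomial_Gr[of "[J]"] J by simp
  then have "rotation (qplucker q m n J) = cls (\<theta> (plucker J))"
    using J by (simp add: qplucker_eq rotation_cls)
  also have "\<dots> = cls ((if n \<in> J then inverse q ^ 2 else 1) \<cdot> plucker (rot J))"
    unfolding cls_eq_iff[OF \<theta>_free_alg free_alg_closed(4)[OF plucker_free_alg[OF rot_grass[OF J]]]]
    by (rule \<theta>_plucker[OF J])
  finally show ?thesis
    using J by (simp only: qplucker_eq rot_grass A.B_simps plucker_free_alg)
qed

end

theorem theorem5p9:
  fixes p q :: "'k::field" and m n :: nat
  assumes "q \<noteq> 0" and "0 < m" and "m < n" and "p ^ m = q ^ 2"
  shows "\<exists>\<theta> \<in> alg_iso (qgrass_twist p q m n) (qgrass q m n).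
    \<forall>J. J \<subseteq> {1..n} \<and> card J = m \<longrightarrow>
      (Max J < n \<longrightarrow> \<theta> (qplucker q m n J) = qplucker q m n (Suc ` J)) \<and>
      (Max J = n \<longrightarrow>
         \<theta> (qplucker q m n J) =
           q powi (-2) \<odot>\<^bsub>qgrass q m n\<^esub> qplucker q m n (insert 1 (Suc ` (J - {n}))))"
proof -
  interpret qgrass_twisting q m n p
    using assms by unfold_locales
  have "(Max J < n \<longrightarrow> rotation (qplucker q m n J) = qplucker q m n (Suc ` J)) \<and>
      (Max J = n \<longrightarrow> rotation (qplucker q m n J) =
           q powi (-2) \<odot>\<^bsub>qgrass q m n\<^esub> qplucker q m n (insert 1 (Suc ` (J - {n}))))"
    if "J \<subseteq> {1..n} \<and> card J = m" for J
  proof -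
    have J: "J \<in> \<G>" using that by (simp add: grass_indices_def)
    have ne: "finite J" "J \<noteq> {}" using that assms(2) by (auto intro: card_ge_0_finite)
    show ?thesis
    proof (intro conjI impI)
      assume "Max J < n"
      then have "n \<notin> J" using ne by auto
      then have "rotation (qplucker q m n J) = 1 \<odot>\<^bsub>qgrass q m n\<^esub> qplucker q m n (Suc ` J)"
        and SJ: "Suc ` J \<in> \<G>"
        using rotation_qplucker[OF J] rot_early[OF J] rot_grass[OF J] by simp_all
      then show "rotation (qplucker q m n J) = qplucker q m n (Suc ` J)"
        unfolding qplucker_eq[OF SJ] A.B_simps(5)[OF plucker_free_alg[OF SJ]] nc.scale_one by simp
    next
      assume "Max J = n"
      then have "n \<in> J" using Max_in[OF ne] by simp
      moreover have "q powi (-2) = inverse q ^ 2" by (simp add: power_int_minus power_inverse)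
      ultimately show "rotation (qplucker q m n J) =
           q powi (-2) \<odot>\<^bsub>qgrass q m n\<^esub> qplucker q m n (insert 1 (Suc ` (J - {n})))"
        using rotation_qplucker[OF J] rot_late[OF J] by simp
    qed
  qed
  then show ?thesis using rotation_alg_iso by blast
qed

end
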